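(* Let $\mathbf a\in\mathfrak a^+$. Let $C_1$ and $C_2$ be measurable subsets of $\mathbf S^{m-1}$ and $\mathbf S^{n-1}$, respectively, with measure zero boundaries with respect to $\lambda_{\mathbf S^{m-1}}$ and $\lambda_{\mathbf S^{n-1}}$, respectively. As $T\to\infty$, $$N_R(T,A)(C_1,C_2)\sim\lambda^{m+n}(E_{T,R}(C_1,C_2))$$ holds for $\lambda^{mn}$-almost every $A\in\mathrm{Mat}_{m\times n}(\mathbf K)$.
   Context: Let $\mathbb F_q$ be the finite field of order $q$, $\mathbf K=\mathbb F_q((t^{-1}))$ with absolute value $|f|=q^{\deg f}$, $\mathbf Z=\mathbb F_q[t]$, and $\mathcal O=\mathbb F_q[[t^{-1}]]$. Let $\lambda$ be the Haar measure on $\mathbf K$ normalized by $\lambda(\mathcal O)=1$, and $\lambda^k$ the product measure on $\mathbf K^k$ (so $\lambda^{mn}$ is a Haar measure on $\mathrm{Mat}_{m\times n}(\mathbf K)$). Let $m,n\in\mathbb N$, $d=m+n$, and let $\mathfrak a^+$ be the set of $\mathbf a=(a_1,\dots,a_d)\in\mathbb N^d$ with $\sum_{i=1}^m a_i=\sum_{j=1}^n a_{m+j}$ ($\mathbb N$ being the positive integers). Given $\mathbf a\in\mathfrak a^+$ let $\|\mathbf x\|_\alpha=\max_{1\le i\le m}|x_i|^{1/a_i}$ for $\mathbf x\in\mathbf K^m$ and $\|\mathbf y\|_\beta=\max_{1\le j\le n}|y_j|^{1/a_{m+j}}$ for $\mathbf y\in\mathbf K^n$. $R$ is a fixed real parameter.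 Let $\mathbf S^{m-1}=\{\mathbf x\in\mathbf K^m:\|\mathbf x\|_\infty=1\}$ (supremum norm), and similarly $\mathbf S^{n-1}\subset\mathbf K^n$; $\lambda_{\mathbf S^{m-1}},\lambda_{\mathbf S^{n-1}}$ are the measures on them induced from $\mathbf K^m,\mathbf K^n$. For $\mathbf x\in\mathbf K^m$, $\pi_\alpha(\mathbf x)$ is the point of $\{(t^{ka_1}x_1,\dots,t^{ka_m}x_m):k\in\mathbb Z\}\cap\mathbf S^{m-1}$ (when it exists); for $\mathbf y\in\mathbf K^n$, $\pi_\beta(\mathbf y)$ is the point of $\{(t^{ka_{m+1}}y_1,\dots,t^{ka_{m+n}}y_n):k\in\mathbb Z\}\cap\mathbf S^{n-1}$ (when it exists). A condition $\pi_\alpha(\mathbf x)\in C_1$ or $\pi_\beta(\mathbf y)\in C_2$ means that the point exists and lies in the set. Define $$E_{T,R}(C_1,C_2)=\left\{(\mathbf x,\mathbf y)\in\mathbf K^m\times\mathbf K^n:\|\mathbf x\|_\alpha<\frac{q^R}{\|\mathbf y\|_\beta},\ 1\le\|\mathbf y\|_\beta\le q^T,\ \pi_\alpha(\mathbf x)\in C_1,\ \pi_\beta(\mathbf y)\in C_2\right\}.$$ $N_R(T,A)(C_1,C_2)$ is the number of nonzero $(\mathbf p,\mathbf q)\in\mathbf Z^m\times\mathbf Z^n$ with $\|A\mathbf q-\mathbf p\|_\alpha<q^R/\|\mathbf q\|_\beta$, $1\le\|\mathbf q\|_\beta\le q^T$, $\pi_\alpha(A\mathbf q-\mathbf p)\in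 C_1$ and $\pi_\beta(\mathbf q)\in C_2$. The relation $f(T)\sim g(T)$ means that $f(T)/g(T)\to1$.
   Formalization: The Haar measure is normalized so that t^{-1}O (not O) has measure 1, since with λ(O)=1 the count is asymptotic to q^{m+n} times the volume; λ^{m+n}(E_{T,R}(C_1,C_2)) is assumed nonzero for all large T, so that the quotient is defined. *)

theory Defs
  imports "HOL-Analysis.Analysis" "HOL-Computational_Algebra.Formal_Laurent_Series"
begin

text \<open>
  The field \<open>K = F_q((1/t))\<close> is the library type \<open>'a fls\<close> with \<open>'a\<close> a finite field,
  \<open>q = CARD('a)\<close>, and the formal variable \<open>fls_X\<close> standing for \<open>1/t\<close>; hence \<open>t\<close> is \<open>fls_X_inv\<close>
  and the degree of \<open>f\<close> in \<open>t\<close> is \<open>- fls_subdegree f\<close>.  The library metric on \<open>'a fls\<close> uses the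
  base 2 instead of \<open>q\<close>, which gives the same topology as \<open>kabs\<close>.

  A vector in \<open>K^k\<close> is an extensional function on \<open>{1..k}\<close>, so that it lives in the space of the
  product measure \<open>PiM {1..k}\<close>, and a matrix in \<open>Mat m n K\<close> an extensional function on
  \<open>{1..m} \<times> {1..n}\<close>.
\<close>

definition kabs :: "'a::{field,finite} fls \<Rightarrow> real" where
  "kabs f = (if f = 0 then 0 else real CARD('a) powi (- fls_subdegree f))"

definition polyZ :: "'a::{field,finite} fls set" where
  "polyZ = range (\<lambda>p :: 'a poly. poly (map_poly fls_const p) fls_X_inv)"

definition kvec :: "nat \<Rightarrow> (nat \<Rightarrow> 'a::{field,finite} fls) set" where
  "kvec k = ({1..k} \<rightarrow>\<^sub>E UNIV)"

definition kvec_topology :: "nat \<Rightarrow> (nat \<Rightarrow> 'a::{field,finite} fls) topology" where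
  "kvec_topology k = product_topology (\<lambda>_. euclidean) {1..k}"

definition haar_measure :: "'a::{field,finite} fls measure \<Rightarrow> bool" where
  "haar_measure M \<longleftrightarrow>
     sets M = sets borel \<and>
     (\<forall>c. \<forall>B \<in> sets borel. emeasure M ((\<lambda>x. c + x) ` B) = emeasure M B) \<and>
     (\<forall>C. compact C \<longrightarrow> emeasure M C < \<infinity>) \<and>
     (\<forall>U. open U \<and> U \<noteq> {} \<longrightarrow> emeasure M U > 0)"

text \<open>
  Only the normalization of the Haar measure matters for an asymptotic count of points of the lattice
  \<open>F_q[t]^(m+n)\<close>.  The open unit ball \<open>{x. kabs x < 1} = (1/t) F_q[[1/t]]\<close> is a fundamental domain
  for the translations by \<open>F_q[t]\<close> on \<open>K\<close>, so the condition below says that \<open>F_q[t]\<close> has covolume 1.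
  It gives the ring of integers \<open>F_q[[1/t]]\<close> measure \<open>q\<close>.  With measure 1 for the ring of integers,
  the covolume of \<open>F_q[t]^(m+n)\<close> would be \<open>q^-(m+n)\<close>, and the count would be asymptotic to
  \<open>q^(m+n)\<close> times the volume.
\<close>

definition unimodular_normalization :: "'a::{field,finite} fls measure \<Rightarrow> bool" where
  "unimodular_normalization M \<longleftrightarrow> emeasure M {x. kabs x < 1} = 1"

definition vec_measure ::
    "'a::{field,finite} fls measure \<Rightarrow> nat \<Rightarrow> (nat \<Rightarrow> 'a fls) measure" where
  "vec_measure M k = PiM {1..k} (\<lambda>_. M)"

definition mat_measure ::
    "'a::{field,finite} fls measure \<Rightarrow> nat \<Rightarrow> nat \<Rightarrow> (nat \<times> nat \<Rightarrow> 'a fls) measure" where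
  "mat_measure M m n = PiM ({1..m} \<times> {1..n}) (\<lambda>_. M)"

text \<open>The completion makes the non-Borel Haar-measurable sets measurable as well.\<close>

definition pair_vec_measure ::
    "'a::{field,finite} fls measure \<Rightarrow> nat \<Rightarrow> nat
      \<Rightarrow> ((nat \<Rightarrow> 'a fls) \<times> (nat \<Rightarrow> 'a fls)) measure" where
  "pair_vec_measure M m n = completion (vec_measure M m \<Otimes>\<^sub>M vec_measure M n)"

definition weights :: "nat \<Rightarrow> nat \<Rightarrow> (nat \<Rightarrow> nat) set" where
  "weights m n = {a. (\<forall>i\<in>{1..m+n}. 0 < a i) \<and> (\<Sum>i=1..m. a i) = (\<Sum>j=1..n. a (m + j))}"

definition qnorm :: "nat \<Rightarrow> (nat \<Rightarrow> nat) \<Rightarrow> (nat \<Rightarrow> 'a::{field,finite} fls) \<Rightarrow> real" where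
  "qnorm k w x = Max ((\<lambda>i. kabs (x i) powr (1 / real (w i))) ` {1..k})"

definition ksphere :: "nat \<Rightarrow> (nat \<Rightarrow> 'a::{field,finite} fls) set" where
  "ksphere k = {x \<in> kvec k. Max ((\<lambda>i. kabs (x i)) ` {1..k}) = 1}"

text \<open>The unit sphere is open in \<open>K^k\<close>, so it carries the restriction of the Haar measure.\<close>

definition sphere_measure ::
    "'a::{field,finite} fls measure \<Rightarrow> nat \<Rightarrow> (nat \<Rightarrow> 'a fls) measure" where
  "sphere_measure M k = completion (restrict_space (vec_measure M k) (ksphere k))"

definition sphere_topology :: "nat \<Rightarrow> (nat \<Rightarrow> 'a::{field,finite} fls) topology" where
  "sphere_topology k = subtopology (kvec_topology k) (ksphere k)"

definition dilation_orbit ::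
    "nat \<Rightarrow> (nat \<Rightarrow> nat) \<Rightarrow> (nat \<Rightarrow> 'a::{field,finite} fls) \<Rightarrow> (nat \<Rightarrow> 'a fls) set" where
  "dilation_orbit k w x =
     range (\<lambda>l::int. \<lambda>i\<in>{1..k}. fls_X_inv powi (l * int (w i)) * x i)"

text \<open>The projection of \<open>x\<close> to the sphere along its orbit exists and lies in \<open>C\<close>.\<close>

definition direction_in ::
    "nat \<Rightarrow> (nat \<Rightarrow> nat) \<Rightarrow> (nat \<Rightarrow> 'a::{field,finite} fls) \<Rightarrow> (nat \<Rightarrow> 'a fls) set \<Rightarrow> bool" where
  "direction_in k w x C \<longleftrightarrow> (\<exists>z. dilation_orbit k w x \<inter> ksphere k = {z} \<and> z \<in> C)"

definition E_set ::
    "nat \<Rightarrow> nat \<Rightarrow> (nat \<Rightarrow> nat) \<Rightarrow> real \<Rightarrow> real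
      \<Rightarrow> (nat \<Rightarrow> 'a::{field,finite} fls) set \<Rightarrow> (nat \<Rightarrow> 'a fls) set
      \<Rightarrow> ((nat \<Rightarrow> 'a fls) \<times> (nat \<Rightarrow> 'a fls)) set" where
  "E_set m n a T R C1 C2 =
     {(x, y) \<in> kvec m \<times> kvec n.
        qnorm m a x < real CARD('a) powr R / qnorm n (\<lambda>j. a (m + j)) y \<and>
        1 \<le> qnorm n (\<lambda>j. a (m + j)) y \<and> qnorm n (\<lambda>j. a (m + j)) y \<le> real CARD('a) powr T \<and>
        direction_in m a x C1 \<and> direction_in n (\<lambda>j. a (m + j)) y C2}"

definition approx_error ::
    "nat \<Rightarrow> nat \<Rightarrow> (nat \<times> nat \<Rightarrow> 'a::{field,finite} fls)
      \<Rightarrow> (nat \<Rightarrow> 'a fls) \<Rightarrow> (nat \<Rightarrow> 'a fls) \<Rightarrow> (nat \<Rightarrow> 'a fls)" where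
  "approx_error m n A p v = (\<lambda>i\<in>{1..m}. (\<Sum>j=1..n. A (i, j) * v j) - p i)"

definition N_count ::
    "nat \<Rightarrow> nat \<Rightarrow> (nat \<Rightarrow> nat) \<Rightarrow> real \<Rightarrow> real \<Rightarrow> (nat \<times> nat \<Rightarrow> 'a::{field,finite} fls)
      \<Rightarrow> (nat \<Rightarrow> 'a fls) set \<Rightarrow> (nat \<Rightarrow> 'a fls) set \<Rightarrow> nat" where
  "N_count m n a R T A C1 C2 =
     card {(p, v) \<in> ({1..m} \<rightarrow>\<^sub>E polyZ) \<times> ({1..n} \<rightarrow>\<^sub>E polyZ).
        \<not> ((\<forall>i\<in>{1..m}. p i = 0) \<and> (\<forall>j\<in>{1..n}. v j = 0)) \<and>
        qnorm m a (approx_error m n A p v)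
          < real CARD('a) powr R / qnorm n (\<lambda>j. a (m + j)) v \<and>
        1 \<le> qnorm n (\<lambda>j. a (m + j)) v \<and> qnorm n (\<lambda>j. a (m + j)) v \<le> real CARD('a) powr T \<and>
        direction_in m a (approx_error m n A p v) C1 \<and> direction_in n (\<lambda>j. a (m + j)) v C2}"

end

theory Submission
  imports Defs "HOL-Probability.Probability"
begin

text \<open>
  Write \<open>a\<^sub>i\<close>, \<open>b\<^sub>j = a\<^sub>m\<^sub>+\<^sub>j\<close> for the two halves of the weights, \<open>K\<close> for the Laurent series field with its
  subring \<open>Z = F_q[t]\<close>, and \<open>D_s\<close> for the dilation that multiplies the coordinate of weight \<open>w\<close> by \<open>t^(s w)\<close>.
  The projections to the spheres exist only for quasinorms \<open>q^s\<close> with \<open>s\<close> an integer. The region of the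
  theorem therefore splits into shells \<open>s = 0, 1, ..., \<lfloor>T\<rfloor>\<close>, in which \<open>D_{-s} y\<close> lies in \<open>C2\<close> and \<open>D_s x\<close>
  in a fixed bounded set, the \<open>target\<close> (\<open>region_iff\<close>). The two weight sums are equal, hence all shells
  have the same volume, and the volume of the region is proportional to \<open>\<lfloor>T\<rfloor> + 1\<close>.

  The count is a sum over shells as well. In shell \<open>s\<close> there is a number of vectors \<open>v\<close> proportional to
  \<open>q^(s wt)\<close>, where \<open>wt\<close> is the sum of the weights \<open>a\<^sub>i\<close>, and the question is how many of them have
  \<open>A v\<close> modulo \<open>Z^m\<close> in \<open>D_{-s}\<close> of the target, a set of volume proportional to \<open>q^(-s wt)\<close>. For random
  \<open>A\<close> the vector \<open>A v\<close> is uniformly distributed modulo \<open>Z^m\<close>, so the mean per shell converges to the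
  right constant, and it remains to prove a strong law of large numbers. This is done by second
  moments:

  \<^item> Digits after the point of \<open>A v\<close> are additive functionals of \<open>A\<close> with values in \<open>F_q\<close>; jointly
    surjective families of such functionals are equidistributed (\<open>functionals_equidistributed\<close>). Hence
    the events for \<open>v\<close> and \<open>w\<close> are exactly independent unless \<open>v = f u\<close> and \<open>w = h u\<close> with coprime
    polynomials \<open>f\<close>, \<open>h\<close> whose degrees are below a bound linear in \<open>s\<close> (\<open>good_pair\<close>).

  \<^item> The remaining pairs are counted by triples \<open>(f, h, u)\<close>. Their contribution is linear in the number
    of shells, with one exception: if \<open>A u\<close> is extremely close to \<open>Z^m\<close>, then many multiples of \<open>u\<close>
    are counted at once. In the case \<open>m = n = 1\<close> this makes the variance quadratic. Solutions \<open>(p, v)\<close>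
    divisible by a polynomial of degree above \<open>L\<close> are therefore removed; in the mean this
    loses a fraction of order \<open>q^-L\<close> of the solutions (\<open>truncation_cost\<close>), and up to this loss the
    variance of what remains is of order \<open>N (L + 1)\<close> for \<open>N\<close> shells (\<open>bad_sum\<close>, \<open>variance_bound\<close>).
    Taking \<open>L = k\<close> along \<open>N = k^3\<close> and interpolating monotonically gives the almost sure limit
    (\<open>hits_law\<close>).

  This argument needs a target that is a finite union of boxes. The assumption on the frontiers makes
  the target and \<open>C2\<close> Jordan measurable (\<open>jordan_approximation\<close>), so both are squeezed between such
  sets of nearly equal volume, and the count and the volume are squeezed together (\<open>sandwiched_ratio\<close>).\<close>

unbundle fps_syntax

section \<open>Polynomials in the Laurent series field\<close>

definition emb :: "'a::{field,finite} poly \<Rightarrow> 'a fls" where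
  "emb p = poly (map_poly fls_const p) fls_X_inv"

lemma emb_0 [simp]: "emb 0 = 0"
  by (simp add: emb_def)

lemma emb_pCons: "emb (pCons c p) = fls_const c + fls_X_inv * emb p"
  by (simp add: emb_def map_poly_pCons)

lemma emb_nth: "emb p $$ k = (if k \<le> 0 then coeff p (nat (- k)) else 0)"
proof (induction p arbitrary: k)
  case 0
  then show ?case by simp
next
  case (pCons c p)
  have e: "nat (- k) = Suc (nat (- (k + 1)))" if "k < 0" for k :: int
    using that by simp
  have "emb (pCons c p) $$ k = (if k = 0 then c else 0) + emb p $$ (k + 1)"
    by (simp add: emb_pCons fls_X_inv_times_conv_shift)
  then show ?case
    by (cases "k < 0") (auto simp: pCons.IH e coeff_pCons split: nat.splits)
qed

lemma emb_add: "emb (p + r) = emb p + emb r"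
  by (rule fls_eqI) (simp add: emb_nth)

lemma emb_uminus: "emb (- p) = - emb p"
  by (rule fls_eqI) (simp add: emb_nth)

lemma emb_diff: "emb (p - r) = emb p - emb r"
  by (rule fls_eqI) (simp add: emb_nth)

lemma emb_smult: "emb (smult c p) = fls_const c * emb p"
  by (rule fls_eqI) (simp add: emb_nth)

lemma emb_mult: "emb (p * r) = emb p * emb r"
proof (induction p)
  case 0
  then show ?case by simp
next
  case (pCons c p)
  have "emb (pCons c p * r) = emb (smult c r) + emb (pCons 0 (p * r))"
    by (simp add: mult_pCons_left emb_add)
  also have "\<dots> = emb (pCons c p) * emb r"
    by (simp add: emb_smult emb_pCons pCons.IH algebra_simps)
  finally show ?case .
qed

lemma emb_1 [simp]: "emb 1 = 1"
  by (rule fls_eqI) (auto simp: emb_nth)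

lemma emb_eq_iff [simp]: "emb p = emb r \<longleftrightarrow> p = r"
proof
  assume h: "emb p = emb r"
  show "p = r"
  proof (rule poly_eqI)
    fix n
    have "emb p $$ (- int n) = emb r $$ (- int n)" using h by simp
    then show "coeff p n = coeff r n" by (simp add: emb_nth)
  qed
qed simp

lemma emb_eq_0_iff [simp]: "emb p = 0 \<longleftrightarrow> p = 0"
  using emb_eq_iff[of p 0] by (simp del: emb_eq_iff)

lemma polyZ_eq: "polyZ = range emb"
  by (simp add: polyZ_def emb_def[abs_def])

lemma emb_subdegree: "p \<noteq> 0 \<Longrightarrow> fls_subdegree (emb p) = - int (degree p)"
  by (rule fls_subdegree_eqI) (auto simp: emb_nth coeff_eq_0 leading_coeff_neq_0)

lemma countable_poly: "countable (UNIV :: 'a::{zero,finite} poly set)"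
proof -
  have "(UNIV :: 'a poly set) = Poly ` UNIV"
    by (metis Poly_coeffs UNIV_I image_eqI subsetI subset_antisym subset_UNIV)
  then show ?thesis
    by (metis countable_image countableI_type)
qed

text \<open>
  In terms of the absolute value this is the ball \<open>|x| < q^(-k)\<close>. It is a subgroup of \<open>K\<close>, and so its
  translates are cosets.\<close>

definition vball :: "int \<Rightarrow> 'a::zero fls set" where
  "vball k = {x. \<forall>j\<le>k. x $$ j = 0}"

lemma vball_0 [simp]: "0 \<in> vball k"
  by (simp add: vball_def)

lemma vball_iff: "x \<in> vball k \<longleftrightarrow> x = 0 \<or> k < fls_subdegree x"
proof
  assume "x \<in> vball k"
  then show "x = 0 \<or> k < fls_subdegree x"
    using nth_fls_subdegree_nonzero[of x] by (force simp: vball_def not_less)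
next
  assume "x = 0 \<or> k < fls_subdegree x"
  then show "x \<in> vball k" by (auto simp: vball_def)
qed

lemma vball_add: "x \<in> vball k \<Longrightarrow> y \<in> vball k \<Longrightarrow> x + y \<in> vball k"
  for x y :: "'a::monoid_add fls"
  by (simp add: vball_def)

lemma vball_diff: "x \<in> vball k \<Longrightarrow> y \<in> vball k \<Longrightarrow> x - y \<in> vball k"
  for x y :: "'a::group_add fls"
  by (simp add: vball_def)

lemma vball_uminus: "x \<in> vball k \<Longrightarrow> - x \<in> vball k"
  for x y :: "'a::group_add fls"
  by (simp add: vball_def)

lemma vball_mono: "k \<le> l \<Longrightarrow> vball l \<subseteq> vball k"
  by (auto simp: vball_def)

lemma vball_mult_emb:
  assumes "x \<in> vball k" "int (degree p) \<le> d"
  shows "emb p * x \<in> vball (k - d)"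
  using assms by (cases "x = 0"; cases "p = 0") (auto simp: vball_iff emb_subdegree)

lemma vball_mult_emb_cancel:
  assumes "emb p * x \<in> vball k" "p \<noteq> 0"
  shows "x \<in> vball (k + int (degree p))"
  using assms by (cases "x = 0") (auto simp: vball_iff emb_subdegree)

lemma emb_vball_0: "emb p \<in> vball 0 \<Longrightarrow> p = 0"
  by (cases "p = 0") (auto simp: vball_iff emb_subdegree)

text \<open>
  \<open>K\<close> is the direct sum of the polynomials and of \<open>vball 0\<close>; the two functions below are the
  projections to the summands. Reduction modulo \<open>F_q[t]\<close> is represented by \<open>fpart\<close>.\<close>

definition ppart :: "'a::{field,finite} fls \<Rightarrow> 'a poly" where
  "ppart x = (SOME p. x - emb p \<in> vball 0)"

definition fpart :: "'a::{field,finite} fls \<Rightarrow> 'a fls" where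
  "fpart x = x - emb (ppart x)"

lemma ex_ppart: "\<exists>p. x - emb p \<in> vball 0"
proof -
  define c where "c = (\<lambda>n. x $$ (- int n))"
  have "\<forall>\<^sub>\<infinity> n. c n = 0"
    unfolding MOST_nat c_def
    by (intro exI[of _ "nat (- fls_subdegree x)"]) auto
  then have "coeff (Abs_poly c) = c"
    by (simp add: Abs_poly_inverse)
  then have "x - emb (Abs_poly c) \<in> vball 0"
    by (simp add: vball_def emb_nth c_def)
  then show ?thesis by blast
qed

lemma fpart_vball [simp]: "fpart x \<in> vball 0"
  unfolding fpart_def ppart_def by (rule someI_ex[OF ex_ppart])

lemma fpart_eqI: "y \<in> vball 0 \<Longrightarrow> x - y = emb p \<Longrightarrow> fpart x = y"
proof -
  assume y: "y \<in> vball 0" and e: "x - y = emb p"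
  have "emb (p - ppart x) = fpart x - y"
    using e by (simp add: fpart_def emb_diff algebra_simps)
  also have "\<dots> \<in> vball 0" using y by (intro vball_diff) auto
  finally have "p = ppart x" using emb_vball_0 by fastforce
  then show "fpart x = y" using e by (simp add: fpart_def algebra_simps)
qed

lemma fpart_nth: "fpart x $$ k = (if k \<le> 0 then 0 else x $$ k)"
proof (cases "k \<le> 0")
  case True
  then show ?thesis using fpart_vball[of x] by (auto simp: vball_def simp del: fpart_vball)
next
  case False
  then show ?thesis by (simp add: fpart_def emb_nth)
qed

section \<open>The Haar measure of the Laurent series field\<close>

definition kball :: "'a::{field,finite} fls \<Rightarrow> int \<Rightarrow> 'a fls set" where
  "kball x k = {y. y - x \<in> vball k}"

lemma kball_0: "kball 0 k = vball k"
  by (simp add: kball_def)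

lemma kball_self [simp]: "x \<in> kball x k"
  by (simp add: kball_def)

lemma kball_eq: "y \<in> kball x k \<Longrightarrow> kball y k = kball x k"
  by (auto simp: kball_def vball_def)

lemma kball_mono: "k \<le> l \<Longrightarrow> kball x l \<subseteq> kball x k"
  using vball_mono[of k l] by (auto simp: kball_def)

lemma open_kball: "open (kball x k)"
  unfolding open_fls_def
proof (intro ballI exI conjI subsetI)
  fix y z assume y: "y \<in> kball x k" and z: "z \<in> {z. dist z y < inverse (2 ^ nat k)}"
  have "z - y \<in> vball k"
  proof (cases "z = y")
    case False
    have d: "dist z y < inverse (2 ^ nat k)" using z by simp
    show ?thesis
    proof (cases "fls_subdegree (z - y) \<ge> 0")
      case True
      then have "inverse (2 ^ nat (fls_subdegree (z - y))) < (inverse (2 ^ nat k) :: real)"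
        using d False by (simp add: dist_fls_def)
      then have "nat k < nat (fls_subdegree (z - y))" by simp
      then show ?thesis by (simp add: vball_iff)
    next
      case neg: False
      have "(1::real) \<le> 2 ^ nat (- fls_subdegree (z - y))" by simp
      moreover have "inverse (2 ^ nat k) \<le> (1::real)" by (simp add: field_simps)
      moreover have "dist z y = 2 ^ nat (- fls_subdegree (z - y))"
        using False neg by (simp add: dist_fls_def)
      ultimately show ?thesis
        using d by linarith
    qed
  qed simp
  then show "z \<in> kball x k"
    using y kball_eq[OF y] by (auto simp: kball_def)
qed simp

lemma open_contains_kball_fls:
  assumes "open S" "x \<in> S"
  shows "\<exists>k\<ge>l. kball x k \<subseteq> S"
proof -
  obtain r where r: "r > 0" "{y. dist y x < r} \<subseteq> S"
    using assms by (auto simp: open_fls_def)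
  obtain n where n: "(1/2::real) ^ n < r"
    using real_arch_pow_inv[of r "1/2"] r by auto
  define k where "k = max l (int n)"
  have "kball x k \<subseteq> S"
  proof
    fix y assume y: "y \<in> kball x k"
    have "dist y x < r"
    proof (cases "y = x")
      case False
      with y have s: "k < fls_subdegree (y - x)" by (auto simp: kball_def vball_iff)
      then have "dist y x = (1/2) ^ nat (fls_subdegree (y - x))"
        using False by (auto simp: dist_fls_def k_def power_one_over inverse_eq_divide)
      also have "\<dots> \<le> (1/2) ^ n" using s by (intro power_decreasing) (auto simp: k_def)
      finally show ?thesis using n by simp
    qed (use r in simp)
    with r show "y \<in> S" by auto
  qed
  moreover have "l \<le> k" by (simp add: k_def)
  ultimately show ?thesis by blast
qed

text \<open>
  A centre for the ball of radius \<open>q^(-k)\<close> around \<open>x\<close>, taken from a countable set of centres.\<close>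

definition trunc :: "int \<Rightarrow> 'a::{field,finite} fls \<Rightarrow> 'a fls" where
  "trunc k x = fls_shift (- k) (emb (ppart (fls_shift k x)))"

lemma trunc_kball: "x \<in> kball (trunc k x) k"
proof -
  have "fls_shift k (x - trunc k x) = fpart (fls_shift k x)"
    by (simp add: trunc_def fpart_def)
  then have "fls_shift k (x - trunc k x) \<in> vball 0"
    by simp
  then have "\<And>j. j \<le> 0 \<Longrightarrow> (x - trunc k x) $$ (j + k) = 0"
    by (simp add: vball_def del: fls_minus_nth fls_shift_minus)
  from this[of "_ - k"] show ?thesis
    by (simp add: kball_def vball_def del: fls_minus_nth)
qed

lemma countable_range_trunc: "countable (range (trunc k :: 'a::{field,finite} fls \<Rightarrow> _))"
proof (rule countable_subset)
  show "range (trunc k :: 'a fls \<Rightarrow> _) \<subseteq> range (\<lambda>p. fls_shift (- k) (emb p))"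
    by (auto simp: trunc_def)
qed (intro countable_image countable_poly)

text \<open>
  Every open set is a union of balls, and countably many balls suffice because their centres can be
  truncated. So the balls determine a measure.\<close>

lemma sets_borel_fls:
  "sets (borel :: 'a::{field,finite} fls measure)
     = sigma_sets UNIV (insert {} (range (\<lambda>(x, k). kball x k)))" (is "_ = sigma_sets _ ?B")
proof (rule set_eqI, rule iffI)
  fix A :: "'a fls set"
  assume "A \<in> sets borel"
  then have "A \<in> sigma_sets UNIV {S. open S}" by (simp add: borel_def)
  then show "A \<in> sigma_sets UNIV ?B"
  proof (induction rule: sigma_sets.induct)
    case (Basic S)
    then have S: "open S" by simp
    define F where "F = {(x, k). x \<in> range (trunc k) \<and> kball x k \<subseteq> S}"
    have "countable F"
    proof (rule countable_subset)
      show "F \<subseteq> (\<Union>k. range (trunc k) \<times> {k})" by (auto simp: F_def)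
    qed (auto intro!: countable_UN countable_range_trunc countable_SIGMA)
    have "S = (\<Union>p\<in>F. (\<lambda>(x, k). kball x k) p)"
    proof safe
      fix x assume "x \<in> S"
      then obtain k where k: "kball x k \<subseteq> S" using open_contains_kball_fls[OF S] by blast
      have "kball (trunc k x) k = kball x k" using trunc_kball[of x k] kball_eq by metis
      with k have "(trunc k x, k) \<in> F" by (auto simp: F_def)
      then show "x \<in> (\<Union>p\<in>F. (\<lambda>(x, k). kball x k) p)" using trunc_kball[of x k] by blast
    qed (auto simp: F_def)
    moreover have "(\<Union>p\<in>F. (\<lambda>(x, k). kball x k) p) \<in> sigma_sets UNIV ?B"
    proof (rule sigma_sets_UNION)
      show "countable ((\<lambda>(x, k). kball x k) ` F)" using \<open>countable F\<close> by simp
    qed (auto intro!: sigma_sets.Basic)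
    ultimately show ?case by simp
  qed (auto intro: sigma_sets.intros)
next
  fix A :: "'a fls set"
  assume "A \<in> sigma_sets UNIV ?B"
  then show "A \<in> sets borel"
  proof (induction rule: sigma_sets.induct)
    case (Basic S)
    then show ?case by (auto intro!: borel_open open_kball)
  next
    case (Compl a)
    then show ?case using sets.compl_sets[of a borel] by simp
  qed auto
qed

text \<open>
  In an ultrametric space two balls are nested or disjoint.\<close>

lemma Int_stable_kball:
  "Int_stable (insert {} (range (\<lambda>(x :: 'a::{field,finite} fls, k). kball x k)))"
proof -
  have *: "kball x k \<inter> kball y l \<in> insert {} (range (\<lambda>(x, k). kball x k))" if "k \<le> l" for x y :: "'a fls" and k l
  proof (cases "kball x k \<inter> kball y l = {}")
    case False
    then obtain z where z: "z \<in> kball x k" "z \<in> kball y l" by blast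
    have "kball x k \<inter> kball y l = kball z l"
      using kball_eq[OF z(1)] kball_eq[OF z(2)] kball_mono[OF that, of z] by blast
    then show ?thesis by (auto intro!: image_eqI[of _ _ "(z, l)"])
  qed simp
  show ?thesis
  proof (rule Int_stableI)
    fix A B :: "'a fls set"
    assume A: "A \<in> insert {} (range (\<lambda>(x, k). kball x k))" and B: "B \<in> insert {} (range (\<lambda>(x, k). kball x k))"
    show "A \<inter> B \<in> insert {} (range (\<lambda>(x, k). kball x k))"
    proof (cases "A = {} \<or> B = {}")
      case False
      then obtain x k y l where "A = kball x k" "B = kball y l" using A B by auto
      then show ?thesis using *[of k l x y] *[of l k y x] by (cases "k \<le> l") (simp_all add: Int_commute)
    qed auto
  qed
qed

lemma fls_shift_vimage_kball: "fls_shift k -` kball x l = kball (fls_shift (- k) x) (l + k)"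
proof -
  have "y \<in> fls_shift k -` kball x l \<longleftrightarrow> y \<in> kball (fls_shift (- k) x) (l + k)" for y
  proof -
    have "(\<forall>j\<le>l. y $$ (j + k) - x $$ j = 0) \<longleftrightarrow> (\<forall>j\<le>l + k. y $$ j - x $$ (j - k) = 0)"
      by (metis add_le_cancel_right add_diff_cancel_right' diff_add_cancel)
    then show ?thesis by (simp add: kball_def vball_def)
  qed
  then show ?thesis by blast
qed

lemma borel_measurable_kballI:
  assumes "\<And>x k. f -` kball x k \<in> sets borel"
  shows "f \<in> measurable borel (borel :: 'a::{field,finite} fls measure)"
proof (rule measurable_sigma_sets[OF sets_borel_fls])
  fix A :: "'a fls set" assume "A \<in> insert {} (range (\<lambda>(x, k). kball x k))"
  then show "f -` A \<inter> space borel \<in> sets borel" using assms by auto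
qed auto

lemma fls_shift_borel_measurable [measurable]:
  "fls_shift k \<in> measurable borel (borel :: 'a::{field,finite} fls measure)"
  by (rule borel_measurable_kballI) (simp add: fls_shift_vimage_kball open_kball)

lemma plus_borel_measurable [measurable]:
  "(+) c \<in> measurable borel (borel :: 'a::{field,finite} fls measure)"
proof (rule borel_measurable_kballI)
  fix x :: "'a fls" and k
  have "(+) c -` kball x k = kball (x - c) k"
    by (auto simp: kball_def vball_def algebra_simps)
  then show "(+) c -` kball x k \<in> sets borel" by (simp add: open_kball)
qed

lemma fls_nth_mult_emb_measurable:
  "(\<lambda>x. (x * emb p) $$ k) \<in> measurable borel (count_space (UNIV :: 'a::{field,finite} set))"
proof (rule measurableI)
  fix A :: "'a set"
  have "open ((\<lambda>x. (x * emb p) $$ k) -` A)"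
    unfolding openin_open_eq[symmetric, simplified]
  proof (subst open_subopen, intro ballI exI conjI)
    fix x assume x: "x \<in> (\<lambda>x. (x * emb p) $$ k) -` A"
    show "open (kball x (k + int (degree p)))" by (rule open_kball)
    show "kball x (k + int (degree p)) \<subseteq> (\<lambda>x. (x * emb p) $$ k) -` A"
    proof
      fix y assume "y \<in> kball x (k + int (degree p))"
      then have "emb p * (y - x) \<in> vball (k + int (degree p) - int (degree p))"
        by (intro vball_mult_emb) (auto simp: kball_def)
      then have "(emb p * (y - x)) $$ k = 0" by (simp add: vball_def del: fls_minus_nth)
      then have "(y * emb p) $$ k = (x * emb p) $$ k" by (simp add: algebra_simps)
      with x show "y \<in> (\<lambda>x. (x * emb p) $$ k) -` A" by simp
    qed
  qed simp
  then show "(\<lambda>x. (x * emb p) $$ k) -` A \<inter> space borel \<in> sets borel" by simp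
qed simp

locale haar =
  fixes lam :: "'a::{field,finite} fls measure"
  assumes haar: "haar_measure lam" and unimodular: "unimodular_normalization lam"
begin

definition q :: real where "q = real CARD('a)"

lemma q_ge_2: "q \<ge> 2"
proof -
  have "card {0::'a, 1} \<le> CARD('a)" by (intro card_mono) auto
  then show ?thesis by (simp add: q_def)
qed

lemma q_pos [simp]: "0 < q" "0 \<le> q" "1 < q" "1 \<le> q" "q \<noteq> 0" "\<not> q \<le> 0"
  using q_ge_2 by linarith+

lemma sets_lam [measurable_cong, simp]: "sets lam = sets borel"
  using haar by (simp add: haar_measure_def)

lemma space_lam [simp]: "space lam = UNIV"
  using sets_eq_imp_space_eq[OF sets_lam] by simp

lemma emeasure_translate:
  assumes "B \<in> sets borel" shows "emeasure lam ((+) c -` B) = emeasure lam B"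
proof -
  have "(+) c -` B = (+) (- c) ` B"
    by (auto simp: image_iff intro!: bexI[of _ "c + _"])
  moreover have "emeasure lam ((+) (- c) ` B) = emeasure lam B"
    using haar assms unfolding haar_measure_def by blast
  ultimately show ?thesis by (simp only:)
qed

lemma emeasure_kball: "emeasure lam (kball x k) = emeasure lam (vball k)"
proof -
  have "(+) x -` kball x k = vball k" by (auto simp: kball_def)
  then show ?thesis using emeasure_translate[of "kball x k" x] by (simp add: open_kball)
qed

lemma vball_split:
  "vball k = (\<Union>c::'a. kball (fls_shift (- (k + 1)) (fls_const c)) (k + 1))"
proof safe
  fix x :: "'a fls" assume x: "x \<in> vball k"
  have "\<forall>j\<le>k + 1. (x - fls_shift (- (k + 1)) (fls_const (x $$ (k + 1)))) $$ j = 0"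
  proof (intro allI impI)
    fix j assume "j \<le> k + 1"
    then consider "j = k + 1" | "j \<le> k" by linarith
    then show "(x - fls_shift (- (k + 1)) (fls_const (x $$ (k + 1)))) $$ j = 0"
      using x by cases (simp_all add: vball_def)
  qed
  then have "x \<in> kball (fls_shift (- (k + 1)) (fls_const (x $$ (k + 1)))) (k + 1)"
    by (simp only: kball_def vball_def mem_Collect_eq)
  then show "x \<in> (\<Union>c. kball (fls_shift (- (k + 1)) (fls_const c)) (k + 1))" by blast
next
  fix x :: "'a fls" and c
  assume "x \<in> kball (fls_shift (- (k + 1)) (fls_const c)) (k + 1)"
  then have *: "\<forall>j\<le>k + 1. (x - fls_shift (- (k + 1)) (fls_const c)) $$ j = 0"
    by (simp only: kball_def vball_def mem_Collect_eq)
  have "x $$ j = 0" if "j \<le> k" for j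
  proof -
    have "(x - fls_shift (- (k + 1)) (fls_const c)) $$ j = 0"
      using that by (intro *[rule_format]) linarith
    then show ?thesis using that by simp
  qed
  then show "x \<in> vball k" unfolding vball_def by blast
qed

lemma vball_borel [measurable, simp]: "vball k \<in> sets (borel :: 'a fls measure)"
  using borel_open[OF open_kball[of 0 k]] by (simp add: kball_0)

text \<open>
  The digit at position \<open>k + 1\<close> cuts the ball into \<open>q\<close> translates of the next smaller one.\<close>

lemma emeasure_vball_Suc: "emeasure lam (vball k) = ennreal q * emeasure lam (vball (k + 1))"
proof -
  let ?B = "\<lambda>c. kball (fls_shift (- (k + 1)) (fls_const c)) (k + 1) :: 'a fls set"
  have "disjoint_family ?B"
    unfolding disjoint_family_on_def
  proof (intro ballI impI, rule ccontr)
    fix c d :: 'a assume "c \<noteq> d" "?B c \<inter> ?B d \<noteq> {}"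
    then obtain x where x: "x \<in> ?B c" "x \<in> ?B d" by blast
    have "x $$ (k + 1) = c" using x(1) by (auto simp: kball_def vball_def dest: spec[of _ "k + 1"])
    moreover have "x $$ (k + 1) = d" using x(2) by (auto simp: kball_def vball_def dest: spec[of _ "k + 1"])
    ultimately show False using \<open>c \<noteq> d\<close> by simp
  qed
  then have "(\<Sum>c\<in>UNIV. emeasure lam (?B c)) = emeasure lam (\<Union>c\<in>UNIV. ?B c)"
    by (intro sum_emeasure) (auto simp: open_kball)
  then have "emeasure lam (vball k) = (\<Sum>c\<in>(UNIV::'a set). emeasure lam (vball (k + 1)))"
    by (simp add: vball_split[of k] emeasure_kball)
  also have "\<dots> = ennreal q * emeasure lam (vball (k + 1))"
    by (simp add: q_def ennreal_of_nat_eq_real_of_nat)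
  finally show ?thesis .
qed

lemma kabs_less_1: "{x :: 'a fls. kabs x < 1} = vball 0"
proof -
  have "real CARD('a) powi (- s) < 1 \<longleftrightarrow> 0 < s" for s
  proof -
    have "q powi (- s) = q powr real_of_int (- s)"
      by (rule powr_real_of_int'[symmetric]) auto
    also have "\<dots> < q powr 0 \<longleftrightarrow> 0 < s" by (subst powr_less_cancel_iff) auto
    finally show ?thesis by (simp add: q_def)
  qed
  then have "kabs x < 1 \<longleftrightarrow> x \<in> vball 0" for x :: "'a fls"
    unfolding kabs_def vball_iff by (cases "x = 0") simp_all
  then show ?thesis by blast
qed

lemma q_powr_shift: "q * q powr x = q powr (1 + x)"
  by (simp only: powr_add powr_one q_pos)

lemma emeasure_vball: "emeasure lam (vball k) = ennreal (q powr (- real_of_int k))"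
proof (induction k rule: int_induct[where k = 0])
  case base
  show ?case using unimodular by (simp add: unimodular_normalization_def kabs_less_1)
next
  case (step1 i)
  have "q powr (- real_of_int i) = q * q powr (- real_of_int (i + 1))"
    unfolding q_powr_shift by simp
  then have "ennreal q * emeasure lam (vball (i + 1)) = ennreal q * ennreal (q powr (- real_of_int (i + 1)))"
    using trans[OF emeasure_vball_Suc[of i, symmetric] step1(2)] by (simp only: ennreal_mult q_pos powr_ge_zero)
  then show ?case
    by (subst (asm) ennreal_mult_cancel_left) (auto simp: ennreal_eq_0_iff)
next
  case (step2 i)
  have "q powr (- real_of_int (i - 1)) = q * q powr (- real_of_int i)"
    unfolding q_powr_shift by simp
  moreover have "emeasure lam (vball (i - 1)) = ennreal q * ennreal (q powr (- real_of_int i))"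
    using emeasure_vball_Suc[of "i - 1"] by (simp only: diff_add_cancel step2(2))
  ultimately show ?case by (simp only: ennreal_mult q_pos powr_ge_zero)
qed

text \<open>
  The shift by \<open>k\<close> is multiplication by \<open>t^k\<close>. It maps balls to balls, and measures are determined by
  their values on balls.\<close>

lemma emeasure_shift:
  assumes "B \<in> sets borel"
  shows "emeasure lam (fls_shift k -` B) = ennreal (q powr (- real_of_int k)) * emeasure lam B"
proof -
  let ?M = "scale_measure (ennreal (q powr real_of_int k)) (distr lam borel (fls_shift k))"
  have "?M = lam"
  proof (rule measure_eqI_generator_eq[OF Int_stable_kball, where \<Omega> = UNIV and A = "\<lambda>i. vball (- int i)"])
    fix X :: "'a fls set" assume "X \<in> insert {} (range (\<lambda>(x, k). kball x k))"
    then consider "X = {}" | x l where "X = kball x l" by auto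
    then show "emeasure ?M X = emeasure lam X"
    proof cases
      case 2
      have "emeasure ?M X = ennreal (q powr real_of_int k) * ennreal (q powr (- real_of_int (l + k)))"
        by (simp add: 2 emeasure_distr open_kball fls_shift_vimage_kball emeasure_kball emeasure_vball)
      also have "\<dots> = ennreal (q powr real_of_int k * q powr (- real_of_int (l + k)))"
        by (simp only: ennreal_mult powr_ge_zero)
      also have "q powr real_of_int k * q powr (- real_of_int (l + k)) = q powr (- real_of_int l)"
        by (simp only: powr_add[symmetric]) simp
      finally show ?thesis by (simp only: 2 emeasure_kball emeasure_vball)
    qed simp
  next
    show "(\<Union>i. vball (- int i)) = (UNIV :: 'a fls set)"
    proof -
      have "x \<in> vball (- int (nat (1 - fls_subdegree x)))" for x :: "'a fls"
        by (auto simp: vball_def)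
      then show ?thesis by blast
    qed
    show "range (\<lambda>i. vball (- int i)) \<subseteq> insert {} (range (\<lambda>(x, k). kball x k))"
      by (auto simp: kball_0[symmetric])
    show "emeasure ?M (vball (- int i)) \<noteq> \<infinity>" for i
      using fls_shift_vimage_kball[of k "0 :: 'a fls" "- int i"]
      by (simp add: emeasure_distr kball_0 emeasure_vball ennreal_mult[symmetric])
    show "sets ?M = sigma_sets UNIV (insert {} (range (\<lambda>(x, k). kball x k)))"
      by (simp only: sets_scale_measure sets_distr sets_borel_fls)
    show "sets lam = sigma_sets UNIV (insert {} (range (\<lambda>(x, k). kball x k)))"
      by (simp only: sets_lam sets_borel_fls)
  qed simp
  have "emeasure lam B = ennreal (q powr real_of_int k) * emeasure lam (fls_shift k -` B)"
  proof -
    have "emeasure ?M B = ennreal (q powr real_of_int k) * emeasure lam (fls_shift k -` B)"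
      using assms by (simp add: emeasure_distr)
    then show ?thesis using \<open>?M = lam\<close> by (simp only:)
  qed
  then have "ennreal (q powr (- real_of_int k)) * emeasure lam B
      = (ennreal (q powr (- real_of_int k)) * ennreal (q powr real_of_int k)) * emeasure lam (fls_shift k -` B)"
    by (simp only: mult.assoc)
  also have "ennreal (q powr (- real_of_int k)) * ennreal (q powr real_of_int k) = 1"
    by (simp add: ennreal_mult[symmetric] powr_minus)
  finally show ?thesis by simp
qed

lemma sigma_finite_lam: "sigma_finite_measure lam"
proof
  show "\<exists>A. countable A \<and> A \<subseteq> sets lam \<and> \<Union>A = space lam \<and> (\<forall>a\<in>A. emeasure lam a \<noteq> \<infinity>)"
  proof (intro exI[of _ "range (\<lambda>i. vball (- int i))"] conjI)
    have "\<exists>i. x \<in> vball (- int i)" for x :: "'a fls"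
      by (rule exI[of _ "nat (1 - fls_subdegree x)"]) (auto simp: vball_def)
    then show "\<Union>(range (\<lambda>i. vball (- int i))) = space lam" by auto
  qed (auto simp: emeasure_vball)
qed

lemma product_sigma_finite_lam: "product_sigma_finite (\<lambda>_. lam)"
  by (simp add: product_sigma_finite_def sigma_finite_lam)

end

section \<open>Products of the Haar measure\<close>

text \<open>
  Invariance under the translations by a box, or equivalently: membership in \<open>B\<close> depends only on the
  digits of the coordinate \<open>j\<close> up to position \<open>l j\<close>.\<close>

definition level_set :: "'i set \<Rightarrow> ('i \<Rightarrow> int) \<Rightarrow> ('i \<Rightarrow> 'a::{field,finite} fls) set \<Rightarrow> bool" where
  "level_set J l B \<longleftrightarrow> B \<subseteq> J \<rightarrow>\<^sub>E UNIV \<and>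
     (\<forall>x\<in>B. \<forall>y\<in>J \<rightarrow>\<^sub>E UNIV. (\<forall>j\<in>J. y j - x j \<in> vball (l j)) \<longrightarrow> y \<in> B)"

definition unit_cube :: "'i set \<Rightarrow> ('i \<Rightarrow> 'a::{field,finite} fls) set" where
  "unit_cube J = J \<rightarrow>\<^sub>E vball 0"

context haar
begin

abbreviation hprod :: "'i set \<Rightarrow> ('i \<Rightarrow> 'a fls) measure" where
  "hprod J \<equiv> PiM J (\<lambda>_. lam)"

lemma space_hprod: "space (hprod J) = J \<rightarrow>\<^sub>E UNIV"
  by (simp add: space_PiM)

lemma emeasure_hprod:
  assumes "finite J" "\<And>j. j \<in> J \<Longrightarrow> B j \<in> sets borel"
  shows "emeasure (hprod J) (Pi\<^sub>E J B) = (\<Prod>j\<in>J. emeasure lam (B j))"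
  by (rule product_sigma_finite.emeasure_PiM[OF product_sigma_finite_lam]) (use assms in auto)

lemma coordinatewise_measurable:
  assumes "\<And>j. j \<in> J \<Longrightarrow> f j \<in> measurable borel borel"
  shows "(\<lambda>x. \<lambda>j\<in>J. f j (x j)) \<in> measurable (hprod J) (hprod J)"
proof (rule measurable_restrict)
  fix j assume "j \<in> J"
  then have "(\<lambda>x. x j) \<in> measurable (hprod J) lam" by simp
  moreover have "f j \<in> measurable lam lam"
    using assms[OF \<open>j \<in> J\<close>] by (simp cong: measurable_cong_sets)
  ultimately show "(\<lambda>x. f j (x j)) \<in> measurable (hprod J) lam"
    by (rule measurable_compose)
qed

text \<open>
  The common source of translation invariance and of the scaling under dilations: a product measure
  is determined by its values on products of sets.\<close>

lemma emeasure_coordinatewise: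
  assumes J: "finite J"
    and f: "\<And>j. j \<in> J \<Longrightarrow> f j \<in> measurable borel borel"
    and r: "\<And>j. j \<in> J \<Longrightarrow> 0 < r j"
    and fr: "\<And>j B. j \<in> J \<Longrightarrow> B \<in> sets borel \<Longrightarrow> emeasure lam (f j -` B) = ennreal (r j) * emeasure lam B"
    and B: "B \<in> sets (hprod J)"
  shows "emeasure (hprod J) {x \<in> J \<rightarrow>\<^sub>E UNIV. (\<lambda>j\<in>J. f j (x j)) \<in> B}
      = ennreal (\<Prod>j\<in>J. r j) * emeasure (hprod J) B"
proof -
  define F where "F = (\<lambda>x. \<lambda>j\<in>J. f j (x j))"
  define c where "c = (\<Prod>j\<in>J. r j)"
  have c: "0 < c" using r by (simp add: c_def prod_pos)
  have F: "F \<in> measurable (hprod J) (hprod J)"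
    unfolding F_def by (rule coordinatewise_measurable) (rule f)
  have vim: "F -` B \<inter> space (hprod J) = {x \<in> J \<rightarrow>\<^sub>E UNIV. F x \<in> B}" for B
    by (auto simp: space_hprod)
  have cancel: "ennreal (inverse c) * (ennreal c * y) = y" for y
  proof -
    have "ennreal (inverse c) * ennreal c = 1" using c by (simp add: ennreal_mult[symmetric])
    then show ?thesis by (simp add: mult.assoc[symmetric])
  qed
  let ?M = "scale_measure (ennreal (inverse c)) (distr (hprod J) (hprod J) F)"
  have eq: "?M = hprod J"
  proof (rule product_sigma_finite.PiM_eqI[OF product_sigma_finite_lam J])
    fix A :: "'b \<Rightarrow> 'a fls set" assume A: "\<And>j. j \<in> J \<Longrightarrow> A j \<in> sets lam"
    then have A': "\<And>j. j \<in> J \<Longrightarrow> A j \<in> sets borel" by simp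
    have P: "Pi\<^sub>E J A \<in> sets (hprod J)" by (intro sets_PiM_I_finite J A)
    have "{x \<in> J \<rightarrow>\<^sub>E UNIV. F x \<in> Pi\<^sub>E J A} = Pi\<^sub>E J (\<lambda>j. f j -` A j)"
      by (auto simp: F_def PiE_iff extensional_def)
    moreover have "f j -` A j \<in> sets borel" if "j \<in> J" for j
      using measurable_sets[OF f[OF that] A'[OF that]] by simp
    ultimately have "emeasure (distr (hprod J) (hprod J) F) (Pi\<^sub>E J A) = (\<Prod>j\<in>J. emeasure lam (f j -` A j))"
      by (simp add: emeasure_distr[OF F P] vim emeasure_hprod[OF J])
    also have "\<dots> = (\<Prod>j\<in>J. ennreal (r j) * emeasure lam (A j))"
      using fr A' by (intro prod.cong) auto
    also have "\<dots> = ennreal c * (\<Prod>j\<in>J. emeasure lam (A j))"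
      using r by (simp add: prod.distrib c_def prod_ennreal less_imp_le)
    finally show "emeasure ?M (Pi\<^sub>E J A) = (\<Prod>j\<in>J. emeasure lam (A j))"
      by (simp only: emeasure_scale_measure cancel)
  qed simp
  have "emeasure (hprod J) B = ennreal (inverse c) * emeasure (hprod J) {x \<in> J \<rightarrow>\<^sub>E UNIV. F x \<in> B}"
  proof -
    have "emeasure ?M B = ennreal (inverse c) * emeasure (hprod J) {x \<in> J \<rightarrow>\<^sub>E UNIV. F x \<in> B}"
      by (simp only: emeasure_scale_measure emeasure_distr[OF F B] vim)
    then show ?thesis by (simp only: eq)
  qed
  then have "ennreal c * emeasure (hprod J) B = emeasure (hprod J) {x \<in> J \<rightarrow>\<^sub>E UNIV. F x \<in> B}"
    using cancel by (simp only: mult.left_commute)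
  then show ?thesis by (simp only: F_def c_def)
qed

lemma emeasure_hprod_translate:
  assumes "finite J" "B \<in> sets (hprod J)"
  shows "emeasure (hprod J) {x \<in> J \<rightarrow>\<^sub>E UNIV. (\<lambda>j\<in>J. c j + x j) \<in> B} = emeasure (hprod J) B"
  using emeasure_coordinatewise[of J "\<lambda>j. (+) (c j)" "\<lambda>_. 1" B] assms
  by (simp add: emeasure_translate)

lemma emeasure_hprod_shift:
  assumes "finite J" "B \<in> sets (hprod J)"
  shows "emeasure (hprod J) {x \<in> J \<rightarrow>\<^sub>E UNIV. (\<lambda>j\<in>J. fls_shift (k j) (x j)) \<in> B}
    = ennreal (q powr (- real_of_int (\<Sum>j\<in>J. k j))) * emeasure (hprod J) B"
proof -
  have "(\<Prod>j\<in>J. q powr (- real_of_int (k j))) = q powr (- real_of_int (\<Sum>j\<in>J. k j))"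
    by (simp add: powr_sum[symmetric] sum_negf)
  then show ?thesis
    using emeasure_coordinatewise[of J "\<lambda>j. fls_shift (k j)" "\<lambda>j. q powr (- real_of_int (k j))" B] assms
    by (simp add: emeasure_shift)
qed

lemma kball_borel [measurable, simp]: "kball x k \<in> sets (borel :: 'a fls measure)"
  by (intro borel_open open_kball)

lemma box_sets [simp]: "finite J \<Longrightarrow> Pi\<^sub>E J (\<lambda>j. kball (x j) (l j)) \<in> sets (hprod J)"
  by (intro sets_PiM_I_finite) auto

lemma emeasure_box:
  assumes "finite J"
  shows "emeasure (hprod J) (Pi\<^sub>E J (\<lambda>j. kball (x j) (l j))) = ennreal (q powr (- real_of_int (\<Sum>j\<in>J. l j)))"
proof -
  have "emeasure (hprod J) (Pi\<^sub>E J (\<lambda>j. kball (x j) (l j))) = (\<Prod>j\<in>J. ennreal (q powr (- real_of_int (l j))))"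
    using assms by (simp add: emeasure_hprod emeasure_kball emeasure_vball)
  also have "\<dots> = ennreal (\<Prod>j\<in>J. q powr (- real_of_int (l j)))"
    by (simp add: prod_ennreal)
  also have "(\<Prod>j\<in>J. q powr (- real_of_int (l j))) = q powr (- real_of_int (\<Sum>j\<in>J. l j))"
    by (simp add: powr_sum[symmetric] sum_negf)
  finally show ?thesis .
qed

lemma level_set_Union:
  assumes "level_set J l B"
  shows "B = (\<Union>z\<in>{z \<in> (\<Pi>\<^sub>E j\<in>J. range (trunc (l j))). z \<in> B}. Pi\<^sub>E J (\<lambda>j. kball (z j) (l j)))"
proof (intro equalityI subsetI)
  fix x assume x: "x \<in> B"
  define z where "z = (\<lambda>j\<in>J. trunc (l j) (x j))"
  have "z \<in> (\<Pi>\<^sub>E j\<in>J. range (trunc (l j)))" by (auto simp: z_def)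
  moreover have "z j - x j \<in> vball (l j)" if "j \<in> J" for j
    using trunc_kball[of "x j" "l j"] vball_uminus[of "x j - z j" "l j"] that
    by (simp add: z_def kball_def)
  then have "z \<in> B"
    using assms x unfolding level_set_def by (auto simp: z_def)
  moreover have "x \<in> Pi\<^sub>E J (\<lambda>j. kball (z j) (l j))"
    using assms x trunc_kball by (auto simp: level_set_def z_def PiE_iff)
  ultimately show "x \<in> (\<Union>z\<in>{z \<in> (\<Pi>\<^sub>E j\<in>J. range (trunc (l j))). z \<in> B}. Pi\<^sub>E J (\<lambda>j. kball (z j) (l j)))"
    by blast
next
  fix x assume "x \<in> (\<Union>z\<in>{z \<in> (\<Pi>\<^sub>E j\<in>J. range (trunc (l j))). z \<in> B}. Pi\<^sub>E J (\<lambda>j. kball (z j) (l j)))"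
  then show "x \<in> B" using assms by (auto simp: level_set_def kball_def PiE_iff)
qed

lemma level_set_sets:
  assumes "finite J" "level_set J l B"
  shows "B \<in> sets (hprod J)"
proof -
  have "countable {z \<in> (\<Pi>\<^sub>E j\<in>J. range (trunc (l j) :: 'a fls \<Rightarrow> _)). z \<in> B}"
    by (rule countable_subset[OF _ countable_PiE[OF assms(1) countable_range_trunc]]) auto
  then have "(\<Union>z\<in>{z \<in> (\<Pi>\<^sub>E j\<in>J. range (trunc (l j))). z \<in> B}. Pi\<^sub>E J (\<lambda>j. kball (z j) (l j))) \<in> sets (hprod J)"
    using assms(1) by (intro sets.countable_UN') auto
  then show ?thesis using level_set_Union[OF assms(2)] by simp
qed

text \<open>
  The unit cube is a fundamental domain for the lattice of polynomial vectors, so each lattice point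
  in \<open>B\<close> accounts for one translate of the cube, of volume 1.\<close>

lemma emeasure_eq_card_lattice:
  assumes J: "finite J" and B: "level_set J (\<lambda>_. 0) B"
    and fin: "finite {z \<in> J \<rightarrow>\<^sub>E UNIV. (\<lambda>j\<in>J. emb (z j)) \<in> B}"
  shows "emeasure (hprod J) B = of_nat (card {z \<in> J \<rightarrow>\<^sub>E UNIV. (\<lambda>j\<in>J. emb (z j)) \<in> B})"
proof -
  let ?Z = "{z \<in> J \<rightarrow>\<^sub>E UNIV. (\<lambda>j\<in>J. emb (z j)) \<in> B}"
  let ?C = "\<lambda>z. Pi\<^sub>E J (\<lambda>j. kball (emb (z j)) 0)"
  have BU: "B = (\<Union>z\<in>?Z. ?C z)"
  proof (intro equalityI subsetI)
    fix x assume x: "x \<in> B"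
    define z where "z = (\<lambda>j\<in>J. ppart (x j))"
    have *: "x j - emb (z j) \<in> vball 0" if "j \<in> J" for j
      using fpart_vball[of "x j"] that by (simp add: fpart_def z_def del: fpart_vball)
    then have "emb (z j) - x j \<in> vball 0" if "j \<in> J" for j
      using vball_uminus[OF *[OF that]] by simp
    then have "(\<lambda>j\<in>J. emb (z j)) \<in> B" using B x unfolding level_set_def by auto
    moreover have "z \<in> J \<rightarrow>\<^sub>E UNIV" by (auto simp: z_def)
    moreover have "x \<in> ?C z" using * x B by (auto simp: level_set_def kball_def PiE_iff)
    ultimately show "x \<in> (\<Union>z\<in>?Z. ?C z)" by blast
  next
    fix x assume "x \<in> (\<Union>z\<in>?Z. ?C z)"
    then show "x \<in> B" using B by (auto simp: level_set_def kball_def PiE_iff)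
  qed
  have "disjoint_family_on ?C ?Z"
    unfolding disjoint_family_on_def
  proof (intro ballI impI, rule ccontr)
    fix z w assume zw: "z \<in> ?Z" "w \<in> ?Z" "z \<noteq> w" "?C z \<inter> ?C w \<noteq> {}"
    then obtain x where x: "x \<in> ?C z" "x \<in> ?C w" by blast
    have "z j = w j" for j
    proof (cases "j \<in> J")
      case True
      then have "x j - emb (z j) \<in> vball 0" "x j - emb (w j) \<in> vball 0"
        using x by (auto simp: kball_def PiE_iff)
      then have "emb (w j - z j) \<in> vball 0"
        using vball_diff[of "x j - emb (z j)" 0 "x j - emb (w j)"] by (simp add: emb_diff)
      from emb_vball_0[OF this] show ?thesis by simp
    next
      case False
      moreover have "z \<in> J \<rightarrow>\<^sub>E UNIV" "w \<in> J \<rightarrow>\<^sub>E UNIV" using zw by auto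
      ultimately show ?thesis using PiE_arb[of z J "\<lambda>_. UNIV" j] PiE_arb[of w J "\<lambda>_. UNIV" j] by simp
    qed
    with zw show False by auto
  qed
  then have "emeasure (hprod J) B = (\<Sum>z\<in>?Z. emeasure (hprod J) (?C z))"
    using fin J by (subst BU) (intro sum_emeasure[symmetric], auto)
  also have "\<dots> = of_nat (card ?Z)"
    using J by (simp add: emeasure_box)
  finally show ?thesis .
qed

lemma unit_cube_sets [simp]: "finite J \<Longrightarrow> unit_cube J \<in> sets (hprod J)"
  unfolding unit_cube_def by (intro sets_PiM_I_finite) auto

lemma emeasure_unit_cube: "finite J \<Longrightarrow> emeasure (hprod J) (unit_cube J) = 1"
  using emeasure_box[of J "\<lambda>_. 0" "\<lambda>_. 0"] by (simp add: unit_cube_def kball_0)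

text \<open>
  By additivity the fibres of the map \<open>x \<mapsto> (\<psi> k x)\<^sub>k\<close> on the unit cube are translates of each other, and by
  surjectivity all \<open>q ^ card I\<close> of them are nonempty. Hence they share the volume 1 of the cube
  equally.\<close>

lemma functionals_equidistributed:
  fixes \<psi> :: "'k \<Rightarrow> ('i \<Rightarrow> 'a fls) \<Rightarrow> 'a"
  assumes J: "finite J" and I: "finite I"
    and add: "\<And>k x y. k \<in> I \<Longrightarrow> \<psi> k (\<lambda>j\<in>J. x j + y j) = \<psi> k x + \<psi> k y"
    and meas: "\<And>k. k \<in> I \<Longrightarrow> \<psi> k \<in> measurable (hprod J) (count_space UNIV)"
    and surj: "\<And>c. \<exists>x\<in>unit_cube J. \<forall>k\<in>I. \<psi> k x = c k"
    and S: "S \<subseteq> I \<rightarrow>\<^sub>E UNIV"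
  shows "{x \<in> unit_cube J. (\<lambda>k\<in>I. \<psi> k x) \<in> S} \<in> sets (hprod J)"
    and "measure (hprod J) {x \<in> unit_cube J. (\<lambda>k\<in>I. \<psi> k x) \<in> S} = card S / q ^ card I"
proof -
  define E where "E = (\<lambda>c. {x \<in> unit_cube J. \<forall>k\<in>I. \<psi> k x = c k})"
  have E_sets: "E c \<in> sets (hprod J)" for c
  proof -
    have "E c = unit_cube J \<inter> (\<Inter>k\<in>I. {x \<in> space (hprod J). \<psi> k x = c k}) \<inter> unit_cube J"
      by (auto simp: E_def unit_cube_def space_hprod PiE_iff extensional_def)
    also have "\<dots> \<in> sets (hprod J)"
    proof (cases "I = {}")
      case False
      have "{x \<in> space (hprod J). \<psi> k x = c k} \<in> sets (hprod J)" if "k \<in> I" for k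
      proof -
        have "{x \<in> space (hprod J). \<psi> k x = c k} = \<psi> k -` {c k} \<inter> space (hprod J)" by auto
        then show ?thesis using measurable_sets[OF meas[OF that]] by simp
      qed
      then show ?thesis using False I J by (intro sets.Int sets.finite_INT) auto
    qed (use J in simp)
    finally show ?thesis .
  qed
  have E_eq: "emeasure (hprod J) (E c) = emeasure (hprod J) (E (\<lambda>_. 0))" for c
  proof -
    obtain x0 where x0: "x0 \<in> unit_cube J" "\<forall>k\<in>I. \<psi> k x0 = c k" using surj by blast
    have "{x \<in> J \<rightarrow>\<^sub>E UNIV. (\<lambda>j\<in>J. x0 j + x j) \<in> E c} = E (\<lambda>_. 0)"
    proof (intro equalityI subsetI)
      fix x assume x: "x \<in> {x \<in> J \<rightarrow>\<^sub>E UNIV. (\<lambda>j\<in>J. x0 j + x j) \<in> E c}"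
      have "x j \<in> vball 0" if "j \<in> J" for j
      proof -
        have "x0 j + x j \<in> vball 0" "x0 j \<in> vball 0"
          using x x0 that by (auto simp: E_def unit_cube_def PiE_iff)
        then have "x0 j + x j - x0 j \<in> vball 0" by (rule vball_diff)
        then show ?thesis by simp
      qed
      then show "x \<in> E (\<lambda>_. 0)" using x x0 add by (auto simp: E_def unit_cube_def PiE_iff)
    next
      fix x assume x: "x \<in> E (\<lambda>_. 0)"
      then show "x \<in> {x \<in> J \<rightarrow>\<^sub>E UNIV. (\<lambda>j\<in>J. x0 j + x j) \<in> E c}"
        using x0 add by (auto simp: E_def unit_cube_def PiE_iff intro: vball_add)
    qed
    then show ?thesis using emeasure_hprod_translate[OF J E_sets[of c], of x0] by simp
  qed
  have E_disj: "disjoint_family_on E (I \<rightarrow>\<^sub>E UNIV)"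
    unfolding disjoint_family_on_def
  proof (intro ballI impI)
    fix c d assume "c \<in> I \<rightarrow>\<^sub>E (UNIV :: 'a set)" "d \<in> I \<rightarrow>\<^sub>E (UNIV :: 'a set)" "c \<noteq> d"
    then obtain k where "k \<in> I" "c k \<noteq> d k" by (metis PiE_ext)
    then show "E c \<inter> E d = {}" by (auto simp: E_def)
  qed
  have fin: "finite (I \<rightarrow>\<^sub>E (UNIV :: 'a set))" using I by (intro finite_PiE) auto
  have ES: "{x \<in> unit_cube J. (\<lambda>k\<in>I. \<psi> k x) \<in> S} = (\<Union>c\<in>S. E c)" if S: "S \<subseteq> I \<rightarrow>\<^sub>E UNIV" for S
  proof -
    have *: "(\<lambda>k\<in>I. \<psi> k x) = c \<longleftrightarrow> (\<forall>k\<in>I. \<psi> k x = c k)" if "c \<in> S" for c x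
      using that S by (auto simp: fun_eq_iff PiE_iff extensional_def restrict_def)
    show ?thesis
    proof (intro equalityI subsetI)
      fix x assume "x \<in> {x \<in> unit_cube J. (\<lambda>k\<in>I. \<psi> k x) \<in> S}"
      then show "x \<in> (\<Union>c\<in>S. E c)"
        by (intro UN_I[of "\<lambda>k\<in>I. \<psi> k x"]) (auto simp: E_def)
    next
      fix x assume "x \<in> (\<Union>c\<in>S. E c)"
      then obtain c where c: "c \<in> S" "x \<in> E c" by blast
      then have "(\<lambda>k\<in>I. \<psi> k x) = c" using *[OF c(1)] by (simp add: E_def)
      then show "x \<in> {x \<in> unit_cube J. (\<lambda>k\<in>I. \<psi> k x) \<in> S}" using c by (simp add: E_def)
    qed
  qed
  have finS: "finite S" if S: "S \<subseteq> I \<rightarrow>\<^sub>E UNIV" for S :: "('k \<Rightarrow> 'a) set"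
    using that fin finite_subset by blast
  have em: "emeasure (hprod J) {x \<in> unit_cube J. (\<lambda>k\<in>I. \<psi> k x) \<in> S}
      = of_nat (card S) * emeasure (hprod J) (E (\<lambda>_. 0))" if S: "S \<subseteq> I \<rightarrow>\<^sub>E UNIV" for S
  proof -
    have "emeasure (hprod J) (\<Union>c\<in>S. E c) = (\<Sum>c\<in>S. emeasure (hprod J) (E c))"
      using finS[OF S] E_sets disjoint_family_on_mono[OF S E_disj] by (intro sum_emeasure[symmetric]) auto
    also have "\<dots> = (\<Sum>c\<in>S. emeasure (hprod J) (E (\<lambda>_. 0)))"
      by (rule sum.cong[OF refl E_eq])
    finally show ?thesis by (simp only: ES[OF S] sum_constant)
  qed
  show "{x \<in> unit_cube J. (\<lambda>k\<in>I. \<psi> k x) \<in> S} \<in> sets (hprod J)"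
    unfolding ES[OF S] using finS[OF S] E_sets by auto
  have one: "1 = of_nat (card (I \<rightarrow>\<^sub>E (UNIV :: 'a set))) * emeasure (hprod J) (E (\<lambda>_. 0))"
  proof -
    have "{x \<in> unit_cube J. (\<lambda>k\<in>I. \<psi> k x) \<in> I \<rightarrow>\<^sub>E UNIV} = unit_cube J" by auto
    then show ?thesis using em[of "I \<rightarrow>\<^sub>E UNIV"] emeasure_unit_cube[OF J] by simp
  qed
  have cI: "real (card (I \<rightarrow>\<^sub>E (UNIV :: 'a set))) = q ^ card I"
    using I by (simp add: card_PiE q_def)
  have E0: "measure (hprod J) (E (\<lambda>_. 0)) = 1 / q ^ card I"
  proof -
    have "1 = q ^ card I * measure (hprod J) (E (\<lambda>_. 0))"
      using arg_cong[OF one, of enn2real]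
      by (simp add: enn2real_mult measure_def[symmetric] cI)
    then show ?thesis by (simp add: field_simps)
  qed
  have "measure (hprod J) {x \<in> unit_cube J. (\<lambda>k\<in>I. \<psi> k x) \<in> S} = card S * measure (hprod J) (E (\<lambda>_. 0))"
    unfolding measure_def em[OF S] by (simp add: enn2real_mult)
  then show "measure (hprod J) {x \<in> unit_cube J. (\<lambda>k\<in>I. \<psi> k x) \<in> S} = card S / q ^ card I"
    by (simp add: E0)
qed

end

section \<open>Joint equidistribution of two linear forms\<close>

text \<open>
  Euclid's algorithm, with the cofactors \<open>f\<close> and \<open>h\<close> of the common divisor \<open>g\<close> recorded along the way.\<close>

lemma poly_bezout:
  fixes a b :: "'a::field poly"
  assumes "a \<noteq> 0 \<or> b \<noteq> 0"
  shows "\<exists>g f h \<alpha> \<beta>. g \<noteq> 0 \<and> a = g * f \<and> b = g * h \<and> \<alpha> * f + \<beta> * h = 1"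
  using assms
proof (induction "if b = 0 then 0 else Suc (degree b)" arbitrary: a b rule: less_induct)
  case less
  show ?case
  proof (cases "b = 0")
    case True
    then show ?thesis
      using less(2) by (intro exI[of _ a] exI[of _ 1] exI[of _ 0] exI[of _ 1] exI[of _ 0]) simp
  next
    case False
    define r c where "r = a mod b" and "c = a div b"
    have a: "a = c * b + r" by (simp add: r_def c_def)
    have "(if r = 0 then 0 else Suc (degree r)) < (if b = 0 then 0 else Suc (degree b))"
      using False degree_mod_less[of b a] by (auto simp: r_def)
    then obtain g f h \<alpha> \<beta> where *: "g \<noteq> 0" "b = g * f" "r = g * h" "\<alpha> * f + \<beta> * h = 1"
      using less(1)[of r b] False by blast
    have "a = g * (c * f + h)" using a *(2,3) by (simp add: algebra_simps)
    moreover have "\<beta> * (c * f + h) + (\<alpha> - \<beta> * c) * f = 1" using *(4) by (simp add: algebra_simps)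
    ultimately show ?thesis using *(1,2) by blast
  qed
qed

definition dotp :: "nat \<Rightarrow> (nat \<Rightarrow> 'a::{field,finite} fls) \<Rightarrow> (nat \<Rightarrow> 'a poly) \<Rightarrow> 'a fls" where
  "dotp n r v = (\<Sum>j=1..n. r j * emb (v j))"

lemma dotp_cong: "(\<And>j. j \<in> {1..n} \<Longrightarrow> v j = w j) \<Longrightarrow> dotp n r v = dotp n r w"
  by (simp add: dotp_def)

lemma dotp_mult: "dotp n r (\<lambda>j. f * u j) = emb f * dotp n r u"
  by (simp add: dotp_def emb_mult sum_distrib_left algebra_simps)

lemma emb_sum: "emb (sum f S) = (\<Sum>j\<in>S. emb (f j))"
  by (induction S rule: infinite_finite_induct) (auto simp: emb_add)

text \<open>
  Reducing the row modulo \<open>F_q[t]\<close> changes the product by a polynomial, which has no digits after the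
  point.\<close>

lemma dotp_fpart_nth:
  assumes "0 < l" shows "dotp n (\<lambda>j. fpart (r j)) v $$ l = dotp n r v $$ l"
proof -
  have "dotp n (\<lambda>j. fpart (r j)) v = dotp n r v - emb (\<Sum>j=1..n. ppart (r j) * v j)"
    by (simp add: dotp_def fpart_def emb_sum emb_mult sum_subtractf[symmetric] algebra_simps)
  then show ?thesis using assms by (simp add: emb_nth)
qed

text \<open>
  For a row \<open>r\<close> ranging over the unit cube, the first \<open>l\<close> digits after the point of \<open>r \<cdot> v\<close> and the
  first \<open>l'\<close> digits of \<open>r \<cdot> w\<close> can be prescribed independently.\<close>

definition row_indep :: "nat \<Rightarrow> (nat \<Rightarrow> 'a::{field,finite} poly) \<Rightarrow> (nat \<Rightarrow> 'a poly) \<Rightarrow> nat \<Rightarrow> nat \<Rightarrow> bool" where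
  "row_indep n v w l l' \<longleftrightarrow> (\<forall>y z. \<exists>r.
     (\<forall>k\<in>{1..l}. dotp n r v $$ int k = y $$ int k) \<and> (\<forall>k\<in>{1..l'}. dotp n r w $$ int k = z $$ int k))"

lemma row_indep_single:
  assumes "j0 \<in> {1..n}" "v j0 \<noteq> 0"
  shows "row_indep n v w l 0"
  unfolding row_indep_def
proof (intro allI)
  fix y z
  have "dotp n (\<lambda>j. if j = j0 then y / emb (v j0) else 0) v = y"
    using assms by (simp add: dotp_def if_distrib[of "\<lambda>x. x * _"] sum.delta cong: if_cong)
  then show "\<exists>r. (\<forall>k\<in>{1..l}. dotp n r v $$ int k = y $$ int k) \<and> (\<forall>k\<in>{1..0}. dotp n r w $$ int k = z $$ int k)"
    by (intro exI[of _ "\<lambda>j. if j = j0 then y / emb (v j0) else 0"]) simp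
qed

text \<open>
  Cramer's rule in the two columns of the nonzero minor.\<close>

lemma row_indep_minor:
  assumes j: "j1 \<in> {1..n}" "j2 \<in> {1..n}" and d: "v j1 * w j2 \<noteq> v j2 * w j1"
  shows "row_indep n v w l l'"
  unfolding row_indep_def
proof (intro allI)
  fix y z :: "'a fls"
  define D where "D = emb (v j1) * emb (w j2) - emb (v j2) * emb (w j1)"
  have "D = emb (v j1 * w j2 - v j2 * w j1)" by (simp add: D_def emb_diff emb_mult)
  then have D: "D \<noteq> 0" using d by simp
  have "j1 \<noteq> j2" using d by auto
  define s t where "s = (y * emb (w j2) - z * emb (v j2)) / D" and "t = (z * emb (v j1) - y * emb (w j1)) / D"
  define r where "r = (\<lambda>j. if j = j1 then s else if j = j2 then t else 0)"
  have r: "dotp n r v = s * emb (v j1) + t * emb (v j2)" for v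
  proof -
    have "dotp n r v = (\<Sum>j=1..n. (if j = j1 then s * emb (v j1) else 0) + (if j = j2 then t * emb (v j2) else 0))"
      unfolding dotp_def r_def by (rule sum.cong) (use \<open>j1 \<noteq> j2\<close> in auto)
    then show ?thesis using j by (simp add: sum.distrib)
  qed
  have "s * emb (v j1) + t * emb (v j2) = y * D / D"
    by (simp add: s_def t_def D_def add_divide_distrib[symmetric] algebra_simps)
  moreover have "s * emb (w j1) + t * emb (w j2) = z * D / D"
    by (simp add: s_def t_def D_def add_divide_distrib[symmetric] algebra_simps)
  ultimately have "dotp n r v = y" "dotp n r w = z" using D by (simp_all add: r)
  then show "\<exists>r. (\<forall>k\<in>{1..l}. dotp n r v $$ int k = y $$ int k) \<and> (\<forall>k\<in>{1..l'}. dotp n r w $$ int k = z $$ int k)"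
    by (intro exI[of _ r]) simp
qed

text \<open>
  For proportional vectors \<open>f u\<close> and \<open>h u\<close> with coprime \<open>f\<close>, \<open>h\<close>, the numbers \<open>x\<close> with \<open>h x \<equiv> z\<close>
  modulo \<open>F_q[t]\<close> are \<open>(z + p) / h\<close>; by coprimality \<open>f p\<close> runs through all residues modulo \<open>h\<close>, so
  the fractional parts of \<open>f (z + p) / h\<close> meet every ball of radius \<open>1 / |h|\<close>.\<close>

lemma row_indep_coprime:
  assumes j0: "j0 \<in> {1..n}" "u j0 \<noteq> 0" and co: "\<alpha> * f + \<beta> * h = 1" and h: "h \<noteq> 0"
    and l: "l \<le> degree h"
    and v: "\<And>j. j \<in> {1..n} \<Longrightarrow> v j = f * u j" and w: "\<And>j. j \<in> {1..n} \<Longrightarrow> w j = h * u j"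
  shows "row_indep n v w l l'"
  unfolding row_indep_def
proof (intro allI)
  fix y z :: "'a fls"
  define P where "P = ppart (emb f * z - y * emb h)"
  define p r where "p = - P * \<alpha>" and "r = P * \<beta>"
  define x where "x = (z + emb p) / emb h"
  define row where "row = (\<lambda>j. if j = j0 then x / emb (u j0) else 0)"
  have "dotp n row u = x"
    using j0 by (simp add: row_def dotp_def if_distrib[of "\<lambda>x. x * _"] sum.delta cong: if_cong)
  then have rv: "dotp n row v = emb f * x" and rw: "dotp n row w = emb h * x"
    using dotp_cong[of n v "\<lambda>j. f * u j"] dotp_cong[of n w "\<lambda>j. h * u j"] v w by (simp_all add: dotp_mult)
  have hx: "emb h * x = z + emb p" using h by (simp add: x_def)
  have "f * p - r * h = - P * (\<alpha> * f + \<beta> * h)" by (simp add: p_def r_def algebra_simps)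
  then have fp: "f * p = r * h - P" using co by (simp add: algebra_simps)
  have "emb h * (emb f * x - y - emb r) = emb f * (z + emb p) - y * emb h - emb (r * h)"
    by (simp add: hx[symmetric] emb_mult algebra_simps)
  also have "\<dots> = (emb f * z - y * emb h) + (emb (f * p) - emb (r * h))"
    by (simp add: emb_mult algebra_simps)
  also have "\<dots> = fpart (emb f * z - y * emb h)"
    by (simp add: fp fpart_def P_def emb_diff)
  finally have "emb h * (emb f * x - y - emb r) \<in> vball 0" by simp
  then have "emb f * x - y - emb r \<in> vball (int (degree h))"
    using vball_mult_emb_cancel[OF _ h] by fastforce
  then have "(emb f * x) $$ int k = y $$ int k" if "k \<in> {1..l}" for k
    using that l by (auto simp: vball_def emb_nth dest!: spec[of _ "int k"])
  then show "\<exists>r. (\<forall>k\<in>{1..l}. dotp n r v $$ int k = y $$ int k) \<and> (\<forall>k\<in>{1..l'}. dotp n r w $$ int k = z $$ int k)"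
    by (intro exI[of _ row]) (simp add: rv rw hx emb_nth)
qed

text \<open>
  Divide one nonzero pair of coordinates by its greatest common divisor to get \<open>f\<close> and \<open>h\<close>. Then
  \<open>f w = h v\<close>, and the vector \<open>u = \<alpha> v + \<beta> w\<close> has the required property.\<close>

lemma proportional_vectors:
  fixes v w :: "nat \<Rightarrow> 'a::field poly"
  assumes "\<And>j1 j2. j1 \<in> J \<Longrightarrow> j2 \<in> J \<Longrightarrow> v j1 * w j2 = v j2 * w j1" "j1 \<in> J" "v j1 \<noteq> 0"
  shows "\<exists>f h u \<alpha> \<beta>. \<alpha> * f + \<beta> * h = 1 \<and> (\<forall>j\<in>J. v j = f * u j \<and> w j = h * u j)"
proof -
  obtain g f h \<alpha> \<beta> where *: "g \<noteq> 0" "v j1 = g * f" "w j1 = g * h" "\<alpha> * f + \<beta> * h = 1"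
    using poly_bezout[of "v j1" "w j1"] assms(3) by blast
  have fw: "f * w j = h * v j" if "j \<in> J" for j
  proof -
    have "g * (f * w j) = g * (h * v j)"
      using assms(1)[OF assms(2) that] by (simp add: *(2,3) algebra_simps)
    then show ?thesis using *(1) by simp
  qed
  have "v j = f * (\<alpha> * v j + \<beta> * w j) \<and> w j = h * (\<alpha> * v j + \<beta> * w j)" if "j \<in> J" for j
  proof
    have "f * (\<alpha> * v j + \<beta> * w j) = \<alpha> * f * v j + \<beta> * (f * w j)" by (simp add: algebra_simps)
    also have "\<dots> = (\<alpha> * f + \<beta> * h) * v j" by (simp add: fw[OF that] algebra_simps)
    finally show "v j = f * (\<alpha> * v j + \<beta> * w j)" by (simp add: *(4))
    have "h * (\<alpha> * v j + \<beta> * w j) = \<beta> * h * w j + \<alpha> * (h * v j)" by (simp add: algebra_simps)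
    also have "\<dots> = (\<alpha> * f + \<beta> * h) * w j" by (simp add: fw[OF that, symmetric] algebra_simps)
    finally show "w j = h * (\<alpha> * v j + \<beta> * w j)" by (simp add: *(4))
  qed
  then show ?thesis
    by (intro exI[of _ f] exI[of _ h] exI[of _ "\<lambda>j. \<alpha> * v j + \<beta> * w j"] exI[of _ \<alpha>] exI[of _ \<beta>])
      (simp add: *(4))
qed

text \<open>
  If \<open>f x\<close> and \<open>h x\<close> are both much closer to polynomials \<open>p\<close>, \<open>p'\<close> than \<open>1 / |h|\<close>, then the polynomial
  \<open>f p' - h p\<close> has absolute value below 1, so it vanishes; then \<open>h\<close> divides \<open>p'\<close>, and \<open>x\<close> itself is
  close to the polynomial \<open>p' / h\<close>.\<close>

lemma common_approximation:
  fixes x :: "'a::{field,finite} fls"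
  assumes co: "\<alpha> * f + \<beta> * h = 1" and h: "h \<noteq> 0" and d: "degree h \<le> l" "degree f \<le> l'"
    and fx: "\<And>k. k \<in> {1..l} \<Longrightarrow> (emb f * x) $$ int k = 0"
    and hx: "\<And>k. k \<in> {1..l'} \<Longrightarrow> (emb h * x) $$ int k = 0"
    and k: "k \<in> {1..l' + degree h}"
  shows "x $$ int k = 0"
proof -
  have vb: "fpart y \<in> vball (int l)" if "\<And>k. k \<in> {1..l} \<Longrightarrow> y $$ int k = 0" for y :: "'a fls" and l
  proof -
    have "fpart y $$ j = 0" if "j \<le> int l" for j
    proof (cases "0 < j")
      case True
      then have "nat j \<in> {1..l}" using that by auto
      from \<open>\<And>k. k \<in> {1..l} \<Longrightarrow> y $$ int k = 0\<close>[OF this] show ?thesis using True by (simp add: fpart_nth)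
    qed (simp add: fpart_nth)
    then show ?thesis by (simp add: vball_def)
  qed
  define p p' where "p = ppart (emb f * x)" and "p' = ppart (emb h * x)"
  have a: "emb f * x - emb p \<in> vball (int l)" and b: "emb h * x - emb p' \<in> vball (int l')"
    using vb[OF fx] vb[OF hx] by (auto simp: fpart_def p_def p'_def)
  have "emb (f * p' - h * p) = emb h * (emb f * x - emb p) - emb f * (emb h * x - emb p')"
    by (simp add: emb_diff emb_mult algebra_simps)
  also have "\<dots> \<in> vball 0"
    using vball_mult_emb[OF a, of h l] vball_mult_emb[OF b, of f l'] d by (intro vball_diff) auto
  finally have "f * p' - h * p = 0" by (rule emb_vball_0)
  then have fp: "f * p' = h * p" by simp
  define r where "r = \<alpha> * p + \<beta> * p'"
  have "p' = (\<alpha> * f + \<beta> * h) * p'" by (simp add: co)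
  also have "\<dots> = \<alpha> * (f * p') + \<beta> * h * p'" by (simp add: algebra_simps)
  also have "\<dots> = h * r" by (simp add: fp r_def algebra_simps)
  finally have "emb h * (x - emb r) \<in> vball (int l')" using b by (simp add: emb_mult algebra_simps)
  then have "x - emb r \<in> vball (int l' + int (degree h))" by (rule vball_mult_emb_cancel) (rule h)
  moreover have "int k \<le> int l' + int (degree h)" "int k > 0" using k by auto
  ultimately have "(x - emb r) $$ int k = 0" unfolding vball_def by blast
  then show ?thesis using k by (simp add: emb_nth)
qed

definition rowdot :: "nat \<Rightarrow> (nat \<times> nat \<Rightarrow> 'a::{field,finite} fls) \<Rightarrow> (nat \<Rightarrow> 'a poly) \<Rightarrow> nat \<Rightarrow> 'a fls" where
  "rowdot n A v i = dotp n (\<lambda>j. A (i, j)) v"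

definition digits :: "nat \<Rightarrow> nat \<Rightarrow> (nat \<Rightarrow> nat) \<Rightarrow> (nat \<Rightarrow> nat \<Rightarrow> 'a::{field,finite} poly)
    \<Rightarrow> (nat \<times> nat \<Rightarrow> 'a fls) \<Rightarrow> (nat \<times> nat \<Rightarrow> 'a)" where
  "digits m n l V A = (\<lambda>(i, k)\<in>(SIGMA i:{1..m}. {1..l i}). rowdot n A (V i) i $$ int k)"

context haar
begin

lemma rowdot_nth_measurable [measurable]:
  assumes "i \<in> {1..m}"
  shows "(\<lambda>A. rowdot n A v i $$ k) \<in> measurable (hprod ({1..m} \<times> {1..n})) (count_space UNIV)"
proof -
  have "(\<lambda>A. (\<Sum>j\<in>F. A (i, j) * emb (v j)) $$ k) \<in> measurable (hprod ({1..m} \<times> {1..n})) (count_space UNIV)"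
    if "finite F" "F \<subseteq> {1..n}" for F
    using that
  proof (induction F rule: finite_induct)
    case empty
    then show ?case by simp
  next
    case (insert j F)
    have "(\<lambda>A. A (i, j)) \<in> measurable (hprod ({1..m} \<times> {1..n})) lam"
      using insert assms by (intro measurable_component_singleton) auto
    moreover have "(\<lambda>x. (x * emb (v j)) $$ k) \<in> measurable lam (count_space UNIV)"
      using fls_nth_mult_emb_measurable by (simp only: measurable_cong_sets[OF sets_lam refl])
    ultimately have 1: "(\<lambda>A. (A (i, j) * emb (v j)) $$ k) \<in> measurable (hprod ({1..m} \<times> {1..n})) (count_space UNIV)"
      by (rule measurable_compose)
    have 2: "(\<lambda>A. (\<Sum>j\<in>F. A (i, j) * emb (v j)) $$ k) \<in> measurable (hprod ({1..m} \<times> {1..n})) (count_space UNIV)"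
      using insert by auto
    have "(\<lambda>A. c + (\<Sum>j\<in>F. A (i, j) * emb (v j)) $$ k) \<in> measurable (hprod ({1..m} \<times> {1..n})) (count_space UNIV)" for c
      using measurable_compose[OF 2, of "(+) c"] by simp
    from measurable_compose_countable[OF this 1] show ?case
      using insert by simp
  qed
  from this[of "{1..n}"] show ?thesis by (simp add: rowdot_def dotp_def)
qed

text \<open>
  The rows of \<open>A\<close> can be chosen separately, so that independence in each row gives joint surjectivity of
  all the digits.\<close>

lemma two_forms_equidistributed:
  assumes indep: "\<And>i. i \<in> {1..m} \<Longrightarrow> row_indep n (V i) (W i) (l i) (l' i)"
    and S: "S \<subseteq> (SIGMA i:{1..m}. {1..l i}) \<rightarrow>\<^sub>E UNIV" "S' \<subseteq> (SIGMA i:{1..m}. {1..l' i}) \<rightarrow>\<^sub>E UNIV"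
  shows "measure (hprod ({1..m} \<times> {1..n}))
      {A \<in> unit_cube ({1..m} \<times> {1..n}). digits m n l V A \<in> S \<and> digits m n l' W A \<in> S'}
    = (card S * card S') / q ^ ((\<Sum>i=1..m. l i) + (\<Sum>i=1..m. l' i))"
proof -
  let ?J = "{1..m} \<times> {1..n}"
  let ?I1 = "SIGMA i:{1..m}. {1..l i}" and ?I2 = "SIGMA i:{1..m}. {1..l' i}"
  define I where "I = ?I1 <+> ?I2"
  define \<psi> where "\<psi> = case_sum (\<lambda>(i, k). \<lambda>A. rowdot n A (V i) i $$ int k) (\<lambda>(i, k). \<lambda>A. rowdot n A (W i) i $$ int k)"
  define T where "T = {c \<in> I \<rightarrow>\<^sub>E UNIV. (\<lambda>k\<in>?I1. c (Inl k)) \<in> S \<and> (\<lambda>k\<in>?I2. c (Inr k)) \<in> S'}"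
  have I: "finite I" by (simp add: I_def)
  have cI: "card I = (\<Sum>i=1..m. l i) + (\<Sum>i=1..m. l' i)"
    by (simp add: I_def card_Plus)
  have add: "rowdot n (\<lambda>j\<in>?J. x j + y j) v i $$ k = rowdot n x v i $$ k + rowdot n y v i $$ k"
    if "i \<in> {1..m}" for i v k and x y :: "nat \<times> nat \<Rightarrow> 'a fls"
  proof -
    have "rowdot n (\<lambda>j\<in>?J. x j + y j) v i = rowdot n x v i + rowdot n y v i"
      using that by (simp add: rowdot_def dotp_def sum.distrib[symmetric] algebra_simps)
    then show ?thesis by simp
  qed
  have surj: "\<exists>x\<in>unit_cube ?J. \<forall>k\<in>I. \<psi> k x = c k" for c
  proof -
    define Y where "Y = (\<lambda>i. fps_to_fls (Abs_fps (\<lambda>k. c (Inl (i, k)))))"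
    define Z where "Z = (\<lambda>i. fps_to_fls (Abs_fps (\<lambda>k. c (Inr (i, k)))))"
    have "\<forall>i\<in>{1..m}. \<exists>r. (\<forall>k\<in>{1..l i}. dotp n r (V i) $$ int k = Y i $$ int k)
        \<and> (\<forall>k\<in>{1..l' i}. dotp n r (W i) $$ int k = Z i $$ int k)"
      using indep unfolding row_indep_def by blast
    then obtain r where r: "\<And>i. i \<in> {1..m} \<Longrightarrow> (\<forall>k\<in>{1..l i}. dotp n (r i) (V i) $$ int k = Y i $$ int k)
        \<and> (\<forall>k\<in>{1..l' i}. dotp n (r i) (W i) $$ int k = Z i $$ int k)"
      using bchoice by metis
    define A where "A = (\<lambda>(i, j)\<in>?J. fpart (r i j))"
    have rowA: "rowdot n A v i $$ int k = dotp n (r i) v $$ int k" if "i \<in> {1..m}" "0 < k" for i k v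
    proof -
      have "rowdot n A v i = dotp n (\<lambda>j. fpart (r i j)) v"
        using that by (simp add: rowdot_def dotp_def A_def)
      then show ?thesis using dotp_fpart_nth[of "int k"] that by simp
    qed
    have "A \<in> unit_cube ?J" by (auto simp: A_def unit_cube_def)
    moreover have "\<psi> k A = c k" if "k \<in> I" for k
      using that r by (auto simp: I_def \<psi>_def rowA Y_def Z_def)
    ultimately show ?thesis by blast
  qed
  have "measure (hprod ?J) {A \<in> unit_cube ?J. (\<lambda>k\<in>I. \<psi> k A) \<in> T} = card T / q ^ card I"
  proof (rule functionals_equidistributed(2)[OF _ I _ _ surj])
    show "\<psi> k (\<lambda>j\<in>?J. x j + y j) = \<psi> k x + \<psi> k y" if "k \<in> I" for k x y
      using that add by (auto simp: I_def \<psi>_def)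
    show "\<psi> k \<in> measurable (hprod ?J) (count_space UNIV)" if "k \<in> I" for k
      using that by (auto simp: I_def \<psi>_def intro!: rowdot_nth_measurable[simplified])
  qed (auto simp: T_def)
  moreover have "card T = card S * card S'"
  proof -
    have proj: "(\<lambda>k\<in>?I1. (\<lambda>k\<in>I. case_sum c d k) (Inl k)) = c" "(\<lambda>k\<in>?I2. (\<lambda>k\<in>I. case_sum c d k) (Inr k)) = d"
      if "c \<in> S" "d \<in> S'" for c d
    proof -
      have c: "c \<in> ?I1 \<rightarrow>\<^sub>E UNIV" and d: "d \<in> ?I2 \<rightarrow>\<^sub>E UNIV" using that S by blast+
      show "(\<lambda>k\<in>?I1. (\<lambda>k\<in>I. case_sum c d k) (Inl k)) = c"
        by (rule PiE_ext[OF _ c]) (auto simp: I_def)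
      show "(\<lambda>k\<in>?I2. (\<lambda>k\<in>I. case_sum c d k) (Inr k)) = d"
        by (rule PiE_ext[OF _ d]) (auto simp: I_def)
    qed
    have "bij_betw (\<lambda>c. (\<lambda>k\<in>?I1. c (Inl k), \<lambda>k\<in>?I2. c (Inr k))) T (S \<times> S')"
    proof (rule bij_betwI[where g = "\<lambda>(c, d). \<lambda>k\<in>I. case_sum c d k"])
      show "(\<lambda>(c, d). \<lambda>k\<in>I. case_sum c d k) \<in> S \<times> S' \<rightarrow> T"
      proof safe
        fix c d assume cd: "c \<in> S" "d \<in> S'"
        then show "(\<lambda>k\<in>I. case_sum c d k) \<in> T"
          using proj by (simp add: T_def)
      qed
    next
      fix c assume c: "c \<in> T"
      show "(case (\<lambda>k\<in>?I1. c (Inl k), \<lambda>k\<in>?I2. c (Inr k)) of (c, d) \<Rightarrow> \<lambda>k\<in>I. case_sum c d k) = c"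
        using c by (intro PiE_ext[of _ I "\<lambda>_. UNIV"]) (auto simp: I_def T_def)
    next
      fix p assume "p \<in> S \<times> S'"
      then obtain c d where p: "p = (c, d)" "c \<in> S" "d \<in> S'" by blast
      then show "(\<lambda>k\<in>?I1. (case p of (c, d) \<Rightarrow> \<lambda>k\<in>I. case_sum c d k) (Inl k),
          \<lambda>k\<in>?I2. (case p of (c, d) \<Rightarrow> \<lambda>k\<in>I. case_sum c d k) (Inr k)) = p"
        using proj[OF p(2,3)] by (simp add: p(1))
    qed (auto simp: T_def)
    then show ?thesis by (simp add: bij_betw_same_card card_cartesian_product)
  qed
  moreover have "{A \<in> unit_cube ?J. (\<lambda>k\<in>I. \<psi> k A) \<in> T}
      = {A \<in> unit_cube ?J. digits m n l V A \<in> S \<and> digits m n l' W A \<in> S'}"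
  proof -
    have "(\<lambda>k\<in>?I1. (\<lambda>k\<in>I. \<psi> k A) (Inl k)) = digits m n l V A"
      "(\<lambda>k\<in>?I2. (\<lambda>k\<in>I. \<psi> k A) (Inr k)) = digits m n l' W A" for A
      by (auto simp: digits_def I_def \<psi>_def fun_eq_iff restrict_def)
    then show ?thesis by (auto simp: T_def)
  qed
  ultimately show ?thesis by (simp add: cI)
qed

lemma form_equidistributed:
  assumes nz: "\<And>i. i \<in> {1..m} \<Longrightarrow> \<exists>j\<in>{1..n}. V i j \<noteq> 0"
    and S: "S \<subseteq> (SIGMA i:{1..m}. {1..l i}) \<rightarrow>\<^sub>E UNIV"
  shows "measure (hprod ({1..m} \<times> {1..n})) {A \<in> unit_cube ({1..m} \<times> {1..n}). digits m n l V A \<in> S}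
    = card S / q ^ (\<Sum>i=1..m. l i)"
proof -
  have "(SIGMA i:{1..m}. {1..0::nat}) = {}" by auto
  then have "digits m n (\<lambda>_. 0) V A = (\<lambda>_. undefined)" for A
    by (auto simp: digits_def)
  moreover have "row_indep n (V i) (V i) (l i) 0" if "i \<in> {1..m}" for i
    using nz[OF that] row_indep_single by blast
  ultimately show ?thesis
    using two_forms_equidistributed[of m n V V l "\<lambda>_. 0" S "{\<lambda>_. undefined}"] S by simp
qed

end

section \<open>A law of large numbers from truncated second moments\<close>

text \<open>
  The sum of the \<open>Z k\<close> has finite expectation, so almost surely it converges and its terms tend to 0.\<close>

lemma (in prob_space) AE_tendsto_0_of_summable_expectation:
  fixes Z :: "nat \<Rightarrow> 'a \<Rightarrow> real"
  assumes int: "\<And>k. integrable M (Z k)" and nn: "\<And>k x. 0 \<le> Z k x"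
    and sm: "summable (\<lambda>k. expectation (Z k))"
  shows "AE x in M. (\<lambda>k. Z k x) \<longlonglongrightarrow> 0"
proof -
  have meas: "Z k \<in> borel_measurable M" for k using int by auto
  have "(\<integral>\<^sup>+x. (\<Sum>k. ennreal (Z k x)) \<partial>M) = (\<Sum>k. \<integral>\<^sup>+x. ennreal (Z k x) \<partial>M)"
    using meas by (intro nn_integral_suminf) auto
  also have "\<dots> = (\<Sum>k. ennreal (expectation (Z k)))"
    using int nn by (subst nn_integral_eq_integral) auto
  also have "\<dots> = ennreal (\<Sum>k. expectation (Z k))"
    using sm nn by (intro suminf_ennreal2) (auto intro!: Bochner_Integration.integral_nonneg)
  finally have "(\<integral>\<^sup>+x. (\<Sum>k. ennreal (Z k x)) \<partial>M) \<noteq> \<infinity>" by simp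
  then have "AE x in M. (\<Sum>k. ennreal (Z k x)) \<noteq> \<infinity>"
    using meas by (intro nn_integral_PInf_AE) auto
  then show ?thesis
  proof eventually_elim
    case (elim x)
    then have "summable (\<lambda>k. Z k x)" using nn by (intro summable_suminf_not_top) auto
    then show ?case by (rule summable_LIMSEQ_zero)
  qed
qed

text \<open>
  The sum of the truncated events \<open>H'\<close> is centred at the mean \<open>G\<close> of the full events \<open>H\<close>, which exceeds
  its own mean by the total probability of \<open>H - H'\<close>. This defect produces the last summand and allows
  the covariances to be compared with products of probabilities of the full events.\<close>

lemma (in prob_space) second_moment_truncated:
  assumes K: "finite K" and H: "\<And>k. k \<in> K \<Longrightarrow> H k \<in> events" "\<And>k. k \<in> K \<Longrightarrow> H' k \<in> events"
    and sub: "\<And>k. k \<in> K \<Longrightarrow> H' k \<subseteq> H k"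
  defines "G \<equiv> \<Sum>k\<in>K. prob (H k)"
  shows "expectation (\<lambda>x. ((\<Sum>k\<in>K. indicator (H' k) x) - G)\<^sup>2)
      = (\<Sum>k\<in>K. \<Sum>k'\<in>K. prob (H' k \<inter> H' k') - prob (H k) * prob (H k'))
        + 2 * G * (\<Sum>k\<in>K. prob (H k - H' k))" (is "?E = _")
    and "integrable M (\<lambda>x. ((\<Sum>k\<in>K. indicator (H' k) x) - G)\<^sup>2)"
proof -
  have I: "integrable M (indicator (H' k \<inter> H' k') :: _ \<Rightarrow> real)" if "k \<in> K" "k' \<in> K" for k k'
    using H that by (auto simp: emeasure_eq_measure)
  have I1: "integrable M (indicator (H' k) :: _ \<Rightarrow> real)" if "k \<in> K" for k
    using H that by (auto simp: emeasure_eq_measure)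
  have sq: "((\<Sum>k\<in>K. indicator (H' k) x) - G)\<^sup>2
      = (\<Sum>k\<in>K. \<Sum>k'\<in>K. indicator (H' k \<inter> H' k') x) - 2 * G * (\<Sum>k\<in>K. indicator (H' k) x) + G\<^sup>2" for x
    by (simp add: power2_diff power2_eq_square sum_product indicator_inter_arith algebra_simps)
  show "integrable M (\<lambda>x. ((\<Sum>k\<in>K. indicator (H' k) x) - G)\<^sup>2)"
    unfolding sq using I I1 by (intro Bochner_Integration.integrable_add Bochner_Integration.integrable_diff
        integrable_mult_right Bochner_Integration.integrable_sum) auto
  have "?E = (\<Sum>k\<in>K. \<Sum>k'\<in>K. prob (H' k \<inter> H' k')) - 2 * G * (\<Sum>k\<in>K. prob (H' k)) + G\<^sup>2"
  proof -
    have 1: "integrable M (\<lambda>x. \<Sum>k\<in>K. \<Sum>k'\<in>K. indicator (H' k \<inter> H' k') x :: real)"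
      using I by (intro Bochner_Integration.integrable_sum) auto
    have 2: "integrable M (\<lambda>x. 2 * G * (\<Sum>k\<in>K. indicator (H' k) x))"
      using I1 by (intro integrable_mult_right Bochner_Integration.integrable_sum) auto
    have e1: "expectation (\<lambda>x. \<Sum>k\<in>K. \<Sum>k'\<in>K. indicator (H' k \<inter> H' k') x :: real) = (\<Sum>k\<in>K. \<Sum>k'\<in>K. prob (H' k \<inter> H' k'))"
    proof (subst Bochner_Integration.integral_sum)
      show "(\<Sum>k\<in>K. expectation (\<lambda>x. \<Sum>k'\<in>K. indicator (H' k \<inter> H' k') x :: real)) = (\<Sum>k\<in>K. \<Sum>k'\<in>K. prob (H' k \<inter> H' k'))"
      proof (rule sum.cong[OF refl])
        fix k assume k: "k \<in> K"
        have "expectation (\<lambda>x. \<Sum>k'\<in>K. indicator (H' k \<inter> H' k') x :: real) = (\<Sum>k'\<in>K. expectation (indicator (H' k \<inter> H' k')))"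
          using I k by (intro Bochner_Integration.integral_sum) auto
        also have "\<dots> = (\<Sum>k'\<in>K. prob (H' k \<inter> H' k'))"
          using H k by (intro sum.cong refl) (simp add: Int_absorb2 sets.sets_into_space)
        finally show "expectation (\<lambda>x. \<Sum>k'\<in>K. indicator (H' k \<inter> H' k') x :: real) = (\<Sum>k'\<in>K. prob (H' k \<inter> H' k'))" .
      qed
    qed (use I in auto)
    have "expectation (\<lambda>x. \<Sum>k\<in>K. indicator (H' k) x :: real) = (\<Sum>k\<in>K. expectation (indicator (H' k)))"
      using I1 by (intro Bochner_Integration.integral_sum) auto
    also have "\<dots> = (\<Sum>k\<in>K. prob (H' k))"
      using H by (intro sum.cong refl) (simp add: Int_absorb2 sets.sets_into_space)
    finally have e2: "expectation (\<lambda>x. \<Sum>k\<in>K. indicator (H' k) x :: real) = (\<Sum>k\<in>K. prob (H' k))" .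
    show ?thesis
      unfolding sq
      by (subst Bochner_Integration.integral_add[OF Bochner_Integration.integrable_diff[OF 1 2]], simp,
          subst Bochner_Integration.integral_diff[OF 1 2]) (simp add: e1 e2 prob_space)
  qed
  moreover have "(\<Sum>k\<in>K. prob (H' k)) = G - (\<Sum>k\<in>K. prob (H k - H' k))"
    using H sub by (simp add: G_def finite_measure_Diff sum_subtractf)
  moreover have "(\<Sum>k\<in>K. \<Sum>k'\<in>K. prob (H k) * prob (H k')) = G\<^sup>2"
    by (simp add: G_def power2_eq_square sum_product)
  ultimately show "?E = (\<Sum>k\<in>K. \<Sum>k'\<in>K. prob (H' k \<inter> H' k') - prob (H k) * prob (H k'))
        + 2 * G * (\<Sum>k\<in>K. prob (H k - H' k))"
    by (simp add: sum_subtractf algebra_simps power2_eq_square)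
qed

text \<open>
  Monotone sequences whose centring grows at most linearly need to be controlled only along the
  cubes, because consecutive cubes have ratio tending to 1.\<close>

lemma tendsto_average_from_cubes:
  fixes S G :: "nat \<Rightarrow> real"
  assumes S: "mono S" and G: "mono G" and C: "\<And>N. G (Suc N) \<le> G N + C"
    and lim: "(\<lambda>k. (S (k ^ 3) - G (k ^ 3)) / real (k ^ 3)) \<longlonglongrightarrow> 0"
  shows "(\<lambda>N. (S N - G N) / real N) \<longlonglongrightarrow> 0"
proof -
  define D where "D = (\<lambda>k. (S (k ^ 3) - G (k ^ 3)) / real (k ^ 3))"
  \<comment> \<open>\<open>w k\<close> bounds the deviation for all \<open>N\<close> between \<open>k ^ 3\<close> and \<open>(k + 1) ^ 3\<close>, relative to \<open>k ^ 3\<close>.\<close>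
  define w where "w = (\<lambda>k. \<bar>D (Suc k)\<bar> * (real (Suc k) / real k) ^ 3 + \<bar>D k\<bar> + C * ((real (Suc k) / real k) ^ 3 - 1))"
  have r: "(\<lambda>k. real (Suc k) / real k) \<longlonglongrightarrow> 1" by (rule LIMSEQ_Suc_n_over_n)
  have D0: "D \<longlonglongrightarrow> 0" using lim by (simp add: D_def)
  have "w \<longlonglongrightarrow> \<bar>0\<bar> * 1 ^ 3 + \<bar>0\<bar> + C * (1 ^ 3 - 1)"
    unfolding w_def by (intro tendsto_intros r D0 LIMSEQ_Suc)
  then have w: "w \<longlonglongrightarrow> 0" by simp
  have Gadd: "G (N + d) \<le> G N + real d * C" for N d
  proof (induction d)
    case (Suc d)
    then show ?case using C[of "N + d"] by (simp add: algebra_simps)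
  qed simp
  have Gle: "G N' \<le> G N + (real N' - real N) * C" if "N \<le> N'" for N N'
    using Gadd[of N "N' - N"] that by (simp add: of_nat_diff)
  define kk where "kk = (\<lambda>N. nat \<lfloor>root 3 (real N)\<rfloor>)"
  have kk: "kk N ^ 3 \<le> N" "N < Suc (kk N) ^ 3" for N
  proof -
    have k: "real (kk N) \<le> root 3 (real N)" "root 3 (real N) < real (kk N) + 1"
      by (simp_all add: kk_def)
    have "real (kk N) ^ 3 \<le> root 3 (real N) ^ 3" by (intro power_mono k) simp
    then have "real (kk N ^ 3) \<le> real N" by simp
    then show "kk N ^ 3 \<le> N" by linarith
    have "root 3 (real N) ^ 3 < (real (kk N) + 1) ^ 3" by (intro power_strict_mono k) auto
    then have "real N < real (Suc (kk N) ^ 3)" by (simp add: add.commute)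
    then show "N < Suc (kk N) ^ 3" by linarith
  qed
  have klim: "filterlim kk at_top at_top"
    unfolding filterlim_at_top
  proof
    fix Z :: nat
    show "eventually (\<lambda>N. Z \<le> kk N) at_top"
      using eventually_ge_at_top[of "Suc Z ^ 3"]
    proof eventually_elim
      case (elim N)
      then have "Suc Z ^ 3 < Suc (kk N) ^ 3" using kk(2)[of N] by linarith
      then show ?case using power_less_imp_less_base by fastforce
    qed
  qed
  have "(\<lambda>N. w (kk N)) \<longlonglongrightarrow> 0" by (rule filterlim_compose[OF w klim])
  moreover have "eventually (\<lambda>N. norm ((S N - G N) / real N) \<le> w (kk N)) sequentially"
    using filterlim_at_top[THEN iffD1, rule_format, OF klim, of 1]
  proof eventually_elim
    case (elim N)
    define k where "k = kk N"
    have k1: "1 \<le> k" using elim by (simp add: k_def)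
    define x y where "x = real (k ^ 3)" and "y = real (Suc k ^ 3)"
    have x: "0 < x" "x \<le> real N" "real N \<le> y"
      using kk[of N] k1 by (auto simp: x_def y_def k_def simp del: of_nat_power of_nat_Suc)
    have yx: "y = (real (Suc k) / real k) ^ 3 * x" using k1 by (simp add: x_def y_def power_divide)
    have Dk: "S (k ^ 3) - G (k ^ 3) = D k * x" "S (Suc k ^ 3) - G (Suc k ^ 3) = D (Suc k) * y"
      using k1 by (simp_all add: D_def x_def y_def)
    have C0: "0 \<le> C" using C[of 0] monoD[OF G, of 0 "Suc 0"] by simp
    have GG: "G (Suc k ^ 3) \<le> G (k ^ 3) + (y - x) * C"
      unfolding x_def y_def by (rule Gle) (simp add: power_mono)
    have kN: "k ^ 3 \<le> N" "N \<le> Suc k ^ 3" using kk[of N] by (simp_all add: k_def)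
    have "S N - G N \<le> S (Suc k ^ 3) - G (k ^ 3)"
      using monoD[OF S kN(2)] monoD[OF G kN(1)] by simp
    also have "\<dots> \<le> D (Suc k) * y + (y - x) * C" using GG Dk by simp
    also have "\<dots> \<le> \<bar>D (Suc k)\<bar> * y + \<bar>D k\<bar> * x + (y - x) * C"
      using x by (smt (verit) abs_ge_self abs_ge_zero mult_nonneg_nonneg mult_right_mono)
    finally have up: "S N - G N \<le> \<bar>D (Suc k)\<bar> * y + \<bar>D k\<bar> * x + (y - x) * C" .
    have "G N - S N \<le> G (Suc k ^ 3) - S (k ^ 3)"
      using monoD[OF S kN(1)] monoD[OF G kN(2)] by simp
    also have "\<dots> \<le> - (D k * x) + (y - x) * C" using GG Dk by simp
    also have "\<dots> \<le> \<bar>D (Suc k)\<bar> * y + \<bar>D k\<bar> * x + (y - x) * C"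
    proof -
      have "- (D k * x) \<le> \<bar>D k\<bar> * x" using x mult_right_mono[of "- D k" "\<bar>D k\<bar>" x] by simp
      moreover have "0 \<le> \<bar>D (Suc k)\<bar> * y" using x by simp
      ultimately show ?thesis by linarith
    qed
    finally have "\<bar>S N - G N\<bar> \<le> \<bar>D (Suc k)\<bar> * y + \<bar>D k\<bar> * x + (y - x) * C"
      using up by linarith
    also have "\<dots> = w k * x" by (simp add: w_def yx algebra_simps)
    finally have le: "\<bar>S N - G N\<bar> \<le> w k * x" .
    have "0 \<le> w k" using le x by (smt (verit) zero_le_mult_iff)
    then have "w k * x \<le> w k * real N" using x by (intro mult_left_mono) auto
    then have "\<bar>S N - G N\<bar> \<le> w k * real N" using le by linarith
    then show ?case using x by (simp add: k_def field_simps)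
  qed
  ultimately show ?thesis by (rule Lim_null_comparison[rotated])
qed

section \<open>Counting polynomials\<close>

definition polys :: "nat \<Rightarrow> 'a::zero poly set" where
  "polys N = {p. \<forall>k\<ge>N. coeff p k = 0}"

lemma polys_card:
  "finite (polys N :: 'a::{field,finite} poly set)"
  "card (polys N :: 'a poly set) \<le> CARD('a) ^ N"
proof -
  let ?f = "\<lambda>p :: 'a poly. \<lambda>k\<in>{..<N}. coeff p k"
  have inj: "inj_on ?f (polys N)"
  proof (rule inj_onI)
    fix p r :: "'a poly" assume p: "p \<in> polys N" "r \<in> polys N" and e: "?f p = ?f r"
    show "p = r"
    proof (rule poly_eqI)
      fix k show "coeff p k = coeff r k"
        using p fun_cong[OF e, of k] by (cases "k < N") (auto simp: polys_def)
    qed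
  qed
  have im: "?f ` polys N \<subseteq> {..<N} \<rightarrow>\<^sub>E (UNIV :: 'a set)"
    by (intro image_subsetI) (simp only: restrict_PiE_iff UNIV_I, simp)
  have fin: "finite ({..<N} \<rightarrow>\<^sub>E (UNIV :: 'a set))" by (intro finite_PiE) auto
  show "finite (polys N :: 'a poly set)"
    using inj im fin by (meson finite_imageD finite_subset)
  have "card (polys N :: 'a poly set) \<le> card ({..<N} \<rightarrow>\<^sub>E (UNIV :: 'a set))"
    by (rule card_inj_on_le[OF inj im fin])
  then show "card (polys N :: 'a poly set) \<le> CARD('a) ^ N" by (simp add: card_PiE)
qed

lemma in_polys: "p = 0 \<or> degree p + \<eta> \<le> B \<Longrightarrow> p \<in> polys (B + 1 - \<eta>)"
  by (cases "p = 0") (auto simp: polys_def intro!: coeff_eq_0)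

text \<open>
  A common factor of degree \<open>\<eta>\<close> lowers the degree bound of every coordinate by \<open>\<eta>\<close>, down to the zero
  polynomial. The coordinate \<open>j0\<close> is large enough to be lowered by the full amount.\<close>

lemma sum_truncated_degrees:
  fixes b :: "nat \<Rightarrow> nat"
  assumes "j0 \<in> {1..n}" "\<eta> \<le> s * b j0"
  shows "\<eta> + (\<Sum>j=1..n. s * b j + 1 - \<eta>) \<le> n + s * (\<Sum>j=1..n. b j)"
proof -
  have "(\<Sum>j=1..n. s * b j + 1 - \<eta>) = (s * b j0 + 1 - \<eta>) + (\<Sum>j\<in>{1..n} - {j0}. s * b j + 1 - \<eta>)"
    using assms(1) by (intro sum.remove) auto
  also have "\<dots> \<le> (s * b j0 + 1 - \<eta>) + (\<Sum>j\<in>{1..n} - {j0}. s * b j + 1)"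
    by (intro add_left_mono sum_mono) simp
  finally have "\<eta> + (\<Sum>j=1..n. s * b j + 1 - \<eta>) \<le> (s * b j0 + 1) + (\<Sum>j\<in>{1..n} - {j0}. s * b j + 1)"
    using assms(2) by simp
  also have "\<dots> = (\<Sum>j=1..n. s * b j + 1)"
    using assms(1) by (intro sum.remove[symmetric]) auto
  also have "\<dots> = n + s * (\<Sum>j=1..n. b j)"
    by (simp only: sum.distrib sum_distrib_left) simp
  finally show ?thesis .
qed

lemma geometric_tail_le:
  fixes q :: real assumes "2 \<le> q"
  shows "(\<Sum>\<eta>\<in>{L<..H}. 1 / q ^ \<eta>) \<le> 1 / q ^ L"
proof (cases "L \<le> H")
  case True
  then have "(\<Sum>\<eta>\<in>{L<..H}. 1 / q ^ \<eta>) \<le> 1 / q ^ L - 1 / q ^ H"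
  proof (induction H rule: dec_induct)
    case (step H)
    have "{L<..Suc H} = insert (Suc H) {L<..H}" using step by auto
    then have "(\<Sum>\<eta>\<in>{L<..Suc H}. 1 / q ^ \<eta>) \<le> 1 / q ^ Suc H + (1 / q ^ L - 1 / q ^ H)"
      using step by simp
    moreover have "2 / q ^ Suc H \<le> 1 / q ^ H" using assms by (simp add: field_simps)
    ultimately show ?case by simp
  qed simp
  moreover have "0 \<le> 1 / q ^ H" using assms by simp
  ultimately show ?thesis by linarith
qed (use assms in simp)

lemma power_quotient_le:
  fixes q :: real assumes "1 \<le> q" "x + k \<le> c + y"
  shows "q ^ x / q ^ y \<le> q ^ c / q ^ k"
proof -
  have "q ^ (x + k) \<le> q ^ (c + y)" using assms by (intro power_increasing) auto
  then show ?thesis using assms(1) by (simp add: power_add field_simps)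
qed

section \<open>The shells of the counting problem\<close>

text \<open>
  The vectors of the shell \<open>V s\<close> have quasinorm \<open>q^s\<close>: the \<open>j\<close>-th coordinate has degree at most \<open>s b\<^sub>j\<close>,
  with equality somewhere. The set \<open>Q\<close> is a finite union of boxes; in shell \<open>s\<close> its preimage under the
  dilation by \<open>s\<close> is the target for \<open>A v\<close>.\<close>

locale shells = haar lam for lam :: "'a::{field,finite} fls measure" +
  fixes m n :: nat and a b :: "nat \<Rightarrow> nat" and E e :: nat
    and Q :: "(nat \<Rightarrow> 'a fls) set" and V :: "nat \<Rightarrow> (nat \<Rightarrow> 'a poly) set"
  assumes m: "1 \<le> m" and n: "1 \<le> n"
    and a_pos: "\<And>i. i \<in> {1..m} \<Longrightarrow> 0 < a i" and b_pos: "\<And>j. j \<in> {1..n} \<Longrightarrow> 0 < b j"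
    and weights_eq: "(\<Sum>i=1..m. a i) = (\<Sum>j=1..n. b j)"
    and Q_level: "level_set {1..m} (\<lambda>_. int e) Q"
    and Q_bounded: "\<And>x i k. x \<in> Q \<Longrightarrow> i \<in> {1..m} \<Longrightarrow> k \<le> - int E \<Longrightarrow> x i $$ k = 0"
    and V_ext: "\<And>s v. v \<in> V s \<Longrightarrow> v \<in> {1..n} \<rightarrow>\<^sub>E UNIV"
    and V_le: "\<And>s v j. v \<in> V s \<Longrightarrow> j \<in> {1..n} \<Longrightarrow> v j = 0 \<or> degree (v j) \<le> s * b j"
    and V_eq: "\<And>s v. v \<in> V s \<Longrightarrow> \<exists>j\<in>{1..n}. v j \<noteq> 0 \<and> degree (v j) = s * b j"
begin

abbreviation wt :: nat where "wt \<equiv> \<Sum>i=1..m. a i"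
abbreviation U :: "(nat \<times> nat \<Rightarrow> 'a fls) set" where "U \<equiv> unit_cube ({1..m} \<times> {1..n})"
abbreviation mats :: "(nat \<times> nat \<Rightarrow> 'a fls) measure" where "mats \<equiv> hprod ({1..m} \<times> {1..n})"

text \<open>
  The distinction between \<open>A v\<close> and \<open>A v - p\<close> with a polynomial vector \<open>p\<close> disappears in the fractional
  part, which is the only possible candidate once the target lies in the unit cube.\<close>

definition hit :: "nat \<Rightarrow> (nat \<Rightarrow> 'a poly) \<Rightarrow> (nat \<times> nat \<Rightarrow> 'a fls) \<Rightarrow> bool" where
  "hit s v A \<longleftrightarrow> (\<lambda>i\<in>{1..m}. fls_shift (int (s * a i)) (fpart (rowdot n A v i))) \<in> Q"

definition hits :: "nat \<Rightarrow> (nat \<Rightarrow> 'a poly) \<Rightarrow> (nat \<times> nat \<Rightarrow> 'a fls) set" where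
  "hits s v = {A \<in> U. hit s v A}"

text \<open>
  In coordinate \<open>i\<close> the first \<open>lev s i\<close> digits after the point decide whether the target of shell \<open>s\<close> is
  hit, and the first \<open>slab s i\<close> of them are zero for every hit.\<close>

definition lev :: "nat \<Rightarrow> nat \<Rightarrow> nat" where "lev s i = e + s * a i"

definition slab :: "nat \<Rightarrow> nat \<Rightarrow> nat" where "slab s i = s * a i - E"

definition patterns :: "nat \<Rightarrow> (nat \<times> nat \<Rightarrow> 'a) set" where
  "patterns s = (\<lambda>x. \<lambda>(i, k)\<in>(SIGMA i:{1..m}. {1..lev s i}). x i $$ int k) `
     {x \<in> unit_cube {1..m}. (\<lambda>i\<in>{1..m}. fls_shift (int (s * a i)) (x i)) \<in> Q}"

definition zeros :: "(nat \<Rightarrow> nat) \<Rightarrow> (nat \<Rightarrow> nat \<Rightarrow> 'a poly) \<Rightarrow> (nat \<times> nat \<Rightarrow> 'a fls) \<Rightarrow> bool" where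
  "zeros l F A \<longleftrightarrow> (\<forall>i\<in>{1..m}. \<forall>k\<in>{1..l i}. rowdot n A (F i) i $$ int k = 0)"

definition \<mu> :: "nat \<Rightarrow> real" where
  "\<mu> s = card (patterns s) / q ^ (\<Sum>i=1..m. lev s i)"

lemma V_nonzero: "v \<in> V s \<Longrightarrow> \<exists>j\<in>{1..n}. v j \<noteq> 0"
  using V_eq by blast

lemma level_transfer:
  assumes x: "x \<in> unit_cube {1..m}" and y: "y \<in> unit_cube {1..m}"
    and eq: "\<And>i k. i \<in> {1..m} \<Longrightarrow> k \<in> {1..lev s i} \<Longrightarrow> x i $$ int k = y i $$ int k"
    and xQ: "(\<lambda>i\<in>{1..m}. fls_shift (int (s * a i)) (x i)) \<in> Q"
  shows "(\<lambda>i\<in>{1..m}. fls_shift (int (s * a i)) (y i)) \<in> Q"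
proof -
  have "fls_shift (int (s * a i)) (y i) - fls_shift (int (s * a i)) (x i) \<in> vball (int e)" if i: "i \<in> {1..m}" for i
  proof -
    have "y i $$ k = x i $$ k" if "k \<le> int (lev s i)" for k
    proof (cases "k \<le> 0")
      case True
      have "x i \<in> vball 0" "y i \<in> vball 0" using x y i by (auto simp: unit_cube_def)
      then show ?thesis using True by (auto simp: vball_def)
    next
      case False
      then have "nat k \<in> {1..lev s i}" using that by auto
      from eq[OF i this] show ?thesis using False by simp
    qed
    then have "y i $$ (j + int (s * a i)) = x i $$ (j + int (s * a i))" if "j \<le> int e" for j
      using that by (auto simp: lev_def)
    then show ?thesis by (simp add: vball_def)
  qed
  then show ?thesis using Q_level xQ unfolding level_set_def by auto
qed

lemma hit_iff: "hit s v A \<longleftrightarrow> digits m n (lev s) (\<lambda>_. v) A \<in> patterns s"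
proof
  let ?y = "\<lambda>i\<in>{1..m}. fpart (rowdot n A v i)"
  have y: "?y \<in> unit_cube {1..m}" by (auto simp: unit_cube_def)
  have sh: "(\<lambda>i\<in>{1..m}. fls_shift (int (s * a i)) (?y i)) = (\<lambda>i\<in>{1..m}. fls_shift (int (s * a i)) (fpart (rowdot n A v i)))"
    by (auto simp: fun_eq_iff)
  have dg: "digits m n (lev s) (\<lambda>_. v) A = (\<lambda>(i, k)\<in>(SIGMA i:{1..m}. {1..lev s i}). ?y i $$ int k)"
    unfolding digits_def by (rule restrict_ext) (auto simp: fpart_nth)
  {
    assume "hit s v A"
    then show "digits m n (lev s) (\<lambda>_. v) A \<in> patterns s"
      unfolding patterns_def dg using y sh by (intro image_eqI[where x = ?y]) (auto simp: hit_def)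
  }
  {
    assume "digits m n (lev s) (\<lambda>_. v) A \<in> patterns s"
    then obtain x where x: "x \<in> unit_cube {1..m}" "(\<lambda>i\<in>{1..m}. fls_shift (int (s * a i)) (x i)) \<in> Q"
      and e: "(\<lambda>(i, k)\<in>(SIGMA i:{1..m}. {1..lev s i}). ?y i $$ int k) = (\<lambda>(i, k)\<in>(SIGMA i:{1..m}. {1..lev s i}). x i $$ int k)"
      unfolding patterns_def dg by blast
    have "x i $$ int k = ?y i $$ int k" if "i \<in> {1..m}" "k \<in> {1..lev s i}" for i k
      using fun_cong[OF e, of "(i, k)"] that by simp
    from level_transfer[OF x(1) y this x(2)] show "hit s v A"
      unfolding sh hit_def by blast
  }
qed

lemma patterns_sub: "patterns s \<subseteq> (SIGMA i:{1..m}. {1..lev s i}) \<rightarrow>\<^sub>E UNIV"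
  unfolding patterns_def by (intro image_subsetI) (simp only: restrict_PiE_iff UNIV_I, simp)

lemma digits_measurable:
  "{A \<in> U. digits m n l F A \<in> S} \<in> sets mats"
proof -
  let ?I = "SIGMA i:{1..m}. {1..l i}"
  let ?S = "S \<inter> (?I \<rightarrow>\<^sub>E UNIV)"
  have fin: "finite (?I \<rightarrow>\<^sub>E (UNIV :: 'a set))" by (intro finite_PiE) auto
  have dI: "digits m n l F A \<in> ?I \<rightarrow>\<^sub>E UNIV" for A
    unfolding digits_def by (simp only: restrict_PiE_iff UNIV_I, simp)
  have "{A \<in> U. digits m n l F A = c} \<in> sets mats" if c: "c \<in> ?I \<rightarrow>\<^sub>E UNIV" for c
  proof -
    have "digits m n l F A = c \<longleftrightarrow> (\<forall>p\<in>?I. rowdot n A (F (fst p)) (fst p) $$ int (snd p) = c p)" for A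
      using c by (auto simp: digits_def fun_eq_iff PiE_iff extensional_def restrict_def split: if_splits)
    moreover have "U \<subseteq> space mats" by (auto simp: unit_cube_def space_hprod)
    ultimately have "{A \<in> U. digits m n l F A = c}
      = U \<inter> {A \<in> space mats. \<forall>p\<in>?I. rowdot n A (F (fst p)) (fst p) $$ int (snd p) = c p}"
      by blast
    also have "\<dots> \<in> sets mats"
    proof (intro sets.Int sets.sets_Collect_finite_All)
      fix p assume "p \<in> ?I"
      then have "(\<lambda>A. rowdot n A (F (fst p)) (fst p) $$ int (snd p)) \<in> measurable mats (count_space UNIV)"
        by (intro rowdot_nth_measurable) auto
      from measurable_sets[OF this, of "{c p}"]
      show "{A \<in> space mats. rowdot n A (F (fst p)) (fst p) $$ int (snd p) = c p} \<in> sets mats"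
        by (simp add: vimage_def Int_def conj_commute)
    qed auto
    finally show ?thesis .
  qed
  then have "(\<Union>c\<in>?S. {A \<in> U. digits m n l F A = c}) \<in> sets mats"
    using fin by (intro sets.finite_UN) (auto intro: finite_subset)
  moreover have "(\<Union>c\<in>?S. {A \<in> U. digits m n l F A = c}) = {A \<in> U. digits m n l F A \<in> S}"
    using dI by auto
  ultimately show ?thesis by simp
qed

lemma zeros_iff: "zeros l F A \<longleftrightarrow> digits m n l F A \<in> {\<lambda>p\<in>(SIGMA i:{1..m}. {1..l i}). 0}"
proof -
  have "(\<lambda>p\<in>I. f p) = (\<lambda>p\<in>I. g p) \<longleftrightarrow> (\<forall>p\<in>I. f p = g p)" for f g :: "nat \<times> nat \<Rightarrow> 'a" and I
    by (auto simp: fun_eq_iff restrict_def split: if_splits)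
  from this[of "\<lambda>(i, k). rowdot n A (F i) i $$ int k" "SIGMA i:{1..m}. {1..l i}" "\<lambda>_. 0"]
  show ?thesis by (auto simp: zeros_def digits_def)
qed

lemma zeros_measurable: "{A \<in> U. zeros l F A} \<in> sets mats"
  unfolding zeros_iff by (rule digits_measurable)

lemma hits_measurable [measurable, simp]: "hits s v \<in> sets mats"
  unfolding hits_def hit_iff by (rule digits_measurable)

lemma measure_hits:
  assumes "v \<in> V s"
  shows "measure mats (hits s v) = \<mu> s"
  unfolding hits_def hit_iff \<mu>_def
  using V_nonzero[OF assms] patterns_sub by (intro form_equidistributed) auto

lemma measure_hits_indep:
  assumes "\<And>i. i \<in> {1..m} \<Longrightarrow> row_indep n v w (lev s i) (lev s' i)"
  shows "measure mats (hits s v \<inter> hits s' w) = \<mu> s * \<mu> s'"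
proof -
  have "hits s v \<inter> hits s' w
    = {A \<in> U. digits m n (lev s) (\<lambda>_. v) A \<in> patterns s \<and> digits m n (lev s') (\<lambda>_. w) A \<in> patterns s'}"
    by (auto simp: hits_def hit_iff)
  then show ?thesis
    using two_forms_equidistributed[OF assms patterns_sub patterns_sub] by (simp add: \<mu>_def power_add)
qed

lemma measure_zeros:
  assumes "\<exists>j\<in>{1..n}. v j \<noteq> 0"
  shows "measure mats {A \<in> U. zeros l (\<lambda>_. v) A} = 1 / q ^ (\<Sum>i=1..m. l i)"
proof -
  have "measure mats {A \<in> U. digits m n l (\<lambda>_. v) A \<in> {\<lambda>p\<in>(SIGMA i:{1..m}. {1..l i}). 0}}
    = card {\<lambda>p\<in>(SIGMA i:{1..m}. {1..l i}). 0 :: 'a} / q ^ (\<Sum>i=1..m. l i)"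
    using assms by (intro form_equidistributed) auto
  then show ?thesis unfolding zeros_iff by simp
qed

lemma measure_zeros_two:
  assumes "\<And>i. i \<in> {1..m} \<Longrightarrow> row_indep n (F i) (W i) (l i) (l' i)"
  shows "measure mats {A \<in> U. zeros l F A \<and> zeros l' W A} = 1 / q ^ ((\<Sum>i=1..m. l i) + (\<Sum>i=1..m. l' i))"
proof -
  have "measure mats {A \<in> U. digits m n l F A \<in> {\<lambda>p\<in>(SIGMA i:{1..m}. {1..l i}). 0}
      \<and> digits m n l' W A \<in> {\<lambda>p\<in>(SIGMA i:{1..m}. {1..l' i}). 0}}
    = (card {\<lambda>p\<in>(SIGMA i:{1..m}. {1..l i}). 0 :: 'a} * card {\<lambda>p\<in>(SIGMA i:{1..m}. {1..l' i}). 0 :: 'a})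
        / q ^ ((\<Sum>i=1..m. l i) + (\<Sum>i=1..m. l' i))"
    by (intro two_forms_equidistributed assms) auto
  then show ?thesis unfolding zeros_iff by simp
qed

text \<open>
  From shell \<open>E\<close> on the target lies in the unit cube. Its digit patterns then describe all of it, and
  their proportion among all patterns is its volume.\<close>

lemma \<mu>_eq:
  assumes "E \<le> s"
  shows "\<mu> s = q powr (- real (s * wt)) * measure (hprod {1..m}) Q"
proof -
  let ?I = "SIGMA i:{1..m}. {1..lev s i}"
  let ?sh = "\<lambda>x. \<lambda>i\<in>{1..m}. fls_shift (int (s * a i)) (x i)"
  let ?\<psi> = "\<lambda>(i, k) x. x i $$ int k"
  have meas: "?\<psi> p \<in> measurable (hprod {1..m}) (count_space UNIV)" if pI: "p \<in> ?I" for p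
  proof -
    obtain i k where p: "p = (i, k)" "i \<in> {1..m}" using pI by (cases p) auto
    have "(\<lambda>x. x i) \<in> measurable (hprod {1..m}) lam" using p by simp
    moreover have "(\<lambda>x. (x * emb 1) $$ int k) \<in> measurable lam (count_space (UNIV :: 'a set))"
      using fls_nth_mult_emb_measurable by (simp only: measurable_cong_sets[OF sets_lam refl])
    ultimately have "(\<lambda>x. (x i * emb 1) $$ int k) \<in> measurable (hprod {1..m}) (count_space UNIV)"
      by (rule measurable_compose)
    then show ?thesis by (simp add: p)
  qed
  have surj: "\<exists>x\<in>unit_cube {1..m}. \<forall>p\<in>?I. ?\<psi> p x = c p" for c
    by (rule bexI[of _ "\<lambda>i\<in>{1..m}. fpart (fps_to_fls (Abs_fps (\<lambda>k. c (i, k))))"])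
      (auto simp: unit_cube_def fpart_nth)
  have "measure (hprod {1..m}) {x \<in> unit_cube {1..m}. (\<lambda>p\<in>?I. ?\<psi> p x) \<in> patterns s}
      = card (patterns s) / q ^ card ?I"
    by (rule functionals_equidistributed(2)[OF _ _ _ meas surj patterns_sub]) auto
  moreover have "card ?I = (\<Sum>i=1..m. lev s i)" by simp
  moreover have "{x \<in> unit_cube {1..m}. (\<lambda>p\<in>?I. ?\<psi> p x) \<in> patterns s} = {x \<in> {1..m} \<rightarrow>\<^sub>E UNIV. ?sh x \<in> Q}"
  proof (intro equalityI subsetI)
    fix y assume "y \<in> {x \<in> unit_cube {1..m}. (\<lambda>p\<in>?I. ?\<psi> p x) \<in> patterns s}"
    then obtain x where y: "y \<in> unit_cube {1..m}" and x: "x \<in> unit_cube {1..m}" "?sh x \<in> Q"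
      and e: "(\<lambda>p\<in>?I. ?\<psi> p y) = (\<lambda>(i, k)\<in>?I. x i $$ int k)"
      unfolding patterns_def by blast
    have "x i $$ int k = y i $$ int k" if "i \<in> {1..m}" "k \<in> {1..lev s i}" for i k
      using fun_cong[OF e, of "(i, k)"] that by simp
    from level_transfer[OF x(1) y this x(2)] show "y \<in> {x \<in> {1..m} \<rightarrow>\<^sub>E UNIV. ?sh x \<in> Q}"
      using y by (auto simp: unit_cube_def PiE_iff)
  next
    fix x assume x: "x \<in> {x \<in> {1..m} \<rightarrow>\<^sub>E UNIV. ?sh x \<in> Q}"
    have "x i \<in> vball 0" if i: "i \<in> {1..m}" for i
    proof -
      have "x i $$ k = 0" if "k \<le> 0" for k
      proof -
        have "E \<le> s * a i" using assms a_pos[OF i] by (metis Suc_leI mult.right_neutral mult_le_mono One_nat_def)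
        then have "k - int (s * a i) \<le> - int E" using that by linarith
        then have "?sh x i $$ (k - int (s * a i)) = 0" using x Q_bounded i by blast
        then show ?thesis using i by simp
      qed
      then show ?thesis by (simp add: vball_def)
    qed
    then have "x \<in> unit_cube {1..m}" using x by (auto simp: unit_cube_def PiE_iff)
    then show "x \<in> {x \<in> unit_cube {1..m}. (\<lambda>p\<in>?I. ?\<psi> p x) \<in> patterns s}"
      using x unfolding patterns_def by (auto simp: case_prod_unfold)
  qed
  moreover have "measure (hprod {1..m}) {x \<in> {1..m} \<rightarrow>\<^sub>E UNIV. ?sh x \<in> Q}
      = q powr (- real (s * wt)) * measure (hprod {1..m}) Q"
    using emeasure_hprod_shift[of "{1..m}" Q "\<lambda>i. int (s * a i)"] level_set_sets[OF _ Q_level]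
    by (simp add: measure_def enn2real_mult sum_distrib_left)
  ultimately show ?thesis by (simp add: \<mu>_def)
qed

lemma hit_zeros:
  assumes "hit s v A"
  shows "zeros (slab s) (\<lambda>_. v) A"
  unfolding zeros_def
proof (intro ballI)
  fix i k assume i: "i \<in> {1..m}" and k: "k \<in> {1..slab s i}"
  have "k + E \<le> s * a i" using k by (auto simp: slab_def)
  then have "int k + int E \<le> int (s * a i)" by (simp only: of_nat_add[symmetric] of_nat_le_iff)
  then have "int k - int (s * a i) \<le> - int E" by linarith
  then have "(\<lambda>i\<in>{1..m}. fls_shift (int (s * a i)) (fpart (rowdot n A v i))) i $$ (int k - int (s * a i)) = 0"
    using assms Q_bounded i unfolding hit_def by blast
  then show "rowdot n A v i $$ int k = 0" using i k by (simp add: fpart_nth)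
qed

text \<open>
  A very good approximation \<open>u\<close> makes all its multiples hit, which is what makes the second moment large
  in dimension 2. The predicate says that a hit by \<open>v = h u\<close> arises in this way from a factor of degree
  above \<open>L\<close>: the distance of \<open>A u\<close> to the polynomial vectors is smaller by the factor \<open>|h|\<close> than the
  bound for \<open>A v\<close>. Such hits are removed in \<open>thits\<close>.\<close>

definition divisible :: "nat \<Rightarrow> nat \<Rightarrow> (nat \<Rightarrow> 'a poly) \<Rightarrow> (nat \<times> nat \<Rightarrow> 'a fls) \<Rightarrow> bool" where
  "divisible L s v A \<longleftrightarrow> (\<exists>h u. L < degree h \<and> u \<in> {1..n} \<rightarrow>\<^sub>E UNIV \<and> (\<lambda>j\<in>{1..n}. h * u j) = v
     \<and> zeros (\<lambda>i. slab s i + degree h) (\<lambda>_. u) A)"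

definition thits :: "nat \<Rightarrow> nat \<Rightarrow> (nat \<Rightarrow> 'a poly) \<Rightarrow> (nat \<times> nat \<Rightarrow> 'a fls) set" where
  "thits L s v = {A \<in> hits s v. \<not> divisible L s v A}"

lemma thits_sub: "thits L s v \<subseteq> hits s v"
  by (auto simp: thits_def)

lemma thits_measurable [measurable, simp]: "thits L s v \<in> sets mats"
proof -
  define D where "D = {(h, u). L < degree h \<and> u \<in> {1..n} \<rightarrow>\<^sub>E (UNIV :: 'a poly set) \<and> (\<lambda>j\<in>{1..n}. h * u j) = v}"
  have "countable D"
  proof (rule countable_subset)
    show "D \<subseteq> UNIV \<times> ({1..n} \<rightarrow>\<^sub>E UNIV)" by (auto simp: D_def)
  qed (intro countable_SIGMA countable_PiE countable_poly, simp)
  then have "(\<Union>p\<in>D. {A \<in> U. zeros (\<lambda>i. slab s i + degree (fst p)) (\<lambda>_. snd p) A}) \<in> sets mats"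
    using zeros_measurable by (intro sets.countable_UN') auto
  then have "hits s v - (\<Union>p\<in>D. {A \<in> U. zeros (\<lambda>i. slab s i + degree (fst p)) (\<lambda>_. snd p) A}) \<in> sets mats"
    by (rule sets.Diff[OF hits_measurable])
  moreover have "hits s v - (\<Union>p\<in>D. {A \<in> U. zeros (\<lambda>i. slab s i + degree (fst p)) (\<lambda>_. snd p) A}) = thits L s v"
    unfolding thits_def divisible_def D_def hits_def by (auto simp: Bex_def)
  ultimately show ?thesis by simp
qed

lemma slab_sum: "s * wt \<le> (\<Sum>i=1..m. slab s i) + m * E"
proof -
  have "s * wt = (\<Sum>i=1..m. s * a i)" by (simp add: sum_distrib_left)
  also have "\<dots> \<le> (\<Sum>i=1..m. slab s i + E)" by (intro sum_mono) (simp add: slab_def)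
  also have "\<dots> = (\<Sum>i=1..m. slab s i) + m * E" by (simp add: sum.distrib)
  finally show ?thesis .
qed

lemma V_finite: "finite (V s)" and V_card: "real (card (V s)) \<le> q ^ (n + s * wt)"
proof -
  let ?P = "\<Pi>\<^sub>E j\<in>{1..n}. polys (s * b j + 1) :: 'a poly set"
  have sub: "V s \<subseteq> ?P"
  proof
    fix v assume v: "v \<in> V s"
    have "v j \<in> polys (s * b j + 1)" if "j \<in> {1..n}" for j
      using in_polys[of "v j" 0 "s * b j"] V_le[OF v that] by simp
    then show "v \<in> ?P" using V_ext[OF v] by (auto simp: PiE_iff)
  qed
  have fin: "finite ?P" by (intro finite_PiE polys_card) simp
  show "finite (V s)" using sub fin by (rule finite_subset)
  have "real (card (V s)) \<le> real (card ?P)" using card_mono[OF fin sub] by simp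
  also have "\<dots> = (\<Prod>j=1..n. real (card (polys (s * b j + 1) :: 'a poly set)))" by (simp add: card_PiE)
  also have "\<dots> \<le> (\<Prod>j=1..n. q ^ (s * b j + 1))"
  proof (intro prod_mono conjI)
    fix j show "real (card (polys (s * b j + 1) :: 'a poly set)) \<le> q ^ (s * b j + 1)"
      using polys_card(2)[where 'a = 'a, of "s * b j + 1"] by (metis of_nat_le_iff of_nat_power q_def)
  qed simp
  also have "\<dots> = q ^ (n + s * wt)"
    by (simp only: power_sum[symmetric] sum.distrib sum_distrib_left weights_eq) (simp add: add.commute)
  finally show "real (card (V s)) \<le> q ^ (n + s * wt)" .
qed

end

section \<open>Correlations between hits\<close>

lemma row_indep_sym: "row_indep n v w l l' \<Longrightarrow> row_indep n w v l' l"
  unfolding row_indep_def by blast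

context shells
begin

abbreviation P :: "(nat \<times> nat \<Rightarrow> 'a fls) measure" where "P \<equiv> restrict_space mats U"

lemma U_mats: "U \<in> sets mats"
  by (rule unit_cube_sets) simp

lemma measure_P: "X \<subseteq> U \<Longrightarrow> measure P X = measure mats X"
  using U_mats by (intro measure_restrict_space) (auto simp: Int_absorb2 sets.sets_into_space)

lemma space_P: "space P = U"
  using U_mats by (simp add: space_restrict_space Int_absorb2 sets.sets_into_space)

lemma sets_P: "X \<in> sets mats \<Longrightarrow> X \<subseteq> U \<Longrightarrow> X \<in> sets P"
  using U_mats by (subst sets_restrict_space_iff) (auto simp: Int_absorb2 sets.sets_into_space)

lemma prob_space_P: "prob_space P"
proof
  show "emeasure P (space P) = 1"
    using U_mats emeasure_unit_cube[of "{1..m} \<times> {1..n}"]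
    by (simp add: space_P emeasure_restrict_space Int_absorb2 sets.sets_into_space)
qed

sublocale P: prob_space P by (rule prob_space_P)

lemma hits_P: "hits s v \<in> sets P" and thits_P: "thits L s v \<in> sets P"
  using sets_P[OF hits_measurable] sets_P[OF thits_measurable] thits_sub
  by (auto simp: hits_def thits_def)

lemma zeros_P: "{A \<in> U. zeros l F A} \<in> sets P"
  by (rule sets_P[OF zeros_measurable]) auto

abbreviation scale :: "'a poly \<Rightarrow> (nat \<Rightarrow> 'a poly) \<Rightarrow> nat \<Rightarrow> 'a poly" where
  "scale h u \<equiv> (\<lambda>j\<in>{1..n}. h * u j)"

abbreviation vecs :: "(nat \<Rightarrow> 'a poly) set" where "vecs \<equiv> {1..n} \<rightarrow>\<^sub>E UNIV"

text \<open>
  A set that contains every \<open>u\<close> in a factorisation \<open>v = h u\<close> of a vector of shell \<open>s\<close> with \<open>degree h = \<eta>\<close>.\<close>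

definition cofactors :: "nat \<Rightarrow> nat \<Rightarrow> (nat \<Rightarrow> 'a poly) set" where
  "cofactors s \<eta> = (\<Pi>\<^sub>E j\<in>{1..n}. polys (s * b j + 1 - \<eta>))"

lemma polys_le: "real (card (polys N :: 'a poly set)) \<le> q ^ N"
  using polys_card(2)[where 'a = 'a, of N] by (metis of_nat_le_iff of_nat_power q_def)

lemma cofactors_card: "finite (cofactors s \<eta>)" "real (card (cofactors s \<eta>)) \<le> q ^ (\<Sum>j=1..n. s * b j + 1 - \<eta>)"
proof -
  show "finite (cofactors s \<eta>)" unfolding cofactors_def by (intro finite_PiE polys_card) simp
  have "real (card (cofactors s \<eta>)) = (\<Prod>j=1..n. real (card (polys (s * b j + 1 - \<eta>) :: 'a poly set)))"
    by (simp add: cofactors_def card_PiE)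
  also have "\<dots> \<le> (\<Prod>j=1..n. q ^ (s * b j + 1 - \<eta>))"
    by (intro prod_mono conjI polys_le) simp
  also have "\<dots> = q ^ (\<Sum>j=1..n. s * b j + 1 - \<eta>)" by (simp only: power_sum)
  finally show "real (card (cofactors s \<eta>)) \<le> q ^ (\<Sum>j=1..n. s * b j + 1 - \<eta>)" .
qed

lemma scale_in_V:
  assumes "scale h u \<in> V s" "u \<in> vecs"
  shows "h \<noteq> 0" "u \<in> cofactors s (degree h)" "\<exists>j\<in>{1..n}. u j \<noteq> 0"
    "\<exists>j\<in>{1..n}. u j \<noteq> 0 \<and> degree h + degree (u j) = s * b j"
proof -
  obtain j0 where j0: "j0 \<in> {1..n}" "h * u j0 \<noteq> 0" "degree (h * u j0) = s * b j0"
    using V_eq[OF assms(1)] by auto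
  show h: "h \<noteq> 0" using j0 by auto
  show "\<exists>j\<in>{1..n}. u j \<noteq> 0 \<and> degree h + degree (u j) = s * b j"
    using j0 by (intro bexI[OF _ j0(1)]) (auto simp: degree_mult_eq)
  then show "\<exists>j\<in>{1..n}. u j \<noteq> 0" by blast
  have "u j \<in> polys (s * b j + 1 - degree h)" if j: "j \<in> {1..n}" for j
  proof (rule in_polys)
    show "u j = 0 \<or> degree (u j) + degree h \<le> s * b j"
      using V_le[OF assms(1) j] j h by (cases "u j = 0") (auto simp: degree_mult_eq add.commute)
  qed
  then show "u \<in> cofactors s (degree h)" using assms(2) by (auto simp: cofactors_def PiE_iff)
qed

lemma degree_in_polys: "p \<in> polys (degree p + 1)"
  using in_polys[of p 0 "degree p"] by simp

text \<open>
  There are about \<open>|h|\<close> polynomials of the degree of \<open>h\<close>. Each divisor \<open>h\<close> saves a factor \<open>|h|\<close> in the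
  probability for each of the \<open>m \<ge> 1\<close> rows, and at least one more factor \<open>|h|\<close> in the number of vectors
  \<open>u\<close>. So the sum over \<open>h\<close> is dominated by a geometric series in the degree.\<close>

lemma truncation_cost:
  "(\<Sum>v\<in>V s. measure P (hits s v - thits L s v)) \<le> q ^ (1 + n + m * E) / q ^ L"
proof -
  define D where "D = {(h, u). L < degree h \<and> u \<in> vecs \<and> scale h u \<in> V s}"
  define g where "g = (\<lambda>\<eta>. 1 / q ^ (\<Sum>i=1..m. slab s i + \<eta>))"
  define H where "H = (\<Sum>j=1..n. s * b j)"
  define D\<eta> where "D\<eta> = (\<lambda>\<eta>. {p \<in> D. degree (fst p) = \<eta>})"
  have deg_le: "\<exists>j\<in>{1..n}. degree h \<le> s * b j" if hu: "(h, u) \<in> D" for h u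
  proof -
    obtain j where "j \<in> {1..n}" "degree h + degree (u j) = s * b j"
      using hu scale_in_V(4)[of h u s] by (auto simp: D_def)
    then show ?thesis by (metis le_add1)
  qed
  have degH: "degree h \<le> H" if hu: "(h, u) \<in> D" for h u
  proof -
    obtain j where "j \<in> {1..n}" "degree h \<le> s * b j" using deg_le[OF hu] by blast
    moreover have "s * b j \<le> H" unfolding H_def using \<open>j \<in> {1..n}\<close> by (intro member_le_sum) auto
    ultimately show ?thesis by linarith
  qed
  have D\<eta>_sub: "D\<eta> \<eta> \<subseteq> polys (\<eta> + 1) \<times> cofactors s \<eta>" for \<eta>
    using scale_in_V(2) degree_in_polys by (fastforce simp: D\<eta>_def D_def)
  have fin\<eta>: "finite (polys (\<eta> + 1) \<times> cofactors s \<eta> :: ('a poly \<times> (nat \<Rightarrow> 'a poly)) set)" for \<eta>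
    by (intro finite_cartesian_product polys_card cofactors_card)
  have D_UN: "D = (\<Union>\<eta>\<in>{L<..H}. D\<eta> \<eta>)"
    using degH by (auto simp: D\<eta>_def) (auto simp: D_def)
  have finD: "finite D"
    unfolding D_UN using D\<eta>_sub fin\<eta> by (intro finite_UN_I) (auto intro: finite_subset)
  have one: "measure P (hits s v - thits L s v) \<le> (\<Sum>p\<in>{p \<in> D. scale (fst p) (snd p) = v}. g (degree (fst p)))"
    if v: "v \<in> V s" for v
  proof -
    let ?X = "\<lambda>p. {A \<in> U. zeros (\<lambda>i. slab s i + degree (fst p)) (\<lambda>_. snd p) A}"
    let ?Dv = "{p \<in> D. scale (fst p) (snd p) = v}"
    have sub: "hits s v - thits L s v \<subseteq> (\<Union>p\<in>?Dv. ?X p)"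
    proof
      fix A assume "A \<in> hits s v - thits L s v"
      then have A: "A \<in> U" "divisible L s v A" by (auto simp: hits_def thits_def)
      then obtain h u where hu: "L < degree h" "u \<in> vecs" "scale h u = v"
        "zeros (\<lambda>i. slab s i + degree h) (\<lambda>_. u) A" unfolding divisible_def by blast
      then have "(h, u) \<in> ?Dv" using v by (simp add: D_def)
      moreover have "A \<in> ?X (h, u)" using A hu by simp
      ultimately show "A \<in> (\<Union>p\<in>?Dv. ?X p)" by blast
    qed
    have "measure P (hits s v - thits L s v) \<le> measure P (\<Union>p\<in>?Dv. ?X p)"
      using finD by (intro P.finite_measure_mono[OF sub] sets.finite_UN zeros_P) auto
    also have "\<dots> \<le> (\<Sum>p\<in>?Dv. measure P (?X p))"
      using finD zeros_P by (intro P.finite_measure_subadditive_finite) auto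
    also have "\<dots> = (\<Sum>p\<in>?Dv. g (degree (fst p)))"
    proof (rule sum.cong[OF refl])
      fix p assume p: "p \<in> ?Dv"
      obtain h u where hu: "p = (h, u)" by (cases p)
      have "\<exists>j\<in>{1..n}. u j \<noteq> 0" using p v hu scale_in_V(3)[of h u s] by (auto simp: D_def)
      then show "measure P (?X p) = g (degree (fst p))"
        using measure_P[of "?X p"] measure_zeros[of u] by (auto simp: g_def hu)
    qed
    finally show ?thesis .
  qed
  have "(\<Sum>v\<in>V s. measure P (hits s v - thits L s v))
      \<le> (\<Sum>v\<in>V s. \<Sum>p\<in>{p \<in> D. scale (fst p) (snd p) = v}. g (degree (fst p)))"
    by (intro sum_mono one)
  also have "\<dots> = (\<Sum>p\<in>D. g (degree (fst p)))"
    by (rule sum.group[OF finD V_finite]) (auto simp: D_def)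
  also have "\<dots> = (\<Sum>\<eta>\<in>{L<..H}. \<Sum>p\<in>{p \<in> D. degree (fst p) = \<eta>}. g (degree (fst p)))"
    by (rule sum.group[symmetric, OF finD]) (use D_UN in \<open>auto simp: D\<eta>_def\<close>)
  also have "\<dots> = (\<Sum>\<eta>\<in>{L<..H}. real (card (D\<eta> \<eta>)) * g \<eta>)"
    by (intro sum.cong) (auto simp: D\<eta>_def)
  also have "\<dots> \<le> (\<Sum>\<eta>\<in>{L<..H}. q ^ (1 + n + m * E) * (1 / q ^ \<eta>))"
  proof (rule sum_mono)
    fix \<eta>
    show "real (card (D\<eta> \<eta>)) * g \<eta> \<le> q ^ (1 + n + m * E) * (1 / q ^ \<eta>)"
    proof (cases "D\<eta> \<eta> = {}")
      case False
      then obtain h u where "(h, u) \<in> D" "degree h = \<eta>" by (auto simp: D\<eta>_def)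
      then obtain j0 where j0: "j0 \<in> {1..n}" "\<eta> \<le> s * b j0" using deg_le by blast
      let ?S = "\<Sum>j=1..n. s * b j + 1 - \<eta>"
      have "real (card (D\<eta> \<eta>)) \<le> real (card (polys (\<eta> + 1) \<times> cofactors s \<eta> :: ('a poly \<times> (nat \<Rightarrow> 'a poly)) set))"
        using card_mono[OF fin\<eta> D\<eta>_sub] by simp
      also have "\<dots> \<le> q ^ (\<eta> + 1) * q ^ ?S"
        unfolding card_cartesian_product of_nat_mult by (intro mult_mono polys_le cofactors_card) auto
      also have "\<dots> = q ^ (\<eta> + 1 + ?S)" by (simp only: power_add)
      finally have "real (card (D\<eta> \<eta>)) * g \<eta> \<le> q ^ (\<eta> + 1 + ?S) * g \<eta>"
        by (intro mult_right_mono) (auto simp: g_def)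
      also have "\<dots> = q ^ (\<eta> + 1 + ?S) / q ^ (\<Sum>i=1..m. slab s i + \<eta>)" by (simp add: g_def)
      also have "\<dots> \<le> q ^ (1 + n + m * E) / q ^ \<eta>"
      proof (rule power_quotient_le)
        have "\<eta> + ?S \<le> n + s * wt" using sum_truncated_degrees[of j0 n \<eta> s b, OF j0] by (simp only: weights_eq)
        moreover have "s * wt \<le> (\<Sum>i=1..m. slab s i) + m * E" by (rule slab_sum)
        moreover have "(\<Sum>i=1..m. slab s i + \<eta>) = (\<Sum>i=1..m. slab s i) + m * \<eta>" by (simp add: sum.distrib)
        moreover have "\<eta> \<le> m * \<eta>" using m by simp
        ultimately show "\<eta> + 1 + ?S + \<eta> \<le> 1 + n + m * E + (\<Sum>i=1..m. slab s i + \<eta>)" by linarith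
      qed simp
      finally show ?thesis by simp
    qed simp
  qed
  also have "\<dots> = q ^ (1 + n + m * E) * (\<Sum>\<eta>\<in>{L<..H}. 1 / q ^ \<eta>)" by (simp only: sum_distrib_left)
  also have "\<dots> \<le> q ^ (1 + n + m * E) * (1 / q ^ L)"
    by (intro mult_left_mono geometric_tail_le q_ge_2) simp
  finally show ?thesis by simp
qed

text \<open>
  Look at the coordinate \<open>j\<close> in which \<open>h u\<close> attains the degree \<open>s' b\<^sub>j\<close>, while \<open>f u\<close> is bounded by
  \<open>s b\<^sub>j\<close>.\<close>

lemma degree_coprime_factor:
  assumes V: "scale f u \<in> V s" "scale h u \<in> V s'" and u: "u \<in> vecs" and s: "s \<le> s'"
  shows "degree f + (s' - s) \<le> degree h"
proof -
  obtain j where j: "j \<in> {1..n}" "u j \<noteq> 0" "degree h + degree (u j) = s' * b j"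
    using scale_in_V(4)[OF V(2) u] by blast
  have f: "f \<noteq> 0" by (rule scale_in_V(1)[OF V(1) u])
  have "degree f + degree (u j) \<le> s * b j"
    using V_le[OF V(1) j(1)] j f by (auto simp: degree_mult_eq)
  moreover have "s' * b j = s * b j + (s' - s) * b j" using s by (simp add: algebra_simps)
  moreover have "s' - s \<le> (s' - s) * b j" using b_pos[OF j(1)] by simp
  ultimately show ?thesis using j(3) by linarith
qed

lemma slab_mono: "s \<le> s' \<Longrightarrow> slab s i \<le> slab s' i"
  by (simp add: slab_def diff_le_mono)

text \<open>
  The rows are of two kinds. If \<open>degree h \<le> slab s i\<close>, then simultaneous hits force \<open>u\<close> itself to be close
  to a polynomial in row \<open>i\<close> (\<open>common_approximation\<close>), which prescribes \<open>slab s' i + degree h\<close> digits.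
  Otherwise the digits of \<open>f u\<close> and \<open>h u\<close> up to the slabs are independent (\<open>row_indep_coprime\<close>), which
  prescribes \<open>slab s' i + slab s i\<close> digits. If all rows are of the first kind, then \<open>h u\<close> is a hit that
  comes from the factor \<open>h\<close>, and the truncation excludes it for degrees above \<open>L\<close>.\<close>

lemma dependent_pair:
  assumes co: "\<alpha> * f + \<beta> * h = 1" and V: "scale f u \<in> V s" "scale h u \<in> V s'" and u: "u \<in> vecs" and s: "s \<le> s'"
  shows "measure P (thits L s (scale f u) \<inter> thits L s' (scale h u))
    \<le> of_bool (degree h \<le> L \<or> (\<exists>i\<in>{1..m}. slab s i < degree h))
        / q ^ (\<Sum>i=1..m. slab s' i + min (slab s i) (degree h))"
proof -
  let ?T = "thits L s (scale f u) \<inter> thits L s' (scale h u)"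
  define F where "F = (\<lambda>i::nat. scale f u)"
  define W where "W = (\<lambda>i. if degree h \<le> slab s i then u else scale h u)"
  define l where "l = (\<lambda>i. if degree h \<le> slab s i then 0 else slab s i)"
  define l' where "l' = (\<lambda>i. if degree h \<le> slab s i then slab s' i + degree h else slab s' i)"
  have h: "h \<noteq> 0" by (rule scale_in_V(1)[OF V(2) u])
  obtain j0 where j0: "j0 \<in> {1..n}" "u j0 \<noteq> 0" using scale_in_V(3)[OF V(2) u] by blast
  have df: "degree f \<le> degree h" using degree_coprime_factor[OF V u s] by simp
  have near: "rowdot n A u i $$ int k = 0"
    if A: "A \<in> ?T" and i: "i \<in> {1..m}" "degree h \<le> slab s i" and k: "k \<in> {1..slab s' i + degree h}" for A i k
  proof (rule common_approximation[OF co h i(2) _ _ _ k])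
    show "degree f \<le> slab s' i" using df i(2) slab_mono[OF s, of i] by linarith
    have z: "zeros (slab s) (\<lambda>_. scale f u) A" "zeros (slab s') (\<lambda>_. scale h u) A"
      using A hit_zeros by (auto simp: thits_def hits_def)
    have e: "rowdot n A (scale p u) i = emb p * rowdot n A u i" for p
      unfolding rowdot_def dotp_mult[symmetric] by (rule dotp_cong) simp
    show "(emb f * rowdot n A u i) $$ int k = 0" if "k \<in> {1..slab s i}" for k
      using z(1) i(1) that unfolding zeros_def e[symmetric] by blast
    show "(emb h * rowdot n A u i) $$ int k = 0" if "k \<in> {1..slab s' i}" for k
      using z(2) i(1) that unfolding zeros_def e[symmetric] by blast
  qed
  have sub: "?T \<subseteq> {A \<in> U. zeros l F A \<and> zeros l' W A}"
  proof
    fix A assume A: "A \<in> ?T"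
    then have z: "A \<in> U" "zeros (slab s) (\<lambda>_. scale f u) A" "zeros (slab s') (\<lambda>_. scale h u) A"
      using hit_zeros by (auto simp: thits_def hits_def)
    have "zeros l F A" using z(2) by (auto simp: zeros_def l_def F_def)
    moreover have "zeros l' W A" using z(3) near[OF A] by (auto simp: zeros_def l'_def W_def)
    ultimately show "A \<in> {A \<in> U. zeros l F A \<and> zeros l' W A}" using z by blast
  qed
  show ?thesis
  proof (cases "degree h \<le> L \<or> (\<exists>i\<in>{1..m}. slab s i < degree h)")
    case True
    have "measure P ?T \<le> measure P {A \<in> U. zeros l F A \<and> zeros l' W A}"
    proof (rule P.finite_measure_mono[OF sub])
      have "{A \<in> U. zeros l F A \<and> zeros l' W A} = {A \<in> U. zeros l F A} \<inter> {A \<in> U. zeros l' W A}" by blast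
      then show "{A \<in> U. zeros l F A \<and> zeros l' W A} \<in> sets P" using zeros_P by (simp only: sets.Int)
    qed
    also have "\<dots> = 1 / q ^ ((\<Sum>i=1..m. l i) + (\<Sum>i=1..m. l' i))"
    proof -
      have "row_indep n (F i) (W i) (l i) (l' i)" for i
      proof (cases "degree h \<le> slab s i")
        case True
        then show ?thesis
          using row_indep_sym[OF row_indep_single[of j0 n u "F i" "l' i"]] j0 by (simp add: W_def l_def)
      next
        case False
        then show ?thesis
          unfolding F_def W_def l_def l'_def
          using row_indep_coprime[where u = u, OF j0 co h, where l = "slab s i" and v = "scale f u" and w = "scale h u"]
          by simp
      qed
      then have "measure mats {A \<in> U. zeros l F A \<and> zeros l' W A} = 1 / q ^ ((\<Sum>i=1..m. l i) + (\<Sum>i=1..m. l' i))"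
        by (rule measure_zeros_two)
      moreover have "{A \<in> U. zeros l F A \<and> zeros l' W A} \<subseteq> U" by blast
      ultimately show ?thesis by (simp only: measure_P)
    qed
    also have "(\<Sum>i=1..m. l i) + (\<Sum>i=1..m. l' i) = (\<Sum>i=1..m. slab s' i + min (slab s i) (degree h))"
      unfolding sum.distrib[symmetric] by (rule sum.cong) (auto simp: l_def l'_def)
    finally show ?thesis by (simp only: True of_bool_eq)
  next
    case False
    have "?T = {}"
    proof (rule ccontr)
      assume "?T \<noteq> {}"
      then obtain A where A: "A \<in> ?T" by blast
      have "zeros (\<lambda>i. slab s' i + degree h) (\<lambda>_. u) A"
        using near[OF A] False by (auto simp: zeros_def not_less)
      then have "divisible L s' (scale h u) A"
        unfolding divisible_def using False u by (intro exI[of _ h] exI[of _ u]) auto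
      then show False using A by (simp add: thits_def)
    qed
    then have "measure P ?T = 0" by (simp only: measure_empty)
    then show ?thesis by (simp only: False of_bool_eq)
  qed
qed

definition bad :: "nat \<Rightarrow> nat \<Rightarrow> ((nat \<Rightarrow> 'a poly) \<times> (nat \<Rightarrow> 'a poly)) set" where
  "bad s s' = {(v, w) \<in> V s \<times> V s'. \<exists>f h u \<alpha> \<beta>. \<alpha> * f + \<beta> * h = 1 \<and> u \<in> vecs
     \<and> v = scale f u \<and> w = scale h u \<and> (\<exists>i\<in>{1..m}. degree h < lev s i)}"

text \<open>
  If some minor of \<open>v\<close> and \<open>w\<close> is nonzero, the two forms are independent in every row. Otherwise
  \<open>v = f u\<close> and \<open>w = h u\<close> with coprime \<open>f\<close>, \<open>h\<close>, and the degree of \<open>h\<close> is so large that \<open>row_indep_coprime\<close>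
  applies to all relevant digits.\<close>

lemma good_pair:
  assumes v: "v \<in> V s" and w: "w \<in> V s'" and good: "(v, w) \<notin> bad s s'"
  shows "measure P (hits s v \<inter> hits s' w) = \<mu> s * \<mu> s'"
proof -
  have "row_indep n v w (lev s i) (lev s' i)" if i: "i \<in> {1..m}" for i
  proof (cases "\<forall>j1\<in>{1..n}. \<forall>j2\<in>{1..n}. v j1 * w j2 = v j2 * w j1")
    case False
    then show ?thesis using row_indep_minor by blast
  next
    case True
    obtain j0 where "j0 \<in> {1..n}" "v j0 \<noteq> 0" using V_nonzero[OF v] by blast
    then obtain f h u \<alpha> \<beta> where *: "\<alpha> * f + \<beta> * h = 1" "\<forall>j\<in>{1..n}. v j = f * u j \<and> w j = h * u j"
      using proportional_vectors[of "{1..n}" v w j0] True by blast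
    define u' where "u' = (\<lambda>j\<in>{1..n}. u j)"
    have vw: "v = scale f u'" "w = scale h u'"
      using * V_ext[OF v] V_ext[OF w] by (auto simp: u'_def PiE_iff extensional_def fun_eq_iff)
    have u': "u' \<in> vecs" by (simp add: u'_def)
    then have "\<not> degree h < lev s i" using good v w i vw *(1) unfolding bad_def by blast
    moreover have "h \<noteq> 0" "\<exists>j\<in>{1..n}. u' j \<noteq> 0" using scale_in_V[of h u' s'] u' w vw by auto
    ultimately show ?thesis
      using row_indep_coprime[OF _ _ *(1), of _ n u' "lev s i" v w] vw by auto
  qed
  then have "measure mats (hits s v \<inter> hits s' w) = \<mu> s * \<mu> s'" by (rule measure_hits_indep)
  moreover have "hits s v \<inter> hits s' w \<subseteq> U" by (auto simp: hits_def)
  ultimately show ?thesis by (simp only: measure_P)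
qed

end

section \<open>The law of large numbers for hits\<close>

lemma sum_power_distance_le:
  fixes q :: real assumes "2 \<le> q"
  shows "(\<Sum>s'\<in>{..<N}. 1 / q ^ ((s' - s) + (s - s'))) \<le> 4"
proof -
  have geo: "(\<Sum>d\<in>D. 1 / q ^ d) \<le> 2" if "finite D" for D
  proof -
    have "(\<Sum>d\<in>D. 1 / q ^ d) \<le> (\<Sum>d\<in>insert 0 {0<..Max (insert 0 D)}. 1 / q ^ d)"
      using assms that by (intro sum_mono2) auto
    also have "\<dots> = 1 + (\<Sum>d\<in>{0<..Max (insert 0 D)}. 1 / q ^ d)" by simp
    also have "\<dots> \<le> 1 + 1 / q ^ 0" by (intro add_left_mono geometric_tail_le assms)
    finally show ?thesis by simp
  qed
  have "(\<Sum>s'\<in>{..<N}. 1 / q ^ ((s' - s) + (s - s')))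
      = (\<Sum>s'\<in>{..<N} \<inter> {..<s}. 1 / q ^ ((s' - s) + (s - s'))) + (\<Sum>s'\<in>{..<N} - {..<s}. 1 / q ^ ((s' - s) + (s - s')))"
    by (rule sum.Int_Diff) simp
  also have "(\<Sum>s'\<in>{..<N} \<inter> {..<s}. 1 / q ^ ((s' - s) + (s - s'))) = (\<Sum>d\<in>(\<lambda>s'. s - s') ` ({..<N} \<inter> {..<s}). 1 / q ^ d)"
    by (subst sum.reindex) (auto simp: inj_on_def intro!: sum.cong)
  also have "(\<Sum>s'\<in>{..<N} - {..<s}. 1 / q ^ ((s' - s) + (s - s'))) = (\<Sum>d\<in>(\<lambda>s'. s' - s) ` ({..<N} - {..<s}). 1 / q ^ d)"
    by (subst sum.reindex) (auto simp: inj_on_def intro!: sum.cong)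
  also have "(\<Sum>d\<in>(\<lambda>s'. s - s') ` ({..<N} \<inter> {..<s}). 1 / q ^ d) + (\<Sum>d\<in>(\<lambda>s'. s' - s) ` ({..<N} - {..<s}). 1 / q ^ d) \<le> 2 + 2"
    by (intro add_mono geo) auto
  finally show ?thesis by simp
qed

context shells
begin

text \<open>
  Both are bounds independent of the shells and of \<open>L\<close>; \<open>overlap_bound\<close> covers the degrees of \<open>h\<close> for
  which some row is of the second kind described at \<open>dependent_pair\<close>.\<close>

definition pair_bound :: real where "pair_bound = q ^ (2 + n + m * E)"
definition overlap_bound :: real where "overlap_bound = real wt * q ^ E + real (e + E) * q ^ (e + E)"

lemma pair_bound_nonneg: "0 \<le> pair_bound" and overlap_bound_nonneg: "0 \<le> overlap_bound"
proof -
  show "0 \<le> pair_bound" by (simp add: pair_bound_def)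
  have "0 \<le> real wt * q ^ E" "0 \<le> real (e + E) * q ^ (e + E)" by (intro mult_nonneg_nonneg of_nat_0_le_iff; simp)+
  then show "0 \<le> overlap_bound" unfolding overlap_bound_def by (rule add_nonneg_nonneg)
qed

text \<open>
  This is the sum over \<open>\<eta> = degree h\<close> that remains after the number of triples has been multiplied by the
  probability. If \<open>\<eta>\<close> is at most every slab, a term is at most 1, and the truncation leaves \<open>L + 1\<close> of
  them. If \<open>\<eta>\<close> lies between the smallest and the largest slab, two different rows contribute and the term
  is of order \<open>q^(-s)\<close>, which outweighs the number of such terms. The number of \<open>\<eta>\<close> beyond the
  largest slab is bounded.\<close>

lemma overlap_sum:
  assumes s: "E < s"
  shows "(\<Sum>\<eta> | \<exists>i\<in>{1..m}. \<eta> < lev s i. of_bool (\<eta> \<le> L \<or> (\<exists>i\<in>{1..m}. slab s i < \<eta>))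
      * (q ^ \<eta> / q ^ (\<Sum>i=1..m. min (slab s i) \<eta>))) \<le> real L + 1 + overlap_bound"
    (is "(\<Sum>\<eta> | ?Y \<eta>. of_bool (?B \<eta>) * ?t \<eta>) \<le> _")
proof -
  have "finite (slab s ` {1..m})" "slab s ` {1..m} \<noteq> {}" using m by auto
  from Max_in[OF this] obtain i0 where i0: "i0 \<in> {1..m}" "Max (slab s ` {1..m}) = slab s i0" by auto
  define z where "z = slab s i0"
  have z_max: "slab s i \<le> z" if "i \<in> {1..m}" for i
    using that unfolding z_def i0(2)[symmetric] by (intro Max_ge) auto
  have slabE: "s * a i \<le> slab s i + E" for i by (simp add: slab_def)
  have Y: "\<eta> < z + e + E" if "?Y \<eta>" for \<eta>
  proof -
    obtain i where "i \<in> {1..m}" "\<eta> < e + s * a i" using \<open>?Y \<eta>\<close> by (auto simp: lev_def)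
    then show ?thesis using slabE[of i] z_max[of i] by linarith
  qed
  define r where "r = (\<lambda>\<eta>. of_bool (\<eta> \<le> L) + of_bool (1 \<le> \<eta> \<and> \<eta> \<le> z) * (q ^ E / q ^ s) + of_bool (z < \<eta>) * q ^ (e + E))"
  have r0: "0 \<le> r \<eta>" for \<eta> by (simp add: r_def)
  have pointwise: "of_bool (?B \<eta>) * ?t \<eta> \<le> r \<eta>" if \<eta>: "?Y \<eta>" for \<eta>
  proof -
    have min0: "min z \<eta> \<le> (\<Sum>i=1..m. min (slab s i) \<eta>)"
      unfolding z_def by (rule member_le_sum[OF i0(1)]) auto
    consider "\<not> ?B \<eta>" | i1 where "i1 \<in> {1..m}" "slab s i1 < \<eta>" "\<eta> \<le> z"
      | "z < \<eta>" | "\<eta> \<le> L" "\<forall>i\<in>{1..m}. \<eta> \<le> slab s i"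
      by (metis not_less)
    then show ?thesis
    proof cases
      case 1
      then show ?thesis using r0[of \<eta>] by simp
    next
      case (2 i1)
      have ne: "i1 \<noteq> i0" using 2 by (auto simp: z_def)
      have "(\<Sum>i\<in>{i0, i1}. min (slab s i) \<eta>) \<le> (\<Sum>i=1..m. min (slab s i) \<eta>)"
        using 2 i0 by (intro sum_mono2) auto
      then have "\<eta> + slab s i1 \<le> (\<Sum>i=1..m. min (slab s i) \<eta>)" using 2 ne by (simp add: z_def)
      moreover have "s \<le> s * a i1" using a_pos[OF 2(1)] by simp
      ultimately have "\<eta> + s \<le> E + (\<Sum>i=1..m. min (slab s i) \<eta>)" using slabE[of i1] by linarith
      then have "?t \<eta> \<le> q ^ E / q ^ s" by (intro power_quotient_le) simp
      moreover have "of_bool (?B \<eta>) * ?t \<eta> \<le> ?t \<eta>" by simp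
      moreover have "q ^ E / q ^ s \<le> r \<eta>" using 2 by (simp add: r_def)
      ultimately show ?thesis by linarith
    next
      case 3
      then have "\<eta> + 0 \<le> e + E + (\<Sum>i=1..m. min (slab s i) \<eta>)" using min0 Y[OF \<eta>] by linarith
      then have "?t \<eta> \<le> q ^ (e + E) / q ^ 0" by (intro power_quotient_le) simp
      moreover have "of_bool (?B \<eta>) * ?t \<eta> \<le> ?t \<eta>" by simp
      moreover have "q ^ (e + E) / q ^ 0 \<le> r \<eta>" using 3 by (simp add: r_def)
      ultimately show ?thesis by linarith
    next
      case 4
      then have "\<eta> + 0 \<le> 0 + (\<Sum>i=1..m. min (slab s i) \<eta>)" using min0 i0(1) by (simp add: z_def)
      then have "?t \<eta> \<le> q ^ 0 / q ^ 0" by (intro power_quotient_le) simp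
      moreover have "of_bool (?B \<eta>) * ?t \<eta> \<le> ?t \<eta>" by simp
      moreover have "q ^ 0 / q ^ 0 \<le> r \<eta>" using 4 by (simp add: r_def)
      ultimately show ?thesis by linarith
    qed
  qed
  have "(\<Sum>\<eta> | ?Y \<eta>. of_bool (?B \<eta>) * ?t \<eta>) \<le> (\<Sum>\<eta> | ?Y \<eta>. r \<eta>)"
    using pointwise by (intro sum_mono) simp
  also have "\<dots> \<le> (\<Sum>\<eta>\<in>{..<z + e + E}. r \<eta>)"
    using Y r0 by (intro sum_mono2) auto
  also have "\<dots> = (\<Sum>\<eta>\<in>{..<z + e + E}. of_bool (\<eta> \<le> L)) + (\<Sum>\<eta>\<in>{..<z + e + E}. of_bool (1 \<le> \<eta> \<and> \<eta> \<le> z)) * (q ^ E / q ^ s)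
      + (\<Sum>\<eta>\<in>{..<z + e + E}. of_bool (z < \<eta>)) * q ^ (e + E)"
    by (simp only: r_def sum.distrib sum_distrib_right)
  also have "\<dots> \<le> (real L + 1) + real z * (q ^ E / q ^ s) + real (e + E) * q ^ (e + E)"
  proof (intro add_mono mult_right_mono)
    have card_le: "(\<Sum>\<eta>\<in>{..<z + e + E}. of_bool (R \<eta>)) \<le> real (card X)"
      if "finite X" "\<And>\<eta>. \<eta> < z + e + E \<Longrightarrow> R \<eta> \<Longrightarrow> \<eta> \<in> X" for R :: "nat \<Rightarrow> bool" and X :: "nat set"
    proof -
      have "(\<Sum>\<eta>\<in>{..<z + e + E}. of_bool (R \<eta>)) = real (card ({..<z + e + E} \<inter> {\<eta>. R \<eta>}))"
        by (simp only: sum_of_bool_eq finite_lessThan)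
      also have "\<dots> \<le> real (card X)" using that by (intro of_nat_mono card_mono) auto
      finally show ?thesis .
    qed
    show "(\<Sum>\<eta>\<in>{..<z + e + E}. of_bool (\<eta> \<le> L)) \<le> real L + 1"
      using card_le[of "{..L}" "\<lambda>\<eta>. \<eta> \<le> L"] by (simp add: add.commute)
    show "(\<Sum>\<eta>\<in>{..<z + e + E}. of_bool (1 \<le> \<eta> \<and> \<eta> \<le> z)) \<le> real z"
      using card_le[of "{1..z}" "\<lambda>\<eta>. 1 \<le> \<eta> \<and> \<eta> \<le> z"] by simp
    have "(\<Sum>\<eta>\<in>{..<z + e + E}. of_bool (z < \<eta>)) \<le> real (card {z..<z + e + E})"
      by (rule card_le) auto
    then show "(\<Sum>\<eta>\<in>{..<z + e + E}. of_bool (z < \<eta>)) \<le> real (e + E)" by simp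
  qed auto
  also have "real z * (q ^ E / q ^ s) \<le> real wt * q ^ E"
  proof -
    have "a i0 \<le> wt" using i0(1) by (intro member_le_sum) auto
    then have "z \<le> s * wt" unfolding z_def slab_def by (meson diff_le_self le_trans mult_le_mono2)
    then have "real z \<le> real s * real wt" by (metis of_nat_le_iff of_nat_mult)
    also have "\<dots> \<le> q ^ s * real wt"
    proof (rule mult_right_mono)
      have "real s \<le> 2 ^ s" by (rule of_nat_less_two_power[THEN less_imp_le])
      also have "\<dots> \<le> q ^ s" using q_ge_2 by (intro power_mono) auto
      finally show "real s \<le> q ^ s" .
    qed (rule of_nat_0_le_iff)
    finally have "real z * (q ^ E / q ^ s) \<le> (q ^ s * real wt) * (q ^ E / q ^ s)"
      by (intro mult_right_mono) auto
    then show ?thesis by simp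
  qed
  finally show ?thesis by (simp add: overlap_bound_def)
qed

text \<open>
  The bad pairs are images of triples \<open>(f, h, u)\<close>. The number of triples with \<open>degree h = \<eta>\<close> is bounded by
  the number of polynomials of the possible degrees and multiplied by the probability from
  \<open>dependent_pair\<close>; the factor \<open>q^(-(s' - s))\<close> comes from the bound on the degree of \<open>f\<close>.\<close>

lemma bad_sum:
  assumes s: "E < s" "s \<le> s'"
  shows "(\<Sum>(v, w)\<in>bad s s'. measure P (thits L s v \<inter> thits L s' w)) \<le> pair_bound * (real L + 1 + overlap_bound) / q ^ (s' - s)"
proof -
  define Tri where "Tri = {(f, h, u). (\<exists>\<alpha> \<beta>. \<alpha> * f + \<beta> * h = 1) \<and> u \<in> vecs \<and> scale f u \<in> V s \<and> scale h u \<in> V s'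
    \<and> (\<exists>i\<in>{1..m}. degree h < lev s i)}"
  define Y where "Y = {\<eta>. \<exists>i\<in>{1..m}. \<eta> < lev s i}"
  define T where "T = (\<lambda>\<eta>. {t \<in> Tri. degree (fst (snd t)) = \<eta>})"
  define pr where "pr = (\<lambda>t. (scale (fst t) (snd (snd t)), scale (fst (snd t)) (snd (snd t))))"
  define X where "X = (\<lambda>p. measure P (thits L s (fst p) \<inter> thits L s' (snd p)))"
  define B :: "nat \<Rightarrow> real" where "B = (\<lambda>\<eta>. of_bool (\<eta> \<le> L \<or> (\<exists>i\<in>{1..m}. slab s i < \<eta>)))"
  define g where "g = (\<lambda>\<eta>. B \<eta> / q ^ (\<Sum>i=1..m. slab s' i + min (slab s i) \<eta>))"
  have B: "0 \<le> B \<eta>" for \<eta> by (simp add: B_def)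
  have finY: "finite Y"
  proof -
    have "Y = (\<Union>i\<in>{1..m}. {..<lev s i})" by (auto simp: Y_def)
    then show ?thesis by simp
  qed
  have T_sub: "T \<eta> \<subseteq> polys (\<eta> + 1 - (s' - s)) \<times> polys (\<eta> + 1) \<times> cofactors s' \<eta>" for \<eta>
  proof
    fix t assume "t \<in> T \<eta>"
    then obtain f h u where t: "t = (f, h, u)" "(f, h, u) \<in> Tri" "degree h = \<eta>"
      unfolding T_def by (cases t) auto
    then have V: "scale f u \<in> V s" "scale h u \<in> V s'" and u: "u \<in> vecs" by (auto simp: Tri_def)
    have "f \<in> polys (\<eta> + 1 - (s' - s))"
      using degree_coprime_factor[OF V u s(2)] t(3) by (intro in_polys) auto
    moreover have "h \<in> polys (\<eta> + 1)" using degree_in_polys[of h] t(3) by simp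
    moreover have "u \<in> cofactors s' \<eta>" using scale_in_V(2)[OF V(2) u] t(3) by simp
    ultimately show "t \<in> polys (\<eta> + 1 - (s' - s)) \<times> polys (\<eta> + 1) \<times> cofactors s' \<eta>" by (simp add: t(1))
  qed
  have finP: "finite (polys (\<eta> + 1 - (s' - s)) \<times> polys (\<eta> + 1) \<times> cofactors s' \<eta> :: ('a poly \<times> 'a poly \<times> (nat \<Rightarrow> 'a poly)) set)" for \<eta>
    by (intro finite_cartesian_product polys_card cofactors_card)
  have inY: "degree (fst (snd t)) \<in> Y" if "t \<in> Tri" for t
    using that unfolding Tri_def Y_def by auto
  then have Tri_UN: "Tri = (\<Union>\<eta>\<in>Y. T \<eta>)" by (auto simp: T_def)
  have finTri: "finite Tri"
    unfolding Tri_UN using finY T_sub finP by (intro finite_UN_I) (auto intro: finite_subset)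
  have bad_sub: "bad s s' \<subseteq> pr ` Tri"
  proof
    fix p assume "p \<in> bad s s'"
    then obtain v w f h u \<alpha> \<beta> where *: "p = (v, w)" "v \<in> V s" "w \<in> V s'" "\<alpha> * f + \<beta> * h = 1" "u \<in> vecs"
      "v = scale f u" "w = scale h u" "\<exists>i\<in>{1..m}. degree h < lev s i" unfolding bad_def by blast
    have "(f, h, u) \<in> Tri" using * unfolding Tri_def by blast
    moreover have "p = pr (f, h, u)" by (simp only: pr_def * fst_conv snd_conv)
    ultimately show "p \<in> pr ` Tri" by blast
  qed
  have "(\<Sum>(v, w)\<in>bad s s'. measure P (thits L s v \<inter> thits L s' w)) = (\<Sum>p\<in>bad s s'. X p)"
    by (simp only: X_def case_prod_unfold)
  also have "\<dots> \<le> (\<Sum>p\<in>pr ` Tri. X p)"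
    using finTri bad_sub by (intro sum_mono2) (auto simp: X_def)
  also have "\<dots> \<le> (\<Sum>t\<in>Tri. X (pr t))"
    using sum_image_le[OF finTri, of X pr] by (auto simp: X_def o_def)
  also have "\<dots> \<le> (\<Sum>t\<in>Tri. g (degree (fst (snd t))))"
  proof (rule sum_mono)
    fix t assume "t \<in> Tri"
    then obtain f h u \<alpha> \<beta> where t: "t = (f, h, u)" "\<alpha> * f + \<beta> * h = 1" "scale f u \<in> V s" "scale h u \<in> V s'" "u \<in> vecs"
      unfolding Tri_def by blast
    show "X (pr t) \<le> g (degree (fst (snd t)))"
      using dependent_pair[OF t(2-5) s(2), of L] by (simp only: X_def pr_def g_def B_def t(1) fst_conv snd_conv)
  qed
  also have "\<dots> = (\<Sum>\<eta>\<in>Y. \<Sum>t\<in>{t \<in> Tri. degree (fst (snd t)) = \<eta>}. g (degree (fst (snd t))))"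
    by (rule sum.group[symmetric, OF finTri finY]) (use inY in blast)
  also have "\<dots> = (\<Sum>\<eta>\<in>Y. real (card (T \<eta>)) * g \<eta>)"
    by (intro sum.cong refl) (simp add: T_def)
  also have "\<dots> \<le> (\<Sum>\<eta>\<in>Y. (pair_bound / q ^ (s' - s)) * (B \<eta> * (q ^ \<eta> / q ^ (\<Sum>i=1..m. min (slab s i) \<eta>))))"
  proof (rule sum_mono)
    fix \<eta> assume "\<eta> \<in> Y"
    let ?M = "\<Sum>i=1..m. min (slab s i) \<eta>" and ?S = "\<Sum>j=1..n. s' * b j + 1 - \<eta>"
    show "real (card (T \<eta>)) * g \<eta> \<le> (pair_bound / q ^ (s' - s)) * (B \<eta> * (q ^ \<eta> / q ^ ?M))"
    proof (cases "T \<eta> = {}")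
      case True
      then show ?thesis using B pair_bound_nonneg by (simp del: of_bool_eq_iff)
    next
      case False
      then obtain t where "t \<in> T \<eta>" by blast
      then obtain f h u where t: "t = (f, h, u)" "(f, h, u) \<in> Tri" "degree h = \<eta>"
        unfolding T_def by (cases t) auto
      then have V: "scale f u \<in> V s" "scale h u \<in> V s'" and u: "u \<in> vecs" by (auto simp: Tri_def)
      have ss: "s' - s \<le> \<eta>" using degree_coprime_factor[OF V u s(2)] t(3) by simp
      obtain j0 where j0: "j0 \<in> {1..n}" "\<eta> \<le> s' * b j0"
        using scale_in_V(4)[OF V(2) u] t(3) by (metis le_add1)
      have "real (card (T \<eta>)) \<le> real (card (polys (\<eta> + 1 - (s' - s)) \<times> polys (\<eta> + 1) \<times> cofactors s' \<eta> :: ('a poly \<times> 'a poly \<times> (nat \<Rightarrow> 'a poly)) set))"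
        using card_mono[OF finP T_sub] by simp
      also have "\<dots> \<le> q ^ (\<eta> + 1 - (s' - s)) * (q ^ (\<eta> + 1) * q ^ ?S)"
        unfolding card_cartesian_product of_nat_mult by (intro mult_mono polys_le cofactors_card) auto
      also have "\<dots> = q ^ ((\<eta> + 1 - (s' - s)) + ((\<eta> + 1) + ?S))" by (simp only: power_add)
      finally have "real (card (T \<eta>)) * g \<eta> \<le> q ^ ((\<eta> + 1 - (s' - s)) + ((\<eta> + 1) + ?S)) * g \<eta>"
        using B by (intro mult_right_mono) (auto simp: g_def)
      also have "\<dots> = B \<eta> * (q ^ ((\<eta> + 1 - (s' - s)) + ((\<eta> + 1) + ?S)) / q ^ (\<Sum>i=1..m. slab s' i + min (slab s i) \<eta>))"
        by (simp add: g_def)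
      also have "\<dots> \<le> B \<eta> * (q ^ (2 + n + m * E + \<eta>) / q ^ ((s' - s) + ?M))"
      proof (intro mult_left_mono power_quotient_le B)
        have "\<eta> + ?S \<le> n + s' * wt"
          using sum_truncated_degrees[of j0 n \<eta> s' b, OF j0] by (simp only: weights_eq)
        moreover have "s' * wt \<le> (\<Sum>i=1..m. slab s' i) + m * E" by (rule slab_sum)
        moreover have "(\<Sum>i=1..m. slab s' i + min (slab s i) \<eta>) = (\<Sum>i=1..m. slab s' i) + ?M" by (simp only: sum.distrib)
        ultimately show "(\<eta> + 1 - (s' - s)) + ((\<eta> + 1) + ?S) + ((s' - s) + ?M)
            \<le> 2 + n + m * E + \<eta> + (\<Sum>i=1..m. slab s' i + min (slab s i) \<eta>)"
          using ss by linarith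
      qed simp
      also have "\<dots> = (pair_bound / q ^ (s' - s)) * (B \<eta> * (q ^ \<eta> / q ^ ?M))"
        by (simp add: pair_bound_def power_add field_simps)
      finally show ?thesis .
    qed
  qed
  also have "\<dots> = (pair_bound / q ^ (s' - s)) * (\<Sum>\<eta>\<in>Y. B \<eta> * (q ^ \<eta> / q ^ (\<Sum>i=1..m. min (slab s i) \<eta>)))"
    by (simp only: sum_distrib_left)
  also have "\<dots> \<le> (pair_bound / q ^ (s' - s)) * (real L + 1 + overlap_bound)"
    unfolding Y_def B_def using overlap_sum[OF s(1)] pair_bound_nonneg by (intro mult_left_mono) auto
  finally show ?thesis by simp
qed

end

context shells
begin

lemma correlation_sum_ordered:
  assumes s: "E < s" "s \<le> s'"
  shows "(\<Sum>v\<in>V s. \<Sum>w\<in>V s'. measure P (thits L s v \<inter> thits L s' w) - measure P (hits s v) * measure P (hits s' w))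
    \<le> pair_bound * (real L + 1 + overlap_bound) / q ^ (s' - s)"
proof -
  define X where "X = (\<lambda>(v, w). measure P (thits L s v \<inter> thits L s' w))"
  define Z where "Z = (\<lambda>(v, w). measure P (hits s v) * measure P (hits s' w))"
  have fin: "finite (V s \<times> V s')" by (intro finite_cartesian_product V_finite)
  have sub: "bad s s' \<subseteq> V s \<times> V s'" by (auto simp: bad_def)
  have le: "X p - Z p \<le> (if p \<in> bad s s' then X p else 0)" if p: "p \<in> V s \<times> V s'" for p
  proof -
    obtain v w where vw: "p = (v, w)" "v \<in> V s" "w \<in> V s'" using p by blast
    have Z0: "0 \<le> Z p" by (simp add: Z_def vw)
    have "X p \<le> Z p" if "p \<notin> bad s s'"
    proof -
      have "X p \<le> measure P (hits s v \<inter> hits s' w)"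
        unfolding X_def vw(1) prod.case
        using thits_sub hits_P by (intro P.finite_measure_mono sets.Int) blast+
      also have "\<dots> = \<mu> s * \<mu> s'" using good_pair[OF vw(2,3)] that vw(1) by simp
      also have "\<dots> = Z p"
      proof -
        have "hits s v \<subseteq> U" "hits s' w \<subseteq> U" by (auto simp: hits_def)
        then show ?thesis
          unfolding Z_def vw(1) prod.case using measure_hits[OF vw(2)] measure_hits[OF vw(3)] by (simp only: measure_P)
      qed
      finally show ?thesis .
    qed
    then show ?thesis using Z0 by auto
  qed
  have "(\<Sum>v\<in>V s. \<Sum>w\<in>V s'. measure P (thits L s v \<inter> thits L s' w) - measure P (hits s v) * measure P (hits s' w))
      = (\<Sum>p\<in>V s \<times> V s'. X p - Z p)"
    unfolding X_def Z_def by (simp only: sum.cartesian_product case_prod_unfold)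
  also have "\<dots> \<le> (\<Sum>p\<in>V s \<times> V s'. if p \<in> bad s s' then X p else 0)"
    by (intro sum_mono le)
  also have "\<dots> = (\<Sum>p\<in>bad s s'. X p)"
  proof -
    have "(\<Sum>p\<in>V s \<times> V s'. if p \<in> bad s s' then X p else 0) = (\<Sum>p\<in>(V s \<times> V s') \<inter> bad s s'. X p)"
      by (rule sum.inter_restrict[OF fin, symmetric])
    then show ?thesis using sub by (simp only: Int_absorb1)
  qed
  also have "\<dots> \<le> pair_bound * (real L + 1 + overlap_bound) / q ^ (s' - s)"
    using bad_sum[OF s] by (simp only: X_def)
  finally show ?thesis .
qed

lemma correlation_sum:
  assumes s: "E < s" "E < s'"
  shows "(\<Sum>v\<in>V s. \<Sum>w\<in>V s'. measure P (thits L s v \<inter> thits L s' w) - measure P (hits s v) * measure P (hits s' w))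
    \<le> pair_bound * (real L + 1 + overlap_bound) * (1 / q ^ ((s' - s) + (s - s')))"
proof (cases "s \<le> s'")
  case True
  then show ?thesis using correlation_sum_ordered[OF s(1) True] by simp
next
  case False
  then have "(\<Sum>w\<in>V s'. \<Sum>v\<in>V s. measure P (thits L s' w \<inter> thits L s v) - measure P (hits s' w) * measure P (hits s v))
    \<le> pair_bound * (real L + 1 + overlap_bound) / q ^ (s - s')"
    using correlation_sum_ordered[OF s(2)] by simp
  moreover have "(\<Sum>v\<in>V s. \<Sum>w\<in>V s'. measure P (thits L s v \<inter> thits L s' w) - measure P (hits s v) * measure P (hits s' w))
    = (\<Sum>w\<in>V s'. \<Sum>v\<in>V s. measure P (thits L s' w \<inter> thits L s v) - measure P (hits s' w) * measure P (hits s v))"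
    by (subst sum.swap) (simp only: Int_commute mult.commute)
  ultimately show ?thesis using False by simp
qed

definition shellset :: "nat \<Rightarrow> (nat \<times> (nat \<Rightarrow> 'a poly)) set" where
  "shellset N = (SIGMA s:{Suc E..<N}. V s)"

definition mean :: "nat \<Rightarrow> real" where
  "mean N = (\<Sum>s\<in>{Suc E..<N}. real (card (V s)) * \<mu> s)"

definition hitcount :: "nat \<Rightarrow> (nat \<times> nat \<Rightarrow> 'a fls) \<Rightarrow> real" where
  "hitcount N A = (\<Sum>s\<in>{Suc E..<N}. real (card {v \<in> V s. hit s v A}))"

definition mean_bound :: real where "mean_bound = q ^ n * measure (hprod {1..m}) Q"

lemma shellset_finite: "finite (shellset N)"
  unfolding shellset_def by (intro finite_SigmaI V_finite) simp

lemma sum_shellset: "(\<Sum>k\<in>shellset N. f (fst k) (snd k)) = (\<Sum>s\<in>{Suc E..<N}. \<Sum>v\<in>V s. f s v)"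
  unfolding shellset_def using V_finite by (subst sum.Sigma) (auto simp: case_prod_unfold)

lemma measure_P_hits: "v \<in> V s \<Longrightarrow> measure P (hits s v) = \<mu> s"
proof -
  assume v: "v \<in> V s"
  have "hits s v \<subseteq> U" by (auto simp: hits_def)
  then show "measure P (hits s v) = \<mu> s" using measure_hits[OF v] by (simp only: measure_P)
qed

lemma mean_bound_nonneg: "0 \<le> mean_bound"
  by (simp add: mean_bound_def)

lemma mean_step: "E < s \<Longrightarrow> real (card (V s)) * \<mu> s \<le> mean_bound"
proof -
  assume s: "E < s"
  have "\<mu> s = q powr (- real (s * wt)) * measure (hprod {1..m}) Q" using s by (intro \<mu>_eq) simp
  moreover have "q powr (- real (s * wt)) = 1 / q ^ (s * wt)"
    by (simp only: powr_minus powr_realpow q_pos inverse_eq_divide)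
  ultimately have "\<mu> s = (1 / q ^ (s * wt)) * measure (hprod {1..m}) Q" by simp
  then have "real (card (V s)) * \<mu> s \<le> q ^ (n + s * wt) * ((1 / q ^ (s * wt)) * measure (hprod {1..m}) Q)"
    using V_card[of s] by (simp only:) (intro mult_right_mono mult_nonneg_nonneg, auto)
  also have "\<dots> = mean_bound" by (simp add: mean_bound_def power_add)
  finally show ?thesis .
qed

lemma \<mu>_nonneg: "0 \<le> \<mu> s"
  by (simp add: \<mu>_def)

lemma mean_le: "mean N \<le> real N * mean_bound"
proof -
  have "mean N \<le> (\<Sum>s\<in>{Suc E..<N}. mean_bound)"
    unfolding mean_def by (intro sum_mono mean_step) simp
  also have "\<dots> \<le> real N * mean_bound" using mean_bound_nonneg by (simp add: mult_right_mono)
  finally show ?thesis .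
qed

lemma mean_nonneg: "0 \<le> mean N"
  unfolding mean_def by (intro sum_nonneg mult_nonneg_nonneg \<mu>_nonneg) simp

lemma mean_eq: "(\<Sum>k\<in>shellset N. measure P (hits (fst k) (snd k))) = mean N"
proof -
  have "(\<Sum>k\<in>shellset N. measure P (hits (fst k) (snd k))) = (\<Sum>s\<in>{Suc E..<N}. \<Sum>v\<in>V s. measure P (hits s v))"
    by (rule sum_shellset)
  also have "\<dots> = (\<Sum>s\<in>{Suc E..<N}. \<Sum>v\<in>V s. \<mu> s)"
    by (intro sum.cong refl measure_P_hits)
  finally show ?thesis by (simp add: mean_def)
qed

definition tcount :: "nat \<Rightarrow> nat \<Rightarrow> (nat \<times> nat \<Rightarrow> 'a fls) \<Rightarrow> real" where
  "tcount L N A = (\<Sum>k\<in>shellset N. indicator (thits L (fst k) (snd k)) A)"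

lemma hitcount_eq:
  assumes "A \<in> U" shows "hitcount N A = (\<Sum>k\<in>shellset N. indicator (hits (fst k) (snd k)) A)"
proof -
  have "real (card {v \<in> V s. hit s v A}) = (\<Sum>v\<in>V s. indicator (hits s v) A)" for s
  proof -
    have "(\<Sum>v\<in>V s. indicator (hits s v) A) = (\<Sum>v\<in>V s. of_bool (hit s v A) :: real)"
      using assms by (intro sum.cong) (auto simp: hits_def indicator_def)
    also have "\<dots> = real (card (V s \<inter> {v. hit s v A}))" by (simp only: sum_of_bool_eq V_finite)
    finally show ?thesis by (simp only: Int_def mem_Collect_eq)
  qed
  then show ?thesis
    unfolding hitcount_def using sum_shellset[of "\<lambda>s v. indicator (hits s v) A :: real" N] by simp
qed

lemma truncation_total:
  "(\<Sum>k\<in>shellset N. measure P (hits (fst k) (snd k) - thits L (fst k) (snd k))) \<le> real N * (pair_bound / q ^ L)"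
proof -
  have "(\<Sum>k\<in>shellset N. measure P (hits (fst k) (snd k) - thits L (fst k) (snd k)))
      = (\<Sum>s\<in>{Suc E..<N}. \<Sum>v\<in>V s. measure P (hits s v - thits L s v))"
    by (rule sum_shellset)
  also have "\<dots> \<le> (\<Sum>s\<in>{Suc E..<N}. pair_bound / q ^ L)"
  proof (rule sum_mono)
    fix s
    have "(\<Sum>v\<in>V s. measure P (hits s v - thits L s v)) \<le> q ^ (1 + n + m * E) / q ^ L" by (rule truncation_cost)
    also have "\<dots> \<le> pair_bound / q ^ L"
      unfolding pair_bound_def by (intro divide_right_mono power_increasing) auto
    finally show "(\<Sum>v\<in>V s. measure P (hits s v - thits L s v)) \<le> pair_bound / q ^ L" .
  qed
  also have "\<dots> \<le> real N * (pair_bound / q ^ L)"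
    using pair_bound_nonneg by (simp only: sum_constant card_atLeastLessThan) (intro mult_right_mono divide_nonneg_nonneg, auto)
  finally show ?thesis .
qed

lemma variance_bound:
  "P.expectation (\<lambda>A. (tcount L N A - mean N)\<^sup>2)
    \<le> 4 * real N * pair_bound * (real L + 1 + overlap_bound) + 2 * (real N)\<^sup>2 * mean_bound * (pair_bound / q ^ L)"
  and variance_integrable: "integrable P (\<lambda>A. (tcount L N A - mean N)\<^sup>2)"
proof -
  let ?H = "\<lambda>k. hits (fst k) (snd k)" and ?T = "\<lambda>k. thits L (fst k) (snd k)"
  have prem: "?H k \<in> sets P" "?T k \<in> sets P" "?T k \<subseteq> ?H k" for k
    by (simp_all only: hits_P thits_P thits_sub)
  show "integrable P (\<lambda>A. (tcount L N A - mean N)\<^sup>2)"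
    using P.second_moment_truncated(2)[of "shellset N" ?H ?T, OF shellset_finite prem]
    unfolding mean_eq tcount_def .
  have "P.expectation (\<lambda>A. (tcount L N A - mean N)\<^sup>2)
    = (\<Sum>k\<in>shellset N. \<Sum>k'\<in>shellset N. measure P (?T k \<inter> ?T k') - measure P (?H k) * measure P (?H k'))
      + 2 * mean N * (\<Sum>k\<in>shellset N. measure P (?H k - ?T k))"
    using P.second_moment_truncated(1)[of "shellset N" ?H ?T, OF shellset_finite prem]
    unfolding mean_eq tcount_def .
  also have "\<dots> \<le> 4 * real N * pair_bound * (real L + 1 + overlap_bound) + 2 * (real N)\<^sup>2 * mean_bound * (pair_bound / q ^ L)"
  proof (rule add_mono)
    define c where "c = (\<lambda>s s'. \<Sum>v\<in>V s. \<Sum>w\<in>V s'. measure P (thits L s v \<inter> thits L s' w) - measure P (hits s v) * measure P (hits s' w))"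
    have "(\<Sum>k\<in>shellset N. \<Sum>k'\<in>shellset N. measure P (?T k \<inter> ?T k') - measure P (?H k) * measure P (?H k'))
      = (\<Sum>k\<in>shellset N. \<Sum>s'\<in>{Suc E..<N}. \<Sum>w\<in>V s'. measure P (?T k \<inter> thits L s' w) - measure P (?H k) * measure P (hits s' w))"
      by (intro sum.cong refl sum_shellset)
    also have "\<dots> = (\<Sum>s\<in>{Suc E..<N}. \<Sum>v\<in>V s. \<Sum>s'\<in>{Suc E..<N}. \<Sum>w\<in>V s'. measure P (thits L s v \<inter> thits L s' w) - measure P (hits s v) * measure P (hits s' w))"
      by (rule sum_shellset)
    also have "\<dots> = (\<Sum>s\<in>{Suc E..<N}. \<Sum>s'\<in>{Suc E..<N}. c s s')"
      unfolding c_def by (intro sum.cong refl sum.swap)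
    also have "\<dots> \<le> (\<Sum>s\<in>{Suc E..<N}. \<Sum>s'\<in>{Suc E..<N}. pair_bound * (real L + 1 + overlap_bound) * (1 / q ^ ((s' - s) + (s - s'))))"
      unfolding c_def by (intro sum_mono correlation_sum) auto
    also have "\<dots> \<le> (\<Sum>s\<in>{Suc E..<N}. \<Sum>s'\<in>{..<N}. pair_bound * (real L + 1 + overlap_bound) * (1 / q ^ ((s' - s) + (s - s'))))"
      using pair_bound_nonneg overlap_bound_nonneg by (intro sum_mono sum_mono2) auto
    also have "\<dots> = (\<Sum>s\<in>{Suc E..<N}. pair_bound * (real L + 1 + overlap_bound) * (\<Sum>s'\<in>{..<N}. 1 / q ^ ((s' - s) + (s - s'))))"
      by (simp only: sum_distrib_left)
    also have "\<dots> \<le> (\<Sum>s\<in>{Suc E..<N}. pair_bound * (real L + 1 + overlap_bound) * 4)"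
      using pair_bound_nonneg overlap_bound_nonneg by (intro sum_mono mult_left_mono sum_power_distance_le q_ge_2) auto
    also have "\<dots> \<le> real N * (pair_bound * (real L + 1 + overlap_bound) * 4)"
      using pair_bound_nonneg overlap_bound_nonneg by (simp only: sum_constant card_atLeastLessThan) (intro mult_right_mono, auto)
    finally show "(\<Sum>k\<in>shellset N. \<Sum>k'\<in>shellset N. measure P (?T k \<inter> ?T k') - measure P (?H k) * measure P (?H k'))
      \<le> 4 * real N * pair_bound * (real L + 1 + overlap_bound)" by (simp only: mult_ac)
    have "2 * mean N * (\<Sum>k\<in>shellset N. measure P (?H k - ?T k)) \<le> (2 * (real N * mean_bound)) * (real N * (pair_bound / q ^ L))"
      using mean_le mean_nonneg mean_bound_nonneg by (intro mult_mono truncation_total mult_left_mono sum_nonneg) auto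
    also have "\<dots> = 2 * (real N)\<^sup>2 * mean_bound * (pair_bound / q ^ L)" by (simp add: power2_eq_square)
    finally show "2 * mean N * (\<Sum>k\<in>shellset N. measure P (?H k - ?T k)) \<le> 2 * (real N)\<^sup>2 * mean_bound * (pair_bound / q ^ L)" .
  qed
  finally show "P.expectation (\<lambda>A. (tcount L N A - mean N)\<^sup>2)
    \<le> 4 * real N * pair_bound * (real L + 1 + overlap_bound) + 2 * (real N)\<^sup>2 * mean_bound * (pair_bound / q ^ L)" .
qed

lemma excess_expectation:
  "P.expectation (\<lambda>A. \<Sum>k\<in>shellset N. indicator (hits (fst k) (snd k) - thits L (fst k) (snd k)) A) \<le> real N * (pair_bound / q ^ L)"
  and excess_integrable:
  "integrable P (\<lambda>A. \<Sum>k\<in>shellset N. indicator (hits (fst k) (snd k) - thits L (fst k) (snd k)) A :: real)"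
proof -
  have *: "hits s v - thits L s v \<in> sets P" for s v by (intro sets.Diff hits_P thits_P)
  have int: "integrable P (indicator (hits s v - thits L s v) :: _ \<Rightarrow> real)" for s v
    using *[of s v] P.emeasure_finite by (intro integrable_real_indicator) (simp_all only: less_top infinity_ennreal_def not_False_eq_True)
  show "integrable P (\<lambda>A. \<Sum>k\<in>shellset N. indicator (hits (fst k) (snd k) - thits L (fst k) (snd k)) A :: real)"
    by (intro Bochner_Integration.integrable_sum int)
  have "P.expectation (\<lambda>A. \<Sum>k\<in>shellset N. indicator (hits (fst k) (snd k) - thits L (fst k) (snd k)) A :: real)
      = (\<Sum>k\<in>shellset N. P.expectation (indicator (hits (fst k) (snd k) - thits L (fst k) (snd k))))"
    by (intro Bochner_Integration.integral_sum int)
  also have "\<dots> = (\<Sum>k\<in>shellset N. measure P (hits (fst k) (snd k) - thits L (fst k) (snd k)))"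
    using sets.sets_into_space[OF *] by (intro sum.cong refl) (simp add: Int_absorb2)
  finally show "P.expectation (\<lambda>A. \<Sum>k\<in>shellset N. indicator (hits (fst k) (snd k) - thits L (fst k) (snd k)) A) \<le> real N * (pair_bound / q ^ L)"
    using truncation_total by simp
qed

end

lemma tendsto_sum_squares_imp:
  fixes x y :: "nat \<Rightarrow> real"
  assumes "(\<lambda>k. x k + (y k)\<^sup>2) \<longlonglongrightarrow> 0" "\<And>k. 0 \<le> x k"
  shows "(\<lambda>k. x k + y k) \<longlonglongrightarrow> 0"
proof -
  have x: "x \<longlonglongrightarrow> 0"
    by (rule tendsto_sandwich[OF _ _ tendsto_const assms(1)]) (use assms(2) in auto)
  have "(\<lambda>k. (y k)\<^sup>2) \<longlonglongrightarrow> 0"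
    by (rule tendsto_sandwich[OF _ _ tendsto_const assms(1)]) (use assms(2) in auto)
  then have "(\<lambda>k. sqrt ((y k)\<^sup>2)) \<longlonglongrightarrow> sqrt 0" by (rule tendsto_real_sqrt)
  then have "y \<longlonglongrightarrow> 0" by (simp add: tendsto_rabs_zero_iff)
  with x show ?thesis using tendsto_add by fastforce
qed

context shells
begin

definition excess :: "nat \<Rightarrow> nat \<Rightarrow> (nat \<times> nat \<Rightarrow> 'a fls) \<Rightarrow> real" where
  "excess L N A = (\<Sum>k\<in>shellset N. indicator (hits (fst k) (snd k) - thits L (fst k) (snd k)) A)"

lemma hitcount_split: "A \<in> U \<Longrightarrow> hitcount N A = tcount L N A + excess L N A"
proof -
  assume A: "A \<in> U"
  have "indicator (hits s v) A = indicator (thits L s v) A + (indicator (hits s v - thits L s v) A :: real)" for s v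
    using thits_sub[of L s v] by (auto simp: indicator_def)
  then show ?thesis
    unfolding hitcount_eq[OF A] tcount_def excess_def sum.distrib[symmetric] by (intro sum.cong refl)
qed

lemma hitcount_mono: "mono (\<lambda>N. hitcount N A)"
  unfolding hitcount_def by (intro monoI sum_mono2) auto

lemma mean_mono: "mono mean"
proof (intro monoI)
  fix N N' :: nat assume "N \<le> N'"
  then show "mean N \<le> mean N'"
    unfolding mean_def using \<mu>_nonneg by (intro sum_mono2 mult_nonneg_nonneg) auto
qed

lemma mean_Suc: "mean (Suc N) \<le> mean N + mean_bound"
proof (cases "Suc E \<le> N")
  case True
  then have "mean (Suc N) = mean N + real (card (V N)) * \<mu> N" by (simp add: mean_def)
  then show ?thesis using mean_step[of N] True by simp
next
  case False
  then have "mean (Suc N) = 0" by (simp add: mean_def)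
  then show ?thesis using mean_nonneg mean_bound_nonneg by (simp add: add_nonneg_nonneg)
qed

text \<open>
  Truncate at \<open>L = k\<close> when there are \<open>N = k^3\<close> shells. After division by \<open>N\<close>, the expected number of
  removed hits is of order \<open>q^(-k)\<close>, and after division by \<open>N\<^sup>2\<close> the second moment of the rest is of
  order \<open>k / N = k^(-2)\<close>, up to a term of order \<open>q^(-k)\<close>. Both are summable in \<open>k\<close>.\<close>

lemma hits_law_cubes:
  "AE A in P. (\<lambda>k. (hitcount (k ^ 3) A - mean (k ^ 3)) / real (k ^ 3)) \<longlonglongrightarrow> 0"
proof -
  define Z where "Z = (\<lambda>k A. excess k (k ^ 3) A / real (k ^ 3) + ((tcount k (k ^ 3) A - mean (k ^ 3)) / real (k ^ 3))\<^sup>2)"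
  have ex0: "0 \<le> excess L N A" for L N A
    unfolding excess_def by (intro sum_nonneg) simp
  have int1: "integrable P (\<lambda>A. excess k (k ^ 3) A / real (k ^ 3))" for k
    using excess_integrable unfolding excess_def by (rule integrable_divide)
  have int2: "integrable P (\<lambda>A. ((tcount k (k ^ 3) A - mean (k ^ 3)) / real (k ^ 3))\<^sup>2)" for k
    unfolding power_divide by (intro integrable_divide variance_integrable)
  have int: "integrable P (Z k)" for k
    unfolding Z_def by (intro Bochner_Integration.integrable_add int1 int2)
  have bound: "P.expectation (Z k) \<le> (pair_bound + 2 * mean_bound * pair_bound) * (1/2) ^ k + (4 * pair_bound * (2 + overlap_bound)) * inverse ((real k) ^ 2)" for k
  proof (cases "k = 0")
    case True
    then show ?thesis using pair_bound_nonneg overlap_bound_nonneg mean_bound_nonneg by (simp add: Z_def)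
  next
    case False
    define N where "N = real (k ^ 3)"
    have N: "0 < N" using False by (simp add: N_def)
    have "P.expectation (Z k) = P.expectation (\<lambda>A. excess k (k ^ 3) A / N) + P.expectation (\<lambda>A. ((tcount k (k ^ 3) A - mean (k ^ 3)) / N)\<^sup>2)"
      unfolding Z_def N_def by (intro Bochner_Integration.integral_add int1 int2)
    also have "P.expectation (\<lambda>A. excess k (k ^ 3) A / N) = P.expectation (\<lambda>A. excess k (k ^ 3) A) / N"
      by simp
    also have "P.expectation (\<lambda>A. ((tcount k (k ^ 3) A - mean (k ^ 3)) / N)\<^sup>2)
        = P.expectation (\<lambda>A. (tcount k (k ^ 3) A - mean (k ^ 3))\<^sup>2) / N\<^sup>2"
      unfolding power_divide by simp
    also have "P.expectation (\<lambda>A. excess k (k ^ 3) A) / N + P.expectation (\<lambda>A. (tcount k (k ^ 3) A - mean (k ^ 3))\<^sup>2) / N\<^sup>2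
      \<le> (N * (pair_bound / q ^ k)) / N + (4 * N * pair_bound * (real k + 1 + overlap_bound) + 2 * N\<^sup>2 * mean_bound * (pair_bound / q ^ k)) / N\<^sup>2"
      using N excess_expectation[where L = k and N = "k ^ 3"] variance_bound[where L = k and N = "k ^ 3"]
      by (intro add_mono divide_right_mono) (auto simp: excess_def N_def)
    also have "\<dots> = (pair_bound + 2 * mean_bound * pair_bound) * (1 / q ^ k) + 4 * pair_bound * ((real k + 1 + overlap_bound) / N)"
      using N by (simp add: field_simps power2_eq_square)
    also have "\<dots> \<le> (pair_bound + 2 * mean_bound * pair_bound) * (1/2) ^ k + 4 * pair_bound * ((2 + overlap_bound) * inverse ((real k) ^ 2))"
    proof (intro add_mono mult_left_mono)
      show "1 / q ^ k \<le> (1/2) ^ k"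
        using q_ge_2 by (simp add: power_one_over) (intro divide_left_mono power_mono, auto)
      have "real k + 1 + overlap_bound \<le> (2 + overlap_bound) * real k"
      proof -
        have "1 \<le> real k" using False by simp
        moreover have "overlap_bound * 1 \<le> overlap_bound * real k" using calculation overlap_bound_nonneg by (intro mult_left_mono) auto
        ultimately show ?thesis by (simp add: algebra_simps)
      qed
      then have "(real k + 1 + overlap_bound) / N \<le> (2 + overlap_bound) * real k / N" using N by (intro divide_right_mono) auto
      also have "\<dots> = (2 + overlap_bound) * inverse ((real k) ^ 2)"
        using False by (simp add: N_def field_simps power2_eq_square power3_eq_cube)
      finally show "(real k + 1 + overlap_bound) / N \<le> (2 + overlap_bound) * inverse ((real k) ^ 2)" .
    qed (use pair_bound_nonneg mean_bound_nonneg in auto)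
    finally show ?thesis by (simp add: mult.assoc)
  qed
  have nn: "0 \<le> Z k A" for k A using ex0 by (simp add: Z_def)
  have "summable (\<lambda>k. (pair_bound + 2 * mean_bound * pair_bound) * (1/2) ^ k + (4 * pair_bound * (2 + overlap_bound)) * inverse ((real k) ^ 2))"
    by (intro summable_add summable_mult summable_geometric inverse_power_summable) auto
  then have "summable (\<lambda>k. P.expectation (Z k))"
    by (rule summable_comparison_test'[where N = 0]) (use bound nn in \<open>auto simp: Bochner_Integration.integral_nonneg\<close>)
  from P.AE_tendsto_0_of_summable_expectation[OF int nn this]
  have "AE A in P. (\<lambda>k. Z k A) \<longlonglongrightarrow> 0" .
  moreover have "AE A in P. A \<in> U" using space_P by (intro AE_I2) simp
  ultimately show ?thesis
  proof eventually_elim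
    case (elim A)
    have "(\<lambda>k. excess k (k ^ 3) A / real (k ^ 3) + (tcount k (k ^ 3) A - mean (k ^ 3)) / real (k ^ 3)) \<longlonglongrightarrow> 0"
      by (rule tendsto_sum_squares_imp) (use elim(1) ex0 in \<open>auto simp: Z_def\<close>)
    moreover have "excess k (k ^ 3) A / real (k ^ 3) + (tcount k (k ^ 3) A - mean (k ^ 3)) / real (k ^ 3)
        = (hitcount (k ^ 3) A - mean (k ^ 3)) / real (k ^ 3)" for k
      unfolding hitcount_split[OF elim(2), of _ k] by (simp add: add_divide_distrib[symmetric] algebra_simps)
    ultimately show ?case by simp
  qed
qed

lemma hit_fpart: "hit s v (\<lambda>(i, j)\<in>{1..m} \<times> {1..n}. fpart (A (i, j))) \<longleftrightarrow> hit s v A"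
proof -
  have "fpart (rowdot n (\<lambda>(i, j)\<in>{1..m} \<times> {1..n}. fpart (A (i, j))) v i) = fpart (rowdot n A v i)" if i: "i \<in> {1..m}" for i
  proof -
    have "rowdot n (\<lambda>(i, j)\<in>{1..m} \<times> {1..n}. fpart (A (i, j))) v i = dotp n (\<lambda>j. fpart (A (i, j))) v"
      using i by (simp add: rowdot_def dotp_def)
    then show ?thesis
      by (intro fls_eqI) (simp add: fpart_nth dotp_fpart_nth rowdot_def)
  qed
  then have "(\<lambda>i\<in>{1..m}. fls_shift (int (s * a i)) (fpart (rowdot n (\<lambda>(i, j)\<in>{1..m} \<times> {1..n}. fpart (A (i, j))) v i)))
    = (\<lambda>i\<in>{1..m}. fls_shift (int (s * a i)) (fpart (rowdot n A v i)))"
    by (intro restrict_ext) (simp only:)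
  then show ?thesis unfolding hit_def by (simp only:)
qed

text \<open>
  Hits depend only on \<open>A\<close> modulo polynomial matrices, so the law carries over from the unit cube to its
  countably many translates.\<close>

theorem hits_law:
  "AE A in mats. (\<lambda>N. (hitcount N A - mean N) / real N) \<longlonglongrightarrow> 0"
proof -
  let ?J = "{1..m} \<times> {1..n}"
  let ?G = "\<lambda>A. (\<lambda>N. (hitcount N A - mean N) / real N) \<longlonglongrightarrow> 0"
  let ?fr = "\<lambda>A. \<lambda>(i, j)\<in>?J. fpart (A (i, j))"
  have "AE A in P. ?G A"
    using hits_law_cubes
  proof eventually_elim
    case (elim A)
    then show ?case by (rule tendsto_average_from_cubes[OF hitcount_mono mean_mono mean_Suc])
  qed
  then have "AE A in mats. A \<in> U \<longrightarrow> ?G A"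
    using U_mats by (subst (asm) AE_restrict_space_iff) (auto simp: Int_absorb2 sets.sets_into_space)
  then obtain N0 where N0: "N0 \<in> null_sets mats" and sub: "{A \<in> space mats. \<not> (A \<in> U \<longrightarrow> ?G A)} \<subseteq> N0"
    unfolding eventually_ae_filter by blast
  define X where "X = (\<lambda>z. {A \<in> ?J \<rightarrow>\<^sub>E UNIV. (\<lambda>j\<in>?J. emb (z j) + A j) \<in> N0})"
  have X: "X z \<in> null_sets mats" for z
  proof
    show "emeasure mats (X z) = 0"
      using emeasure_hprod_translate[of ?J N0 "\<lambda>j. emb (z j)"] N0 by (auto simp: X_def null_sets_def)
    have "(\<lambda>A. \<lambda>j\<in>?J. emb (z j) + A j) \<in> measurable mats mats"
      by (rule coordinatewise_measurable) simp
    from measurable_sets[OF this, of N0] show "X z \<in> sets mats"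
      using N0 by (auto simp: X_def space_hprod vimage_def Int_def conj_commute)
  qed
  have "countable (?J \<rightarrow>\<^sub>E (UNIV :: 'a poly set))"
    by (intro countable_PiE countable_poly) simp
  then have UX: "(\<Union>z\<in>?J \<rightarrow>\<^sub>E UNIV. X z) \<in> null_sets mats"
    by (intro null_sets_UN' X)
  show ?thesis
  proof (rule AE_I'[OF UX], rule subsetI)
    fix A assume A: "A \<in> {A \<in> space mats. \<not> ?G A}"
    have "hitcount N (?fr A) = hitcount N A" for N
      unfolding hitcount_def hit_fpart ..
    then have "\<not> ?G (?fr A)" using A by simp
    moreover have "?fr A \<in> U" by (auto simp: unit_cube_def)
    moreover have "?fr A \<in> space mats" by (auto simp: space_hprod)
    ultimately have fr: "?fr A \<in> N0" using sub by blast
    define z where "z = (\<lambda>p\<in>?J. - ppart (A p))"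
    have "(\<lambda>j\<in>?J. emb (z j) + A j) = ?fr A"
      by (rule restrict_ext) (auto simp: z_def fpart_def emb_uminus)
    then have "A \<in> X z" using A fr by (simp add: X_def space_hprod)
    moreover have "z \<in> ?J \<rightarrow>\<^sub>E UNIV" by (simp add: z_def)
    ultimately show "A \<in> (\<Union>z\<in>?J \<rightarrow>\<^sub>E UNIV. X z)" by blast
  qed
qed

end

section \<open>Jordan measurable sets\<close>

definition near :: "'i set \<Rightarrow> int \<Rightarrow> ('i \<Rightarrow> 'a::{field,finite} fls) \<Rightarrow> ('i \<Rightarrow> 'a fls) \<Rightarrow> bool" where
  "near J l x y \<longleftrightarrow> (\<forall>j\<in>J. y j - x j \<in> vball l)"

lemma near_refl [simp]: "near J l x x"
  by (simp add: near_def)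

lemma near_sym: "near J l x y \<Longrightarrow> near J l y x"
  unfolding near_def by (metis minus_diff_eq vball_uminus)

lemma near_trans: "near J l x y \<Longrightarrow> near J l y z \<Longrightarrow> near J l x z"
  unfolding near_def
proof
  fix j assume *: "\<forall>j\<in>J. y j - x j \<in> vball l" "\<forall>j\<in>J. z j - y j \<in> vball l" "j \<in> J"
  have "(z j - y j) + (y j - x j) \<in> vball l" using * by (intro vball_add) auto
  then show "z j - x j \<in> vball l" by simp
qed

lemma near_mono: "near J l x y \<Longrightarrow> k \<le> l \<Longrightarrow> near J k x y"
  unfolding near_def using vball_mono by blast

lemma near_nth: "near J l x y \<Longrightarrow> j \<in> J \<Longrightarrow> k \<le> l \<Longrightarrow> y j $$ k = x j $$ k"
  by (simp add: near_def vball_def)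

lemma level_set_near:
  "level_set J (\<lambda>_. l) B \<longleftrightarrow> B \<subseteq> J \<rightarrow>\<^sub>E UNIV \<and> (\<forall>x\<in>B. \<forall>y\<in>J \<rightarrow>\<^sub>E UNIV. near J l x y \<longrightarrow> y \<in> B)"
  by (simp add: level_set_def near_def)

definition outer_approx :: "'i set \<Rightarrow> int \<Rightarrow> ('i \<Rightarrow> 'a::{field,finite} fls) set \<Rightarrow> ('i \<Rightarrow> 'a fls) set" where
  "outer_approx J l C = {x \<in> J \<rightarrow>\<^sub>E UNIV. \<exists>y\<in>C. near J l x y}"

definition inner_approx :: "'i set \<Rightarrow> int \<Rightarrow> ('i \<Rightarrow> 'a::{field,finite} fls) set \<Rightarrow> ('i \<Rightarrow> 'a fls) set" where
  "inner_approx J l C = {x \<in> J \<rightarrow>\<^sub>E UNIV. \<forall>y\<in>J \<rightarrow>\<^sub>E UNIV. near J l x y \<longrightarrow> y \<in> C}"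

lemma level_set_outer: "level_set J (\<lambda>_. l) (outer_approx J l C)"
  unfolding level_set_near outer_approx_def using near_sym near_trans by blast

lemma level_set_inner: "level_set J (\<lambda>_. l) (inner_approx J l C)"
  unfolding level_set_near inner_approx_def using near_trans by blast

lemma inner_subset: "inner_approx J l C \<subseteq> C"
  unfolding inner_approx_def using near_refl by blast

lemma subset_outer: "C \<subseteq> J \<rightarrow>\<^sub>E UNIV \<Longrightarrow> C \<subseteq> outer_approx J l C"
  unfolding outer_approx_def using near_refl by blast

lemma outer_bounded:
  assumes "\<And>x i k. x \<in> C \<Longrightarrow> i \<in> J \<Longrightarrow> k \<le> - int E \<Longrightarrow> x i $$ k = 0"
    and "x \<in> outer_approx J (int l) C" "i \<in> J" "k \<le> - int E"
  shows "x i $$ k = 0"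
proof -
  obtain y where y: "y \<in> C" "near J (int l) x y" using assms(2) by (auto simp: outer_approx_def)
  have "y i $$ k = x i $$ k" by (rule near_nth[OF y(2) assms(3)]) (use assms(4) in linarith)
  then show ?thesis using assms(1)[OF y(1) assms(3,4)] by simp
qed

context haar
begin

lemma bounded_box:
  assumes J: "finite J" and B: "B \<subseteq> J \<rightarrow>\<^sub>E UNIV" "\<And>x i k. x \<in> B \<Longrightarrow> i \<in> J \<Longrightarrow> k \<le> - int E \<Longrightarrow> x i $$ k = 0"
  shows "emeasure (hprod J) B \<le> ennreal (q powr real (card J * E))"
proof -
  have "B \<subseteq> Pi\<^sub>E J (\<lambda>j. kball ((\<lambda>_. 0) j) ((\<lambda>_. - int E) j))"
  proof
    fix x assume "x \<in> B"
    then show "x \<in> Pi\<^sub>E J (\<lambda>j. kball ((\<lambda>_. 0) j) ((\<lambda>_. - int E) j))"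
      using B by (auto simp: PiE_iff kball_0 vball_def)
  qed
  then have "emeasure (hprod J) B \<le> emeasure (hprod J) (Pi\<^sub>E J (\<lambda>j. kball ((\<lambda>_. 0) j) ((\<lambda>_. - int E) j)))"
    by (intro emeasure_mono box_sets J)
  then show ?thesis unfolding emeasure_box[OF J] by simp
qed

text \<open>
  The points at which every ball meets both \<open>C\<close> and its complement form the intersection of the
  decreasing sequence of sets \<open>outer_approx J l C - inner_approx J l C\<close>.\<close>

lemma jordan_approximation:
  assumes J: "finite J" and C: "C \<subseteq> J \<rightarrow>\<^sub>E UNIV"
    and bd: "\<And>x i k. x \<in> C \<Longrightarrow> i \<in> J \<Longrightarrow> k \<le> - int E \<Longrightarrow> x i $$ k = 0"
    and N: "N \<in> null_sets (hprod J)"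
    and fr: "\<And>x. x \<in> J \<rightarrow>\<^sub>E UNIV \<Longrightarrow> (\<And>l. \<exists>y\<in>C. near J (int l) x y)
      \<Longrightarrow> (\<And>l. \<exists>y\<in>J \<rightarrow>\<^sub>E UNIV. y \<notin> C \<and> near J (int l) x y) \<Longrightarrow> x \<in> N"
    and \<epsilon>: "0 < \<epsilon>"
  shows "\<exists>l. measure (hprod J) (outer_approx J (int l) C) \<le> measure (hprod J) (inner_approx J (int l) C) + \<epsilon>"
proof -
  define D where "D = (\<lambda>l. outer_approx J (int l) C - inner_approx J (int l) C)"
  have os: "outer_approx J (int l) C \<in> sets (hprod J)" and "is": "inner_approx J (int l) C \<in> sets (hprod J)" for l
    using level_set_sets[OF J level_set_outer] level_set_sets[OF J level_set_inner] by blast+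
  have ofin: "emeasure (hprod J) (outer_approx J (int l) C) \<noteq> \<infinity>" for l
  proof -
    have "emeasure (hprod J) (outer_approx J (int l) C) \<le> ennreal (q powr real (card J * E))"
    proof (rule bounded_box[OF J])
      show "x i $$ k = 0" if "x \<in> outer_approx J (int l) C" "i \<in> J" "k \<le> - int E" for x i k
        using bd that by (rule outer_bounded)
    qed (auto simp: outer_approx_def)
    then show ?thesis by (metis ennreal_neq_top infinity_ennreal_def top.extremum_unique)
  qed
  have Ds: "range D \<subseteq> sets (hprod J)" using os "is" by (auto simp: D_def)
  have D_sub: "D l \<subseteq> outer_approx J (int l) C" for l by (auto simp: D_def)
  have Dfin: "emeasure (hprod J) (D l) \<noteq> \<infinity>" for l
    using emeasure_mono[OF D_sub os, of l] ofin[of l] by (auto simp: top_unique)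
  have "decseq D"
  proof (rule decseq_SucI)
    fix l
    have nm: "near J (int l) x y" if "near J (int (Suc l)) x y" for x y :: "'b \<Rightarrow> 'a fls"
      using near_mono[OF that, of "int l"] by simp
    have "outer_approx J (int (Suc l)) C \<subseteq> outer_approx J (int l) C"
      unfolding outer_approx_def using nm by blast
    moreover have "inner_approx J (int l) C \<subseteq> inner_approx J (int (Suc l)) C"
      unfolding inner_approx_def using nm by blast
    ultimately show "D (Suc l) \<subseteq> D l" by (auto simp: D_def)
  qed
  from Lim_measure_decseq[OF Ds this Dfin]
  have lim: "(\<lambda>l. measure (hprod J) (D l)) \<longlonglongrightarrow> measure (hprod J) (\<Inter>l. D l)" .
  have "(\<Inter>l. D l) \<subseteq> N"
  proof
    fix x assume x: "x \<in> (\<Inter>l. D l)"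
    show "x \<in> N"
    proof (rule fr)
      show "x \<in> J \<rightarrow>\<^sub>E UNIV" using x by (auto simp: D_def outer_approx_def)
      show "\<exists>y\<in>C. near J (int l) x y" for l using x by (auto simp: D_def outer_approx_def)
      show "\<exists>y\<in>J \<rightarrow>\<^sub>E UNIV. y \<notin> C \<and> near J (int l) x y" for l using x by (auto simp: D_def outer_approx_def inner_approx_def)
    qed
  qed
  moreover have "(\<Inter>l. D l) \<in> sets (hprod J)" using Ds by auto
  ultimately have "(\<Inter>l. D l) \<in> null_sets (hprod J)" using N null_sets_subset by blast
  then have "measure (hprod J) (\<Inter>l. D l) = 0" by (simp add: measure_eq_0_null_sets)
  with lim have "eventually (\<lambda>l. measure (hprod J) (D l) < \<epsilon>) sequentially"
    using \<epsilon> by (intro order_tendstoD(2)) auto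
  then obtain l where l: "measure (hprod J) (D l) < \<epsilon>"
    using eventually_happens'[OF sequentially_bot] by blast
  have sub: "inner_approx J (int l) C \<subseteq> outer_approx J (int l) C" using inner_subset subset_outer[OF C] by blast
  have "measure (hprod J) (D l) = measure (hprod J) (outer_approx J (int l) C) - measure (hprod J) (inner_approx J (int l) C)"
    unfolding D_def using os "is" sub ofin by (intro measure_Diff) auto
  then show ?thesis using l by (intro exI[of _ l]) linarith
qed

end

section \<open>Spheres and dilations\<close>

definition dil :: "nat \<Rightarrow> (nat \<Rightarrow> nat) \<Rightarrow> int \<Rightarrow> (nat \<Rightarrow> 'a::{field,finite} fls) \<Rightarrow> (nat \<Rightarrow> 'a fls)" where
  "dil k w l x = (\<lambda>i\<in>{1..k}. fls_shift (l * int (w i)) (x i))"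

lemma powi_mult_eq_shift: "fls_X_inv powi l * x = fls_shift l x" for x :: "'a::field fls"
proof (cases "0 \<le> l")
  case True
  then show ?thesis by (simp add: power_int_def fls_X_inv_power_times_conv_shift)
next
  case False
  then show ?thesis
    by (simp add: power_int_def fls_inverse_X_inv fls_X_power_times_conv_shift)
qed

lemma dilation_orbit_eq: "dilation_orbit k w x = range (\<lambda>l. dil k w l x)"
  by (simp add: dilation_orbit_def dil_def powi_mult_eq_shift)

lemma dil_dil: "dil k w l (dil k w l' x) = dil k w (l + l') x"
  unfolding dil_def by (rule restrict_ext) (simp add: algebra_simps)

lemma dil_kvec [simp]: "dil k w l x \<in> kvec k"
  by (auto simp: dil_def kvec_def)

lemma kabs_nonneg: "0 \<le> kabs x"
  by (simp add: kabs_def)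

lemma card_gt_1: "1 < real CARD('a::{field,finite})"
proof -
  have "card {0::'a, 1} \<le> CARD('a)" by (intro card_mono) auto
  then show ?thesis by simp
qed

lemma kabs_powr: "x \<noteq> 0 \<Longrightarrow> kabs x = real CARD('a) powr (- real_of_int (fls_subdegree x))"
  for x :: "'a::{field,finite} fls"
  using powr_real_of_int'[of "real CARD('a)" "- fls_subdegree x"] card_gt_1[where 'a = 'a] by (simp add: kabs_def)

lemma kabs_shift: "kabs (fls_shift c x) = real CARD('a) powr real_of_int c * kabs x"
  for x :: "'a::{field,finite} fls"
proof (cases "x = 0")
  case True
  then show ?thesis by (simp add: kabs_def)
next
  case False
  then have "fls_shift c x \<noteq> 0" by (simp add: fls_shift_eq0_iff)
  then have "kabs (fls_shift c x) = real CARD('a) powr (real_of_int c + (- real_of_int (fls_subdegree x)))"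
    using False by (simp add: kabs_powr)
  then show ?thesis by (simp only: powr_add kabs_powr[OF False])
qed

lemma kabs_le_1_iff: "kabs x \<le> 1 \<longleftrightarrow> (\<forall>j<0. x $$ j = 0)"
  for x :: "'a::{field,finite} fls"
proof (cases "x = 0")
  case True
  then show ?thesis by (simp add: kabs_def)
next
  case False
  have "kabs x \<le> 1 \<longleftrightarrow> real CARD('a) powr (- real_of_int (fls_subdegree x)) \<le> real CARD('a) powr 0"
    using card_gt_1[where 'a = 'a] False by (simp add: kabs_powr)
  also have "\<dots> \<longleftrightarrow> 0 \<le> fls_subdegree x"
    using card_gt_1[where 'a = 'a] by (subst powr_le_cancel_iff) auto
  also have "\<dots> \<longleftrightarrow> (\<forall>j<0. x $$ j = 0)"
  proof
    assume "\<forall>j<0. x $$ j = 0"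
    then show "0 \<le> fls_subdegree x" using nth_fls_subdegree_nonzero[OF False] by (meson not_le)
  qed auto
  finally show ?thesis .
qed

lemma kabs_eq_1_iff: "kabs x = 1 \<longleftrightarrow> (\<forall>j<0. x $$ j = 0) \<and> x $$ 0 \<noteq> 0"
  for x :: "'a::{field,finite} fls"
proof (cases "x = 0")
  case True
  then show ?thesis by (simp add: kabs_def)
next
  case False
  have "kabs x = 1 \<longleftrightarrow> real CARD('a) powr (- real_of_int (fls_subdegree x)) = real CARD('a) powr 0"
    using card_gt_1[where 'a = 'a] False by (simp add: kabs_powr)
  also have "\<dots> \<longleftrightarrow> fls_subdegree x = 0"
    using card_gt_1[where 'a = 'a] by (subst powr_inj) auto
  also have "\<dots> \<longleftrightarrow> (\<forall>j<0. x $$ j = 0) \<and> x $$ 0 \<noteq> 0"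
  proof
    assume e: "fls_subdegree x = 0"
    then show "(\<forall>j<0. x $$ j = 0) \<and> x $$ 0 \<noteq> 0"
      using nth_fls_subdegree_nonzero[OF False] by simp
  next
    assume "(\<forall>j<0. x $$ j = 0) \<and> x $$ 0 \<noteq> 0"
    then show "fls_subdegree x = 0" by (intro fls_subdegree_eqI) auto
  qed
  finally show ?thesis .
qed

lemma ksphere_kabs:
  assumes k: "1 \<le> k"
  shows "x \<in> ksphere k \<longleftrightarrow> x \<in> kvec k \<and> (\<forall>i\<in>{1..k}. kabs (x i) \<le> 1) \<and> (\<exists>i\<in>{1..k}. kabs (x i) = 1)"
proof -
  have "finite ((\<lambda>i. kabs (x i)) ` {1..k})" "(\<lambda>i. kabs (x i)) ` {1..k} \<noteq> {}" using k by auto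
  from Max_eq_iff[OF this, of 1] show ?thesis by (auto simp: ksphere_def)
qed

lemma ksphere_iff:
  assumes k: "1 \<le> k"
  shows "x \<in> ksphere k \<longleftrightarrow> x \<in> kvec k \<and> (\<forall>i\<in>{1..k}. \<forall>j<0. x i $$ j = 0) \<and> (\<exists>i\<in>{1..k}. x i $$ 0 \<noteq> 0)"
  unfolding ksphere_kabs[OF k] kabs_le_1_iff kabs_eq_1_iff by blast

text \<open>
  Dilation by \<open>l\<close> multiplies the quasinorm by \<open>q^l\<close>, and the quasinorm is 1 on the sphere. Consequently an
  orbit meets the sphere at most once.\<close>

lemma qnorm_eq:
  fixes x :: "nat \<Rightarrow> 'a::{field,finite} fls"
  assumes k: "1 \<le> k" and w: "\<And>i. i \<in> {1..k} \<Longrightarrow> 0 < w i" and s: "dil k w l x \<in> ksphere k"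
  shows "qnorm k w x = real CARD('a) powr (- real_of_int l)"
  unfolding qnorm_def
proof (rule Max_eqI)
  let ?q = "real CARD('a)"
  define y where "y = dil k w l x"
  have e: "kabs (x i) powr (1 / real (w i)) = ?q powr (- real_of_int l) * kabs (y i) powr (1 / real (w i))"
    if i: "i \<in> {1..k}" for i
  proof -
    have "kabs (y i) = ?q powr (real_of_int l * real (w i)) * kabs (x i)"
      using i by (simp add: y_def dil_def kabs_shift)
    then have "kabs (y i) powr (1 / real (w i))
        = (?q powr (real_of_int l * real (w i))) powr (1 / real (w i)) * kabs (x i) powr (1 / real (w i))"
      using kabs_nonneg by (simp add: powr_mult)
    also have "(?q powr (real_of_int l * real (w i))) powr (1 / real (w i)) = ?q powr real_of_int l"
      using w[OF i] by (simp add: powr_powr)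
    finally have "?q powr (- real_of_int l) * kabs (y i) powr (1 / real (w i))
        = (?q powr (- real_of_int l) * ?q powr real_of_int l) * kabs (x i) powr (1 / real (w i))" by simp
    also have "?q powr (- real_of_int l) * ?q powr real_of_int l = 1"
      using card_gt_1[where 'a = 'a] by (simp add: powr_add[symmetric])
    finally show ?thesis by simp
  qed
  have y: "\<And>i. i \<in> {1..k} \<Longrightarrow> kabs (y i) \<le> 1" "\<exists>i\<in>{1..k}. kabs (y i) = 1"
    using s ksphere_kabs[OF k, of y] by (auto simp: y_def)
  show "z \<le> ?q powr (- real_of_int l)" if z: "z \<in> (\<lambda>i. kabs (x i) powr (1 / real (w i))) ` {1..k}" for z
  proof -
    obtain i where i: "i \<in> {1..k}" "z = kabs (x i) powr (1 / real (w i))" using z by blast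
    have "kabs (y i) powr (1 / real (w i)) \<le> 1 powr (1 / real (w i))"
      using y(1)[OF i(1)] kabs_nonneg by (intro powr_mono2) auto
    then have "?q powr (- real_of_int l) * kabs (y i) powr (1 / real (w i)) \<le> ?q powr (- real_of_int l) * 1"
      by (intro mult_left_mono) auto
    then show ?thesis using e[OF i(1)] i(2) by simp
  qed
  obtain i where "i \<in> {1..k}" "kabs (y i) = 1" using y(2) by blast
  then show "?q powr (- real_of_int l) \<in> (\<lambda>i. kabs (x i) powr (1 / real (w i))) ` {1..k}"
    using e[of i] by (intro image_eqI[of _ _ i]) auto
qed simp

lemma dil_sphere_unique:
  fixes x :: "nat \<Rightarrow> 'a::{field,finite} fls"
  assumes k: "1 \<le> k" and w: "\<And>i. i \<in> {1..k} \<Longrightarrow> 0 < w i"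
    and s: "dil k w l x \<in> ksphere k" "dil k w l' x \<in> ksphere k"
  shows "l = l'"
proof -
  have "real CARD('a) powr (- real_of_int l) = real CARD('a) powr (- real_of_int l')"
    using qnorm_eq[OF k w s(1)] qnorm_eq[OF k w s(2)] by simp
  then show ?thesis using card_gt_1[where 'a = 'a] by (subst (asm) powr_inj) auto
qed

lemma direction_in_iff:
  assumes k: "1 \<le> k" and w: "\<And>i. i \<in> {1..k} \<Longrightarrow> 0 < w i"
  shows "direction_in k w x C \<longleftrightarrow> (\<exists>l. dil k w l x \<in> ksphere k \<inter> C)"
proof
  assume "direction_in k w x C"
  then obtain z where z: "range (\<lambda>l. dil k w l x) \<inter> ksphere k = {z}" "z \<in> C"
    unfolding direction_in_def dilation_orbit_eq by blast
  then have "z \<in> range (\<lambda>l. dil k w l x)" "z \<in> ksphere k" by blast+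
  with z(2) show "\<exists>l. dil k w l x \<in> ksphere k \<inter> C" by auto
next
  assume "\<exists>l. dil k w l x \<in> ksphere k \<inter> C"
  then obtain l where l: "dil k w l x \<in> ksphere k" "dil k w l x \<in> C" by blast
  have "range (\<lambda>l. dil k w l x) \<inter> ksphere k = {dil k w l x}"
  proof (intro equalityI subsetI)
    fix z assume "z \<in> range (\<lambda>l. dil k w l x) \<inter> ksphere k"
    then obtain l' where l': "z = dil k w l' x" "dil k w l' x \<in> ksphere k" by auto
    have "l = l'" by (rule dil_sphere_unique[OF k w l(1) l'(2)])
    then show "z \<in> {dil k w l x}" using l' by simp
  qed (use l in auto)
  then show "direction_in k w x C"
    unfolding direction_in_def dilation_orbit_eq using l(2) by (intro exI[of _ "dil k w l x"] conjI)
qed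

text \<open>
  The existence of both projections forces \<open>x\<close> and \<open>y\<close> to have quasinorms in \<open>q\<close>-powers with integer
  exponents, so the counting region splits into shells \<open>|y| = q^s\<close>; dilation moves each shell to a
  fixed target for \<open>x\<close>.\<close>

definition target :: "nat \<Rightarrow> (nat \<Rightarrow> nat) \<Rightarrow> real \<Rightarrow> (nat \<Rightarrow> 'a::{field,finite} fls) set \<Rightarrow> (nat \<Rightarrow> 'a fls) set" where
  "target m a R C1 = {z \<in> kvec m. \<exists>u::int. real_of_int u < R \<and> dil m a (- u) z \<in> ksphere m \<inter> C1}"

lemma region_iff:
  fixes x y :: "nat \<Rightarrow> 'a::{field,finite} fls"
  assumes m: "1 \<le> m" and n: "1 \<le> n"
    and a: "\<And>i. i \<in> {1..m} \<Longrightarrow> 0 < a i" and b: "\<And>i. i \<in> {1..n} \<Longrightarrow> 0 < b i"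
  shows "(qnorm m a x < real CARD('a) powr R / qnorm n b y \<and> 1 \<le> qnorm n b y \<and> qnorm n b y \<le> real CARD('a) powr T
      \<and> direction_in m a x C1 \<and> direction_in n b y C2)
    \<longleftrightarrow> (\<exists>s::nat. real s \<le> T \<and> dil n b (- int s) y \<in> ksphere n \<inter> C2 \<and> dil m a (int s) x \<in> target m a R C1)"
    (is "?L \<longleftrightarrow> ?R")
proof
  let ?q = "real CARD('a)"
  have q: "1 < ?q" by (rule card_gt_1)
  {
    assume ?L
    then obtain l l' where l: "dil n b l y \<in> ksphere n \<inter> C2" and l': "dil m a l' x \<in> ksphere m \<inter> C1"
      using direction_in_iff[of m a, OF m a] direction_in_iff[of n b, OF n b] by blast
    have qy: "qnorm n b y = ?q powr (- real_of_int l)" using qnorm_eq[of n b, OF n b] l by blast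
    have qx: "qnorm m a x = ?q powr (- real_of_int l')" using qnorm_eq[of m a, OF m a] l' by blast
    have "?q powr 0 \<le> ?q powr (- real_of_int l)" using \<open>?L\<close> qy q by simp
    then have l0: "l \<le> 0" using q by (subst (asm) powr_le_cancel_iff) auto
    define s where "s = nat (- l)"
    have s: "l = - int s" using l0 by (simp add: s_def)
    have "?q powr real s \<le> ?q powr T" using \<open>?L\<close> qy by (simp add: s)
    then have sT: "real s \<le> T" using q by (subst (asm) powr_le_cancel_iff) auto
    have "?q powr (- real_of_int l') < ?q powr (R - real s)"
      using \<open>?L\<close> qx qy by (simp add: s powr_diff)
    then have lR: "- real_of_int l' < R - real s" using q by (subst (asm) powr_less_cancel_iff) auto
    have "dil m a (- (int s - l')) (dil m a (int s) x) = dil m a l' x" by (simp add: dil_dil)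
    then have "dil m a (int s) x \<in> target m a R C1"
      unfolding target_def using l' lR by (auto intro!: exI[of _ "int s - l'"])
    then show ?R using l sT by (auto simp: s)
  }
  {
    assume ?R
    then obtain s u where s: "real s \<le> T" "dil n b (- int s) y \<in> ksphere n \<inter> C2"
      and u: "real_of_int u < R" "dil m a (- u) (dil m a (int s) x) \<in> ksphere m \<inter> C1"
      unfolding target_def by blast
    have qy: "qnorm n b y = ?q powr real s" using qnorm_eq[of n b "- int s" y, OF n b] s by simp
    have qx: "qnorm m a x = ?q powr real_of_int (u - int s)"
      using qnorm_eq[of m a "- u + int s" x, OF m a] u by (simp add: dil_dil)
    have "?q powr real_of_int (u - int s) < ?q powr (R - real s)"
      using u(1) q by (subst powr_less_cancel_iff) auto
    then have "qnorm m a x < ?q powr R / qnorm n b y" by (simp add: qx qy powr_diff)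
    moreover have "1 \<le> qnorm n b y"
      unfolding qy using q by (intro ge_one_powr_ge_zero) auto
    moreover have "qnorm n b y \<le> ?q powr T"
      unfolding qy using q s by (intro powr_mono) auto
    moreover have "direction_in m a x C1" using direction_in_iff[of m a, OF m a] u(2) by (auto simp: dil_dil)
    moreover have "direction_in n b y C2" using direction_in_iff[of n b, OF n b] s(2) by blast
    ultimately show ?L by blast
  }
qed

section \<open>Approximation of the targets\<close>

lemma near_dil:
  assumes "near {1..k} L x y" "\<And>i. i \<in> {1..k} \<Longrightarrow> l + t * int (w i) \<le> L"
  shows "near {1..k} l (dil k w t x) (dil k w t y)"
  unfolding near_def
proof
  fix i assume i: "i \<in> {1..k}"
  have "y i $$ (j + t * int (w i)) = x i $$ (j + t * int (w i))" if "j \<le> l" for j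
    using near_nth[OF assms(1) i, of "j + t * int (w i)"] assms(2)[OF i] that by simp
  then show "dil k w t y i - dil k w t x i \<in> vball l" using i by (simp add: dil_def vball_def)
qed

lemma ksphere_near:
  assumes k: "1 \<le> k" and x: "x \<in> ksphere k" and y: "y \<in> kvec k" and l: "0 \<le> l" "near {1..k} l x y"
  shows "y \<in> ksphere k"
proof -
  have e: "y i $$ j = x i $$ j" if "i \<in> {1..k}" "j \<le> 0" for i j
    using near_nth[OF l(2) that(1), of j] that l(1) by simp
  show ?thesis using x y e unfolding ksphere_iff[OF k] by auto
qed

lemma level_set_ksphere: "1 \<le> k \<Longrightarrow> level_set {1..k} (\<lambda>_. 0) (ksphere k)"
  unfolding level_set_near using ksphere_near[of k _ _ 0] by (auto simp: ksphere_def kvec_def)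

lemma topspace_sphere: "topspace (sphere_topology k) = ksphere k"
  by (auto simp: sphere_topology_def kvec_topology_def ksphere_def kvec_def)

lemma sphere_topology_contains_box:
  assumes T: "openin (sphere_topology k) T" "z \<in> T"
  shows "\<exists>l::nat. \<forall>y\<in>ksphere k. near {1..k} (int l) z y \<longrightarrow> y \<in> T"
proof -
  obtain T' where T': "openin (kvec_topology k) T'" "T = T' \<inter> ksphere k"
    using T(1) by (auto simp: sphere_topology_def openin_subtopology)
  have "z \<in> T'" using T(2) T'(2) by blast
  then obtain W where W: "\<And>i. i \<in> {1..k} \<Longrightarrow> open (W i)" "z \<in> Pi\<^sub>E {1..k} W" "Pi\<^sub>E {1..k} W \<subseteq> T'"
    using T'(1) unfolding kvec_topology_def openin_product_topology_alt by (metis open_openin)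
  have "\<forall>i\<in>{1..k}. \<exists>l\<ge>0. kball (z i) l \<subseteq> W i"
    using W by (intro ballI open_contains_kball_fls) (auto simp: PiE_iff)
  then obtain f where f: "\<And>i. i \<in> {1..k} \<Longrightarrow> 0 \<le> f i \<and> kball (z i) (f i) \<subseteq> W i"
    using bchoice by metis
  define l where "l = (\<Sum>i=1..k. nat (f i))"
  have "y \<in> T" if y: "y \<in> ksphere k" "near {1..k} (int l) z y" for y
  proof -
    have "y i \<in> W i" if i: "i \<in> {1..k}" for i
    proof -
      have "nat (f i) \<le> l" unfolding l_def using i by (intro member_le_sum) auto
      then have "f i \<le> int l" by simp
      then have "y i - z i \<in> vball (f i)" using y(2) i vball_mono unfolding near_def by blast
      then show ?thesis using f[OF i] by (auto simp: kball_def)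
    qed
    then have "y \<in> Pi\<^sub>E {1..k} W" using y(1) by (auto simp: ksphere_def kvec_def PiE_iff)
    then show ?thesis using W(3) T'(2) y(1) by blast
  qed
  then show ?thesis by blast
qed

text \<open>
  The boxes \<open>near\<close> are a neighbourhood base of the sphere topology.\<close>

lemma frontier_ofI_near:
  assumes z: "z \<in> ksphere k"
    and "\<And>l::nat. \<exists>y\<in>ksphere k. y \<in> C \<and> near {1..k} (int l) z y"
    and "\<And>l::nat. \<exists>y\<in>ksphere k. y \<notin> C \<and> near {1..k} (int l) z y"
  shows "z \<in> sphere_topology k frontier_of C"
  unfolding frontier_of_closures in_closure_of topspace_sphere Int_iff
proof (intro conjI allI impI z)
  fix T assume "z \<in> T \<and> openin (sphere_topology k) T"
  then obtain l where "\<forall>y\<in>ksphere k. near {1..k} (int l) z y \<longrightarrow> y \<in> T"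
    using sphere_topology_contains_box by blast
  then show "\<exists>y. y \<in> C \<and> y \<in> T" "\<exists>y. y \<in> ksphere k - C \<and> y \<in> T"
    using assms(2)[of l] assms(3)[of l] by blast+
qed

lemma sphere_frontier_near:
  assumes k: "1 \<le> k" and x: "x \<in> kvec k"
    and 1: "\<And>l::nat. \<exists>y\<in>ksphere k \<inter> C. near {1..k} (int l) x y"
    and 2: "\<And>l::nat. \<exists>y\<in>kvec k. y \<notin> ksphere k \<inter> C \<and> near {1..k} (int l) x y"
  shows "x \<in> sphere_topology k frontier_of C"
proof (rule frontier_ofI_near)
  obtain y where y: "y \<in> ksphere k" "near {1..k} (int 0) x y" using 1[of 0] by blast
  show xs: "x \<in> ksphere k" by (rule ksphere_near[OF k y(1) x _ near_sym[OF y(2)]]) simp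
  show "\<exists>y\<in>ksphere k. y \<in> C \<and> near {1..k} (int l) x y" for l using 1[of l] by blast
  show "\<exists>y\<in>ksphere k. y \<notin> C \<and> near {1..k} (int l) x y" for l
  proof -
    obtain y where y: "y \<in> kvec k" "y \<notin> ksphere k \<inter> C" "near {1..k} (int l) x y" using 2[of l] by blast
    then have "y \<in> ksphere k" using ksphere_near[OF k xs y(1) _ y(3)] by simp
    then show ?thesis using y by blast
  qed
qed

lemma target_bounded:
  assumes m: "1 \<le> m" and z: "z \<in> target m a R C" and i: "i \<in> {1..m}"
    and j: "j \<le> - int (nat \<lceil>max 0 R\<rceil> * (\<Sum>i=1..m. a i) + 1)"
  shows "z i $$ j = 0"
proof -
  obtain u where u: "real_of_int u < R" "dil m a (- u) z \<in> ksphere m"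
    using z by (auto simp: target_def)
  have "u \<le> int (nat \<lceil>max 0 R\<rceil>)" using u(1) by linarith
  then have "u * int (a i) \<le> int (nat \<lceil>max 0 R\<rceil>) * int (a i)" by (intro mult_right_mono) auto
  also have "\<dots> \<le> int (nat \<lceil>max 0 R\<rceil>) * int (\<Sum>i=1..m. a i)"
    using i by (intro mult_left_mono of_nat_mono member_le_sum) auto
  also have "\<dots> = int (nat \<lceil>max 0 R\<rceil> * (\<Sum>i=1..m. a i))" by simp
  finally have "j + u * int (a i) < 0" using j by linarith
  then have "dil m a (- u) z i $$ (j + u * int (a i)) = 0" using u(2) i unfolding ksphere_iff[OF m] by blast
  then show ?thesis using i by (simp add: dil_def)
qed

text \<open>
  Near a nonzero point the exponent of the dilation that leads to the sphere is locally constant.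
  Membership in the target near \<open>x\<close> is therefore membership in \<open>C\<close> near the projection of \<open>x\<close>.\<close>

lemma target_frontier_near:
  assumes m: "1 \<le> m" and a: "\<And>i. i \<in> {1..m} \<Longrightarrow> 0 < a i" and x: "x \<in> kvec m"
    and nz: "i1 \<in> {1..m}" "x i1 \<noteq> 0"
    and 1: "\<And>l::nat. \<exists>y\<in>target m a R C. near {1..m} (int l) x y"
    and 2: "\<And>l::nat. \<exists>y\<in>kvec m. y \<notin> target m a R C \<and> near {1..m} (int l) x y"
  shows "\<exists>u::int. dil m a (- u) x \<in> sphere_topology m frontier_of C"
proof -
  define s where "s = fls_subdegree (x i1)"
  \<comment> \<open>Agreement of the digits up to \<open>l0\<close> determines the leading digit of \<open>x i1\<close>, and it covers the
    shift by any exponent \<open>u\<close> that is possible for a neighbour of \<open>x\<close> in the target.\<close>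
  define l0 where "l0 = nat \<bar>s\<bar> * (\<Sum>i=1..m. a i) + nat \<bar>s\<bar>"
  have l0: "int l0 = \<bar>s\<bar> * int (\<Sum>i=1..m. a i) + \<bar>s\<bar>" by (simp add: l0_def)
  have "0 \<le> \<bar>s\<bar> * int (\<Sum>i=1..m. a i)" by (intro mult_nonneg_nonneg of_nat_0_le_iff) simp
  then have sl0: "s \<le> int l0" unfolding l0 by linarith
  obtain y where y: "y \<in> target m a R C" "near {1..m} (int l0) x y" using 1 by blast
  then obtain u where u: "real_of_int u < R" "dil m a (- u) y \<in> ksphere m" by (auto simp: target_def)
  have "y i1 $$ s = x i1 $$ s" by (rule near_nth[OF y(2) nz(1) sl0])
  then have ys: "y i1 $$ s \<noteq> 0" using nz(2) nth_fls_subdegree_nonzero[OF nz(2)] by (simp add: s_def)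
  have "0 \<le> s + u * int (a i1)"
  proof (rule ccontr)
    assume "\<not> 0 \<le> s + u * int (a i1)"
    then have "dil m a (- u) y i1 $$ (s + u * int (a i1)) = 0"
      using u(2) nz(1) unfolding ksphere_iff[OF m] by auto
    then show False using ys nz(1) by (simp add: dil_def)
  qed
  then have us: "- u \<le> \<bar>s\<bar>"
  proof (cases "0 \<le> u")
    case False
    then have "(- u) * 1 \<le> (- u) * int (a i1)" using a[OF nz(1)] by (intro mult_left_mono) auto
    then show ?thesis using \<open>0 \<le> s + u * int (a i1)\<close> by linarith
  qed simp
  have lev: "l + (- u) * int (a i) \<le> l + int l0" if i: "i \<in> {1..m}" for i l
  proof -
    have "(- u) * int (a i) \<le> \<bar>s\<bar> * int (a i)" using us by (intro mult_right_mono) auto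
    also have "\<dots> \<le> \<bar>s\<bar> * int (\<Sum>i=1..m. a i)"
      using i by (intro mult_left_mono of_nat_mono member_le_sum) auto
    also have "\<dots> \<le> int l0" by (simp add: l0_def)
    finally show ?thesis by simp
  qed
  have xs: "dil m a (- u) x \<in> ksphere m"
    using near_dil[OF near_sym[OF y(2)], of 0 "- u" a] lev[of _ 0]
    by (intro ksphere_near[OF m u(2)]) auto
  have "dil m a (- u) x \<in> sphere_topology m frontier_of C"
  proof (rule frontier_ofI_near[OF xs])
    fix l :: nat
    have nd: "near {1..m} (int l) (dil m a (- u) x) (dil m a (- u) y)" if "near {1..m} (int (l + l0)) x y" for y
      using lev[of _ "int l"] by (intro near_dil[OF that]) auto
    have sph: "dil m a (- u) y \<in> ksphere m" if "near {1..m} (int (l + l0)) x y" for y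
      using nd[OF that] by (intro ksphere_near[OF m xs]) auto
    obtain y where y: "y \<in> target m a R C" "near {1..m} (int (l + l0)) x y" using 1 by blast
    then obtain u' where u': "dil m a (- u') y \<in> ksphere m \<inter> C" by (auto simp: target_def)
    then have "- u' = - u" using sph[OF y(2)] by (intro dil_sphere_unique[OF m, of a]) (use a in auto)
    then show "\<exists>y\<in>ksphere m. y \<in> C \<and> near {1..m} (int l) (dil m a (- u) x) y"
      using u' nd[OF y(2)] by (intro bexI[of _ "dil m a (- u) y"]) auto
    obtain y where y: "y \<in> kvec m" "y \<notin> target m a R C" "near {1..m} (int (l + l0)) x y" using 2 by blast
    have "dil m a (- u) y \<notin> C" using y(1,2) u(1) sph[OF y(3)] by (auto simp: target_def)
    then show "\<exists>y\<in>ksphere m. y \<notin> C \<and> near {1..m} (int l) (dil m a (- u) x) y"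
      using sph[OF y(3)] nd[OF y(3)] by blast
  qed
  then show ?thesis by blast
qed

context haar
begin

lemma vec_measure_eq: "vec_measure lam k = hprod {1..k}"
  by (simp add: vec_measure_def)

lemma null_frontier:
  assumes k: "1 \<le> k" and "F \<in> null_sets (sphere_measure lam k)"
  shows "\<exists>N\<in>null_sets (hprod {1..k}). F \<subseteq> N"
proof -
  have "ksphere k \<in> sets (hprod {1..k})" using level_set_sets[OF _ level_set_ksphere[OF k]] by simp
  then show ?thesis
    using assms(2) null_sets_restrict_space[of "ksphere k" "hprod {1..k}"]
    unfolding sphere_measure_def null_sets_completion_iff2 vec_measure_eq by blast
qed

lemma dil_vimage_sets:
  assumes "B \<in> sets (hprod {1..k})"
  shows "{x \<in> kvec k. dil k w l x \<in> B} \<in> sets (hprod {1..k})"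
proof -
  have "(\<lambda>x. \<lambda>i\<in>{1..k}. fls_shift (l * int (w i)) (x i)) \<in> measurable (hprod {1..k}) (hprod {1..k})"
    by (rule coordinatewise_measurable) simp
  from measurable_sets[OF this assms]
  show ?thesis by (simp add: dil_def kvec_def space_hprod vimage_def Int_def conj_commute)
qed

lemma emeasure_dil_vimage:
  assumes "B \<in> sets (hprod {1..k})"
  shows "emeasure (hprod {1..k}) {x \<in> kvec k. dil k w l x \<in> B}
    = ennreal (q powr (- real_of_int (l * int (\<Sum>i=1..k. w i)))) * emeasure (hprod {1..k}) B"
  using emeasure_hprod_shift[of "{1..k}" B "\<lambda>i. l * int (w i)"] assms
  by (simp add: dil_def kvec_def sum_distrib_left)

lemma emeasure_singleton_0: "emeasure lam {0} = 0"
proof -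
  have "emeasure lam {0} \<le> ennreal ((1/2) ^ k)" for k
  proof -
    have "emeasure lam {0} \<le> emeasure lam (vball (int k))" by (intro emeasure_mono) auto
    also have "\<dots> = ennreal (1 / q ^ k)" by (simp add: emeasure_vball powr_minus powr_realpow inverse_eq_divide)
    also have "\<dots> \<le> ennreal ((1/2) ^ k)"
      using q_ge_2 by (intro ennreal_leI) (simp add: power_one_over divide_simps power_mono)
    finally show ?thesis .
  qed
  moreover have "(\<lambda>k. ennreal ((1/2) ^ k)) \<longlonglongrightarrow> ennreal 0"
    by (intro tendsto_ennrealI LIMSEQ_power_zero) simp
  ultimately have "emeasure lam {0} \<le> ennreal 0" by (intro LIMSEQ_le_const) auto
  then show ?thesis by simp
qed

lemma null_set_zero_vector: "1 \<le> (k::nat) \<Longrightarrow> {\<lambda>i\<in>{1..k}. 0} \<in> null_sets (hprod {1..k})"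
proof -
  assume k: "1 \<le> k"
  have cl: "{0} \<in> sets (borel :: 'a fls measure)" by (intro borel_closed closed_singleton)
  have e: "{\<lambda>i\<in>{1..k}. 0 :: 'a fls} = Pi\<^sub>E {1..k} (\<lambda>_. {0})"
    using PiE_singleton[of "\<lambda>i\<in>{1..k}. 0 :: 'a fls" "{1..k}"] by (auto cong: PiE_cong)
  have "emeasure (hprod {1..k}) (Pi\<^sub>E {1..k} (\<lambda>_. {0})) = 0"
    using k by (subst emeasure_hprod) (auto simp: cl emeasure_singleton_0)
  moreover have "Pi\<^sub>E {1..k} (\<lambda>_. {0}) \<in> sets (hprod {1..k})" by (intro sets_PiM_I_finite) (auto simp: cl)
  ultimately show ?thesis unfolding e by auto
qed

text \<open>
  The exceptional set of \<open>jordan_approximation\<close> consists of the origin and of countably many dilates of the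
  frontier of \<open>C\<close>.\<close>

lemma target_approximation:
  assumes m: "1 \<le> m" and a: "\<And>i. i \<in> {1..m} \<Longrightarrow> 0 < a i"
    and fr: "sphere_topology m frontier_of C \<in> null_sets (sphere_measure lam m)" and \<epsilon>: "0 < \<epsilon>"
  shows "\<exists>l. measure (hprod {1..m}) (outer_approx {1..m} (int l) (target m a R C))
    \<le> measure (hprod {1..m}) (inner_approx {1..m} (int l) (target m a R C)) + \<epsilon>"
proof -
  obtain N where N: "N \<in> null_sets (hprod {1..m})" "sphere_topology m frontier_of C \<subseteq> N"
    using null_frontier[OF m fr] by blast
  define N' where "N' = {\<lambda>i\<in>{1..m}. 0} \<union> (\<Union>u. {x \<in> kvec m. dil m a (- u) x \<in> N})"
  have "{x \<in> kvec m. dil m a (- u) x \<in> N} \<in> null_sets (hprod {1..m})" for u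
    using emeasure_dil_vimage[of N m a "- u"] dil_vimage_sets[of N m a "- u"] N(1)
    by (auto simp: null_sets_def)
  then have N': "N' \<in> null_sets (hprod {1..m})"
    unfolding N'_def using null_set_zero_vector[OF m] by (intro null_sets.Un null_sets_UN) auto
  show ?thesis
  proof (rule jordan_approximation[OF _ _ _ N' _ \<epsilon>])
    show "target m a R C \<subseteq> {1..m} \<rightarrow>\<^sub>E UNIV" by (auto simp: target_def kvec_def)
    show "x i $$ k = 0" if "x \<in> target m a R C" "i \<in> {1..m}" "k \<le> - int (nat \<lceil>max 0 R\<rceil> * (\<Sum>i=1..m. a i) + 1)" for x i k
      using target_bounded[OF m that] .
    fix x :: "nat \<Rightarrow> 'a fls"
    assume x: "x \<in> {1..m} \<rightarrow>\<^sub>E UNIV" and 1: "\<And>l. \<exists>y\<in>target m a R C. near {1..m} (int l) x y"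
      and 2: "\<And>l. \<exists>y\<in>{1..m} \<rightarrow>\<^sub>E UNIV. y \<notin> target m a R C \<and> near {1..m} (int l) x y"
    show "x \<in> N'"
    proof (cases "\<exists>i\<in>{1..m}. x i \<noteq> 0")
      case True
      then obtain i1 where i1: "i1 \<in> {1..m}" "x i1 \<noteq> 0" by blast
      obtain u where "dil m a (- u) x \<in> sphere_topology m frontier_of C"
        using target_frontier_near[OF m, of a x i1 R C] a x i1 1 2 unfolding kvec_def by blast
      then show ?thesis using N(2) x unfolding N'_def kvec_def by blast
    next
      case False
      then have "x = (\<lambda>i\<in>{1..m}. 0)" using x by (auto simp: PiE_iff extensional_def fun_eq_iff)
      then show ?thesis by (simp add: N'_def)
    qed
  qed simp
qed

lemma sphere_approximation:
  assumes k: "1 \<le> k" and fr: "sphere_topology k frontier_of C \<in> null_sets (sphere_measure lam k)" and \<epsilon>: "0 < \<epsilon>"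
  shows "\<exists>l. measure (hprod {1..k}) (outer_approx {1..k} (int l) (ksphere k \<inter> C))
    \<le> measure (hprod {1..k}) (inner_approx {1..k} (int l) (ksphere k \<inter> C)) + \<epsilon>"
proof -
  obtain N where N: "N \<in> null_sets (hprod {1..k})" "sphere_topology k frontier_of C \<subseteq> N"
    using null_frontier[OF k fr] by blast
  show ?thesis
  proof (rule jordan_approximation[OF _ _ _ N(1) _ \<epsilon>])
    show "ksphere k \<inter> C \<subseteq> {1..k} \<rightarrow>\<^sub>E UNIV" by (auto simp: ksphere_def kvec_def)
    show "x i $$ j = 0" if "x \<in> ksphere k \<inter> C" "i \<in> {1..k}" "j \<le> - int 1" for x i j
    proof -
      have "x \<in> ksphere k" using that by blast
      then show ?thesis using that(2,3) unfolding ksphere_iff[OF k] by auto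
    qed
    show "x \<in> N" if "x \<in> {1..k} \<rightarrow>\<^sub>E UNIV" "\<And>l. \<exists>y\<in>ksphere k \<inter> C. near {1..k} (int l) x y"
      "\<And>l. \<exists>y\<in>{1..k} \<rightarrow>\<^sub>E UNIV. y \<notin> ksphere k \<inter> C \<and> near {1..k} (int l) x y" for x
      using sphere_frontier_near[OF k, of x C] that N(2) unfolding kvec_def by blast
  qed simp
qed

end

section \<open>Counting solutions in shells\<close>

text \<open>
  The same vector as \<open>approx_error\<close>, for polynomials instead of their images in \<open>K\<close>.\<close>

definition err :: "nat \<Rightarrow> nat \<Rightarrow> (nat \<times> nat \<Rightarrow> 'a::{field,finite} fls) \<Rightarrow> (nat \<Rightarrow> 'a poly) \<Rightarrow> (nat \<Rightarrow> 'a poly) \<Rightarrow> (nat \<Rightarrow> 'a fls)" where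
  "err m n A p v = (\<lambda>i\<in>{1..m}. rowdot n A v i - emb (p i))"

definition solutions :: "nat \<Rightarrow> nat \<Rightarrow> (nat \<Rightarrow> nat) \<Rightarrow> (nat \<Rightarrow> 'a::{field,finite} fls) set \<Rightarrow> (nat \<Rightarrow> (nat \<Rightarrow> 'a poly) set)
    \<Rightarrow> nat \<Rightarrow> (nat \<times> nat \<Rightarrow> 'a fls) \<Rightarrow> ((nat \<Rightarrow> 'a poly) \<times> (nat \<Rightarrow> 'a poly)) set" where
  "solutions m n a Q V s A = {(p, v). p \<in> {1..m} \<rightarrow>\<^sub>E UNIV \<and> v \<in> V s \<and> dil m a (int s) (err m n A p v) \<in> Q}"

context shells
begin

lemma err_nth_zero:
  assumes "(p, v) \<in> solutions m n a Q V s A" "i \<in> {1..m}" "k \<le> int (s * a i) - int E"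
  shows "err m n A p v i $$ k = 0"
proof -
  have "dil m a (int s) (err m n A p v) i $$ (k - int (s * a i)) = 0"
    using assms Q_bounded by (auto simp: solutions_def)
  then show ?thesis using assms(2) by (simp add: dil_def)
qed

lemma solutions_finite: "finite (solutions m n a Q V s A)"
proof -
  let ?G = "\<lambda>v. \<Pi>\<^sub>E i\<in>{1..m}. (\<lambda>r. ppart (rowdot n A v i) + r) ` polys E"
  have "solutions m n a Q V s A \<subseteq> (\<Union>v\<in>V s. ?G v \<times> {v})"
  proof
    fix x assume x: "x \<in> solutions m n a Q V s A"
    then obtain p v where pv: "x = (p, v)" "p \<in> {1..m} \<rightarrow>\<^sub>E UNIV" "v \<in> V s" by (auto simp: solutions_def)
    have "p i - ppart (rowdot n A v i) \<in> polys E" if i: "i \<in> {1..m}" for i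
    proof -
      have "coeff (p i) j = coeff (ppart (rowdot n A v i)) j" if j: "E \<le> j" for j
      proof -
        have "- int j \<le> int (s * a i) - int E" using j by linarith
        then have "err m n A p v i $$ (- int j) = 0" using err_nth_zero x pv(1) i by blast
        then have "emb (p i) $$ (- int j) = rowdot n A v i $$ (- int j)" using i by (simp add: err_def)
        also have "\<dots> = emb (ppart (rowdot n A v i)) $$ (- int j)"
          using fpart_nth[of "rowdot n A v i" "- int j"] by (simp add: fpart_def)
        finally show ?thesis by (simp add: emb_nth)
      qed
      then show ?thesis by (simp add: polys_def)
    qed
    then have "p i \<in> (\<lambda>r. ppart (rowdot n A v i) + r) ` polys E" if "i \<in> {1..m}" for i
      using that by (intro image_eqI[of _ _ "p i - ppart (rowdot n A v i)"]) auto
    then have "p \<in> ?G v" using pv(2) by (auto simp: PiE_iff)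
    then show "x \<in> (\<Union>v\<in>V s. ?G v \<times> {v})" using pv by auto
  qed
  moreover have "finite (\<Union>v\<in>V s. ?G v \<times> {v})"
    by (intro finite_UN_I V_finite finite_cartesian_product finite_PiE finite_imageI polys_card) auto
  ultimately show ?thesis by (rule finite_subset)
qed

text \<open>
  From shell \<open>E + 1\<close> on, \<open>A v - p\<close> lies in the unit cube, which determines \<open>p\<close> as the polynomial part of
  \<open>A v\<close>.\<close>

lemma solutions_card:
  assumes s: "E < s"
  shows "card (solutions m n a Q V s A) = card {v \<in> V s. hit s v A}"
proof -
  let ?f = "\<lambda>v. (\<lambda>i\<in>{1..m}. ppart (rowdot n A v i), v)"
  have f: "dil m a (int s) (err m n A (\<lambda>i\<in>{1..m}. ppart (rowdot n A v i)) v)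
      = (\<lambda>i\<in>{1..m}. fls_shift (int (s * a i)) (fpart (rowdot n A v i)))" for v
    unfolding dil_def err_def by (rule restrict_ext) (simp add: fpart_def)
  have "solutions m n a Q V s A = ?f ` {v \<in> V s. hit s v A}"
  proof (intro equalityI subsetI)
    fix x assume x: "x \<in> solutions m n a Q V s A"
    then obtain p v where pv: "x = (p, v)" "p \<in> {1..m} \<rightarrow>\<^sub>E UNIV" "v \<in> V s"
      "dil m a (int s) (err m n A p v) \<in> Q" by (auto simp: solutions_def)
    have "p i = ppart (rowdot n A v i)" if i: "i \<in> {1..m}" for i
    proof -
      have "int s * 1 \<le> int s * int (a i)" using a_pos[OF i] by (intro mult_left_mono) auto
      then have "int s \<le> int (s * a i)" by (simp only: of_nat_mult mult_1_right)
      then have "0 \<le> int (s * a i) - int E" using s by linarith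
      then have "err m n A p v i \<in> vball 0"
        using err_nth_zero[of p v s A i] x pv(1) i unfolding vball_def by auto
      then have "fpart (rowdot n A v i) = err m n A p v i"
        using i by (intro fpart_eqI[of _ _ "p i"]) (auto simp: err_def)
      then have "emb (ppart (rowdot n A v i)) = emb (p i)" using i by (simp add: fpart_def err_def)
      then show ?thesis by simp
    qed
    then have p: "p = (\<lambda>i\<in>{1..m}. ppart (rowdot n A v i))"
      using pv(2) by (auto simp: PiE_iff extensional_def fun_eq_iff)
    have "hit s v A" using pv(4) unfolding p f hit_def .
    then show "x \<in> ?f ` {v \<in> V s. hit s v A}" using pv(1,3) p by blast
  next
    fix x assume "x \<in> ?f ` {v \<in> V s. hit s v A}"
    then obtain v where v: "x = ?f v" "v \<in> V s" "hit s v A" by blast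
    then show "x \<in> solutions m n a Q V s A"
      using f[of v] unfolding hit_def by (auto simp: solutions_def)
  qed
  moreover have "inj_on ?f {v \<in> V s. hit s v A}" by (auto simp: inj_on_def)
  ultimately show ?thesis by (simp only: card_image)
qed

text \<open>
  The finitely many shells up to \<open>E\<close> contribute a bounded amount, which disappears in the average.\<close>

lemma solutions_law:
  assumes \<kappa>: "\<And>s. s1 \<le> s \<Longrightarrow> real (card (V s)) * \<mu> s = \<kappa>"
  shows "AE A in mats. (\<lambda>N. (\<Sum>s<N. real (card (solutions m n a Q V s A))) / real N) \<longlonglongrightarrow> \<kappa>"
  using hits_law
proof eventually_elim
  case (elim A)
  define N1 where "N1 = max s1 (Suc E)"
  define c where "c = mean N1 - real N1 * \<kappa>"
  define d where "d = (\<Sum>s<Suc E. real (card (solutions m n a Q V s A)))"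
  have mean: "mean N = c + real N * \<kappa>" if "N1 \<le> N" for N
  proof -
    have "mean N = mean N1 + (\<Sum>s\<in>{N1..<N}. real (card (V s)) * \<mu> s)"
      unfolding mean_def using that by (subst sum.atLeastLessThan_concat) (auto simp: N1_def)
    also have "(\<Sum>s\<in>{N1..<N}. real (card (V s)) * \<mu> s) = (\<Sum>s\<in>{N1..<N}. \<kappa>)"
      by (intro sum.cong refl \<kappa>) (auto simp: N1_def)
    also have "\<dots> = (real N - real N1) * \<kappa>" using that by (simp add: of_nat_diff)
    finally show ?thesis by (simp add: c_def algebra_simps)
  qed
  have tot: "(\<Sum>s<N. real (card (solutions m n a Q V s A))) = d + hitcount N A" if "N1 \<le> N" for N
  proof -
    have "(\<Sum>s<N. real (card (solutions m n a Q V s A))) = (\<Sum>s\<in>{0..<N}. real (card (solutions m n a Q V s A)))"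
      by (simp only: atLeast0LessThan)
    also have "\<dots> = (\<Sum>s\<in>{0..<Suc E}. real (card (solutions m n a Q V s A))) + (\<Sum>s\<in>{Suc E..<N}. real (card (solutions m n a Q V s A)))"
      using that by (subst sum.atLeastLessThan_concat) (auto simp: N1_def)
    also have "(\<Sum>s\<in>{Suc E..<N}. real (card (solutions m n a Q V s A))) = hitcount N A"
      unfolding hitcount_def by (intro sum.cong refl) (simp add: solutions_card)
    finally show ?thesis by (simp only: d_def atLeast0LessThan)
  qed
  have "(\<lambda>N. (hitcount N A - mean N) / real N + (c + d) * (1 / real N) + \<kappa>) \<longlonglongrightarrow> 0 + (c + d) * 0 + \<kappa>"
    by (intro tendsto_intros elim lim_1_over_n)
  moreover have "eventually (\<lambda>N. (hitcount N A - mean N) / real N + (c + d) * (1 / real N) + \<kappa>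
      = (\<Sum>s<N. real (card (solutions m n a Q V s A))) / real N) sequentially"
    using eventually_ge_at_top[of N1]
  proof eventually_elim
    case (elim N)
    have "0 < real N" using elim by (simp add: N1_def)
    then show ?case by (simp add: tot[OF elim] mean[OF elim] field_simps)
  qed
  ultimately show ?case using Lim_transform_eventually by fastforce
qed

end

definition shell_vectors :: "nat \<Rightarrow> (nat \<Rightarrow> nat) \<Rightarrow> (nat \<Rightarrow> 'a::{field,finite} fls) set \<Rightarrow> nat \<Rightarrow> (nat \<Rightarrow> 'a poly) set" where
  "shell_vectors n b B s = {v \<in> {1..n} \<rightarrow>\<^sub>E UNIV. dil n b (- int s) (\<lambda>j\<in>{1..n}. emb (v j)) \<in> B}"

lemma shell_vectors_degree:
  assumes n: "1 \<le> n" and B: "B \<subseteq> ksphere n" and v: "v \<in> shell_vectors n b B s"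
  shows "j \<in> {1..n} \<Longrightarrow> v j = 0 \<or> degree (v j) \<le> s * b j"
    and "\<exists>j\<in>{1..n}. v j \<noteq> 0 \<and> degree (v j) = s * b j"
proof -
  let ?y = "dil n b (- int s) (\<lambda>j\<in>{1..n}. emb (v j))"
  have y: "?y \<in> ksphere n" using v B by (auto simp: shell_vectors_def)
  have yj: "?y j $$ k = emb (v j) $$ (k - int (s * b j))" if "j \<in> {1..n}" for j k
    using that by (simp add: dil_def)
  have le: "degree (v j) \<le> s * b j" if j: "j \<in> {1..n}" for j
  proof (rule degree_le, intro allI impI)
    fix i assume i: "s * b j < i"
    have "int (s * b j) - int i < 0" using i by (simp only: of_nat_less_iff diff_less_0_iff_less)
    then have "?y j $$ (int (s * b j) - int i) = 0" using y j unfolding ksphere_iff[OF n] by blast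
    then show "coeff (v j) i = 0" unfolding yj[OF j] by (simp add: emb_nth)
  qed
  then show "j \<in> {1..n} \<Longrightarrow> v j = 0 \<or> degree (v j) \<le> s * b j" by blast
  obtain j where j: "j \<in> {1..n}" "?y j $$ 0 \<noteq> 0" using y unfolding ksphere_iff[OF n] by blast
  have "coeff (v j) (s * b j) \<noteq> 0"
  proof -
    have "emb (v j) $$ (0 - int (s * b j)) \<noteq> 0" using j(2) unfolding yj[OF j(1)] .
    then show ?thesis by (simp add: emb_nth nat_mult_distrib)
  qed
  then have "v j \<noteq> 0" "s * b j \<le> degree (v j)" by (auto intro: le_degree)
  then show "\<exists>j\<in>{1..n}. v j \<noteq> 0 \<and> degree (v j) = s * b j" using le[OF j(1)] j(1) by (intro bexI[of _ j]) auto
qed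

context haar
begin

text \<open>
  For \<open>s \<ge> l\<close> the dilated set is a union of translates of the unit cube, so its lattice points are counted
  by its volume.\<close>

lemma shell_vectors_card:
  assumes b: "\<And>j. j \<in> {1..n} \<Longrightarrow> 0 < b j" and B: "level_set {1..n} (\<lambda>_. int l) B"
    and fin: "finite (shell_vectors n b B s)" and s: "l \<le> s"
  shows "real (card (shell_vectors n b B s)) = q powr real (s * (\<Sum>j=1..n. b j)) * measure (hprod {1..n}) B"
proof -
  define D where "D = {y \<in> kvec n. dil n b (- int s) y \<in> B}"
  have "level_set {1..n} (\<lambda>_. 0) D"
    unfolding level_set_near
  proof (intro conjI ballI impI)
    fix x y assume x: "x \<in> D" and y: "y \<in> {1..n} \<rightarrow>\<^sub>E (UNIV :: 'a fls set)" and nr: "near {1..n} 0 x y"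
    have "near {1..n} (int l) (dil n b (- int s) x) (dil n b (- int s) y)"
    proof (rule near_dil[OF nr])
      fix j assume "j \<in> {1..n}"
      then have "int s * 1 \<le> int s * int (b j)" using b by (intro mult_left_mono) (auto simp: Suc_leI)
      then show "int l + - int s * int (b j) \<le> 0" using s by simp
    qed
    then have "dil n b (- int s) y \<in> B"
      using B x dil_kvec[of n b "- int s" y] unfolding level_set_near D_def kvec_def by blast
    then show "y \<in> D" using y by (simp add: D_def kvec_def)
  qed (auto simp: D_def kvec_def)
  moreover have e: "{z \<in> {1..n} \<rightarrow>\<^sub>E UNIV. (\<lambda>j\<in>{1..n}. emb (z j)) \<in> D} = shell_vectors n b B s"
    by (auto simp: D_def shell_vectors_def kvec_def)
  ultimately have "emeasure (hprod {1..n}) D = of_nat (card (shell_vectors n b B s))"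
    using emeasure_eq_card_lattice[of "{1..n}" D] fin by simp
  then have "real (card (shell_vectors n b B s)) = measure (hprod {1..n}) D"
    by (simp add: measure_def)
  also have "\<dots> = q powr real (s * (\<Sum>j=1..n. b j)) * measure (hprod {1..n}) B"
    using emeasure_dil_vimage[of B n b "- int s"] level_set_sets[OF _ B]
    by (simp add: D_def measure_def enn2real_mult)
  finally show ?thesis .
qed

lemma shell_solutions_law:
  assumes m: "1 \<le> m" and n: "1 \<le> n"
    and a: "\<And>i. i \<in> {1..m} \<Longrightarrow> 0 < a i" and b: "\<And>j. j \<in> {1..n} \<Longrightarrow> 0 < b j"
    and ab: "(\<Sum>i=1..m. a i) = (\<Sum>j=1..n. b j)"
    and Q: "level_set {1..m} (\<lambda>_. int e) Q"
    and Q_bd: "\<And>x i k. x \<in> Q \<Longrightarrow> i \<in> {1..m} \<Longrightarrow> k \<le> - int E \<Longrightarrow> x i $$ k = 0"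
    and B: "B \<subseteq> ksphere n" "level_set {1..n} (\<lambda>_. int l) B"
  shows "AE A in hprod ({1..m} \<times> {1..n}).
      (\<lambda>N. (\<Sum>s<N. real (card (solutions m n a Q (shell_vectors n b B) s A))) / real N)
        \<longlonglongrightarrow> measure (hprod {1..m}) Q * measure (hprod {1..n}) B"
    and "finite (solutions m n a Q (shell_vectors n b B) s A)"
proof -
  interpret sh: shells lam m n a b E e Q "shell_vectors n b B"
  proof
    show "v \<in> {1..n} \<rightarrow>\<^sub>E UNIV" if "v \<in> shell_vectors n b B s" for s v
      using that by (simp add: shell_vectors_def)
  qed (use assms shell_vectors_degree[OF n B(1)] in auto)
  show "finite (solutions m n a Q (shell_vectors n b B) s A)" by (rule sh.solutions_finite)
  show "AE A in hprod ({1..m} \<times> {1..n}).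
      (\<lambda>N. (\<Sum>s<N. real (card (solutions m n a Q (shell_vectors n b B) s A))) / real N)
        \<longlonglongrightarrow> measure (hprod {1..m}) Q * measure (hprod {1..n}) B"
  proof (rule sh.solutions_law[where ?s1.0 = "max l E"])
    fix s assume s: "max l E \<le> s"
    have "real (card (shell_vectors n b B s)) * sh.\<mu> s
        = (q powr real (s * (\<Sum>i=1..m. a i)) * q powr (- real (s * (\<Sum>i=1..m. a i)))) * (measure (hprod {1..m}) Q * measure (hprod {1..n}) B)"
    proof -
      have "sh.\<mu> s = q powr (- real (s * (\<Sum>i=1..m. a i))) * measure (hprod {1..m}) Q"
        using s by (intro sh.\<mu>_eq) simp
      moreover have "real (card (shell_vectors n b B s)) = q powr real (s * (\<Sum>i=1..m. a i)) * measure (hprod {1..n}) B"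
        unfolding ab using s by (intro shell_vectors_card[of n b l B s, OF b B(2) sh.V_finite]) auto
      ultimately show ?thesis by (simp only: mult_ac)
    qed
    then show "real (card (shell_vectors n b B s)) * sh.\<mu> s = measure (hprod {1..m}) Q * measure (hprod {1..n}) B"
      by (simp only: powr_add[symmetric]) simp
  qed
qed

end

section \<open>Comparison of the count with the volume\<close>

lemma real_le_iff_less_floor: "0 \<le> T \<Longrightarrow> real s \<le> T \<longleftrightarrow> s < nat \<lfloor>T\<rfloor> + 1"
  by (auto simp: le_nat_iff le_floor_iff less_Suc_eq_le)

lemma shell_vectors_disjoint:
  assumes n: "1 \<le> n" and b: "\<And>j. j \<in> {1..n} \<Longrightarrow> 0 < b j" and B: "B \<subseteq> ksphere n"
    and v: "v \<in> shell_vectors n b B s" "v \<in> shell_vectors n b B s'"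
  shows "s = s'"
proof -
  have "dil n b (- int s) (\<lambda>j\<in>{1..n}. emb (v j)) \<in> ksphere n" "dil n b (- int s') (\<lambda>j\<in>{1..n}. emb (v j)) \<in> ksphere n"
    using v B by (auto simp: shell_vectors_def)
  from dil_sphere_unique[of n b, OF n b this] show ?thesis by simp
qed

lemma card_solutions_shells:
  assumes n: "1 \<le> n" and b: "\<And>j. j \<in> {1..n} \<Longrightarrow> 0 < b j" and B: "B \<subseteq> ksphere n"
    and fin: "\<And>s. finite (solutions m n a Q (shell_vectors n b B) s A)"
  shows "card (\<Union>s<N. solutions m n a Q (shell_vectors n b B) s A)
    = (\<Sum>s<N. card (solutions m n a Q (shell_vectors n b B) s A))"
proof (rule card_UN_disjoint)
  show "\<forall>s\<in>{..<N}. \<forall>s'\<in>{..<N}. s \<noteq> s' \<longrightarrow>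
      solutions m n a Q (shell_vectors n b B) s A \<inter> solutions m n a Q (shell_vectors n b B) s' A = {}"
    using shell_vectors_disjoint[of n b, OF n b B] by (fastforce simp: solutions_def)
qed (use fin in auto)

lemma N_count_eq:
  fixes A :: "nat \<times> nat \<Rightarrow> 'a::{field,finite} fls" and C1 C2 :: "(nat \<Rightarrow> 'a fls) set" and R :: real
  assumes m: "1 \<le> m" and n: "1 \<le> n"
    and a: "\<And>i. i \<in> {1..m} \<Longrightarrow> 0 < a i" and b: "\<And>j. j \<in> {1..n} \<Longrightarrow> 0 < a (m + j)"
    and T: "0 \<le> T"
  defines "Sol \<equiv> solutions m n a (target m a R C1) (shell_vectors n (\<lambda>j. a (m + j)) (ksphere n \<inter> C2))"
  assumes fin: "\<And>s. finite (Sol s A)"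
  shows "N_count m n a R T A C1 C2 = (\<Sum>s<nat \<lfloor>T\<rfloor> + 1. card (Sol s A))"
proof -
  let ?b = "\<lambda>j. a (m + j)"
  define \<Phi> where "\<Phi> = (\<lambda>(p, v). ((\<lambda>i\<in>{1..m}. emb (p i)) :: nat \<Rightarrow> 'a fls, (\<lambda>j\<in>{1..n}. emb (v j)) :: nat \<Rightarrow> 'a fls))"
  define W where "W = (\<Union>s<nat \<lfloor>T\<rfloor> + 1. Sol s A)"
  define X where "X = {(p, v) \<in> ({1..m} \<rightarrow>\<^sub>E polyZ) \<times> ({1..n} \<rightarrow>\<^sub>E polyZ).
        \<not> ((\<forall>i\<in>{1..m}. p i = 0) \<and> (\<forall>j\<in>{1..n}. v j = 0)) \<and>
        qnorm m a (approx_error m n A p v)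
          < real CARD('a) powr R / qnorm n ?b v \<and>
        1 \<le> qnorm n ?b v \<and> qnorm n ?b v \<le> real CARD('a) powr T \<and>
        direction_in m a (approx_error m n A p v) C1 \<and> direction_in n ?b v C2}"
  have err: "approx_error m n A (\<lambda>i\<in>{1..m}. emb (p i)) (\<lambda>j\<in>{1..n}. emb (v j)) = err m n A p v" for p v
    unfolding approx_error_def err_def rowdot_def dotp_def by (rule restrict_ext) simp
  have inj: "inj_on \<Phi> (({1..m} \<rightarrow>\<^sub>E UNIV) \<times> ({1..n} \<rightarrow>\<^sub>E UNIV))"
  proof -
    have ext: "p = p'" if "p \<in> I \<rightarrow>\<^sub>E UNIV" "p' \<in> I \<rightarrow>\<^sub>E UNIV" "(\<lambda>i\<in>I. emb (p i)) = (\<lambda>i\<in>I. emb (p' i))" for I and p p' :: "nat \<Rightarrow> 'a poly"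
    proof (rule PiE_ext[OF that(1,2)])
      fix i assume "i \<in> I"
      then have "emb (p i) = emb (p' i)" using fun_cong[OF that(3), of i] by simp
      then show "p i = p' i" by simp
    qed
    show ?thesis
    proof (rule inj_onI)
      fix x y assume "x \<in> ({1..m} \<rightarrow>\<^sub>E UNIV) \<times> ({1..n} \<rightarrow>\<^sub>E UNIV)" "y \<in> ({1..m} \<rightarrow>\<^sub>E UNIV) \<times> ({1..n} \<rightarrow>\<^sub>E UNIV)" "\<Phi> x = \<Phi> y"
      then show "x = y"
        using ext[of "fst x" "{1..m}" "fst y"] ext[of "snd x" "{1..n}" "snd y"]
        by (cases x; cases y) (auto simp: \<Phi>_def)
    qed
  qed
  have W_sub: "W \<subseteq> ({1..m} \<rightarrow>\<^sub>E UNIV) \<times> ({1..n} \<rightarrow>\<^sub>E UNIV)"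
    unfolding W_def Sol_def solutions_def shell_vectors_def by blast
  have W_iff: "(p, v) \<in> W \<longleftrightarrow> p \<in> {1..m} \<rightarrow>\<^sub>E UNIV \<and> v \<in> {1..n} \<rightarrow>\<^sub>E UNIV \<and>
      (\<exists>s::nat. real s \<le> T \<and> dil n ?b (- int s) (\<lambda>j\<in>{1..n}. emb (v j)) \<in> ksphere n \<inter> C2
        \<and> dil m a (int s) (err m n A p v) \<in> target m a R C1)" for p v
    unfolding W_def Sol_def solutions_def shell_vectors_def real_le_iff_less_floor[OF T] by blast
  have reg: "(\<exists>s::nat. real s \<le> T \<and> dil n ?b (- int s) y \<in> ksphere n \<inter> C2 \<and> dil m a (int s) x \<in> target m a R C1)
      \<longleftrightarrow> (qnorm m a x < real CARD('a) powr R / qnorm n ?b y \<and> 1 \<le> qnorm n ?b y \<and> qnorm n ?b y \<le> real CARD('a) powr T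
      \<and> direction_in m a x C1 \<and> direction_in n ?b y C2)" for x y :: "nat \<Rightarrow> 'a fls"
    by (rule region_iff[symmetric]) (use m n a b in auto)
  have "\<Phi> ` W = X"
  proof (intro equalityI subsetI)
    fix x assume "x \<in> \<Phi> ` W"
    then obtain p v where x: "x = \<Phi> (p, v)" and W: "(p, v) \<in> W" by auto
    let ?p = "\<lambda>i\<in>{1..m}. emb (p i)" and ?v = "\<lambda>j\<in>{1..n}. emb (v j)"
    have R: "\<exists>s::nat. real s \<le> T \<and> dil n ?b (- int s) ?v \<in> ksphere n \<inter> C2
        \<and> dil m a (int s) (approx_error m n A ?p ?v) \<in> target m a R C1"
      using W unfolding W_iff err by blast
    then obtain s where "dil n ?b (- int s) ?v \<in> ksphere n" by blast
    then obtain j where j: "j \<in> {1..n}" "dil n ?b (- int s) ?v j $$ 0 \<noteq> 0" unfolding ksphere_iff[OF n] by blast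
    have "?v j \<noteq> 0"
    proof
      assume "?v j = 0"
      then have "dil n ?b (- int s) ?v j = 0" using j(1) by (simp only: dil_def restrict_apply' fls_shift_zero)
      then show False using j(2) by simp
    qed
    with j(1) have nz: "\<exists>j\<in>{1..n}. ?v j \<noteq> 0" by blast
    have "?p \<in> {1..m} \<rightarrow>\<^sub>E polyZ" "?v \<in> {1..n} \<rightarrow>\<^sub>E polyZ" by (auto simp: polyZ_eq)
    then show "x \<in> X"
      using nz R[unfolded reg] by (simp add: x X_def \<Phi>_def)
  next
    fix x assume x: "x \<in> X"
    then obtain p v where pv: "x = (p, v)" "p \<in> {1..m} \<rightarrow>\<^sub>E polyZ" "v \<in> {1..n} \<rightarrow>\<^sub>E polyZ" by (auto simp: X_def)
    define p' v' where "p' = (\<lambda>i\<in>{1..m}. inv_into UNIV emb (p i))" and "v' = (\<lambda>j\<in>{1..n}. inv_into UNIV emb (v j))"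
    have p: "(\<lambda>i\<in>{1..m}. emb (p' i)) = p"
      by (rule PiE_ext[OF _ pv(2)]) (use pv(2) in \<open>auto simp: p'_def polyZ_eq f_inv_into_f PiE_iff\<close>)
    have v: "(\<lambda>i\<in>{1..n}. emb (v' i)) = v"
      by (rule PiE_ext[OF _ pv(3)]) (use pv(3) in \<open>auto simp: v'_def polyZ_eq f_inv_into_f PiE_iff\<close>)
    have "\<exists>s::nat. real s \<le> T \<and> dil n ?b (- int s) v \<in> ksphere n \<inter> C2
        \<and> dil m a (int s) (approx_error m n A p v) \<in> target m a R C1"
      unfolding reg using x by (auto simp: X_def pv(1))
    then have "(p', v') \<in> W"
      unfolding W_iff err[symmetric] p v by (simp add: p'_def v'_def)
    moreover have "x = \<Phi> (p', v')" by (simp only: \<Phi>_def pv(1) p v prod.case)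
    ultimately show "x \<in> \<Phi> ` W" by blast
  qed
  then have "card X = card W" using card_image[OF inj_on_subset[OF inj W_sub]] by simp
  moreover have "card W = (\<Sum>s<nat \<lfloor>T\<rfloor> + 1. card (Sol s A))"
    using fin unfolding W_def Sol_def by (intro card_solutions_shells[of n ?b, OF n b]) auto
  ultimately show ?thesis by (simp only: N_count_def X_def)
qed

definition region :: "nat \<Rightarrow> nat \<Rightarrow> (nat \<Rightarrow> nat) \<Rightarrow> (nat \<Rightarrow> nat) \<Rightarrow> (nat \<Rightarrow> 'a::{field,finite} fls) set \<Rightarrow> (nat \<Rightarrow> 'a fls) set
    \<Rightarrow> real \<Rightarrow> ((nat \<Rightarrow> 'a fls) \<times> (nat \<Rightarrow> 'a fls)) set" where
  "region m n a b Q B T = {(x, y) \<in> kvec m \<times> kvec n. \<exists>s::nat. real s \<le> T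
     \<and> dil n b (- int s) y \<in> B \<and> dil m a (int s) x \<in> Q}"

lemma region_mono: "Q \<subseteq> Q' \<Longrightarrow> B \<subseteq> B' \<Longrightarrow> region m n a b Q B T \<subseteq> region m n a b Q' B' T"
  unfolding region_def by blast

lemma E_set_eq:
  assumes "1 \<le> m" "1 \<le> n" "\<And>i. i \<in> {1..m} \<Longrightarrow> 0 < a i" "\<And>j. j \<in> {1..n} \<Longrightarrow> 0 < a (m + j)"
  shows "E_set m n a T R C1 C2 = region m n a (\<lambda>j. a (m + j)) (target m a R C1) (ksphere n \<inter> C2) T"
proof -
  note * = region_iff[of m n a "\<lambda>j. a (m + j)", OF assms, where R = R and T = T and ?C1.0 = C1 and ?C2.0 = C2]
  show ?thesis unfolding E_set_def region_def by (simp only: *)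
qed

context haar
begin

text \<open>
  The dilations act on \<open>x\<close> and \<open>y\<close> in opposite directions, and since the weight sums agree each shell has
  the volume of \<open>Q \<times> B\<close>.\<close>

lemma region_measure:
  assumes n: "1 \<le> n" and b: "\<And>j. j \<in> {1..n} \<Longrightarrow> 0 < b j" and ab: "(\<Sum>i=1..m. a i) = (\<Sum>j=1..n. b j)"
    and Q: "Q \<in> sets (hprod {1..m})" "emeasure (hprod {1..m}) Q \<noteq> \<infinity>"
    and B: "B \<in> sets (hprod {1..n})" "emeasure (hprod {1..n}) B \<noteq> \<infinity>" "B \<subseteq> ksphere n"
    and T: "0 \<le> T"
  shows "region m n a b Q B T \<in> sets (hprod {1..m} \<Otimes>\<^sub>M hprod {1..n})"
    and "emeasure (hprod {1..m} \<Otimes>\<^sub>M hprod {1..n}) (region m n a b Q B T)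
      = ennreal (real (nat \<lfloor>T\<rfloor> + 1) * (measure (hprod {1..m}) Q * measure (hprod {1..n}) B))"
proof -
  let ?M = "hprod {1..m} \<Otimes>\<^sub>M hprod {1..n}" and ?N = "nat \<lfloor>T\<rfloor> + 1"
  define X where "X = (\<lambda>s::nat. {x \<in> kvec m. dil m a (int s) x \<in> Q})"
  define Y where "Y = (\<lambda>s::nat. {y \<in> kvec n. dil n b (- int s) y \<in> B})"
  have XY: "X s \<in> sets (hprod {1..m})" "Y s \<in> sets (hprod {1..n})" for s
    unfolding X_def Y_def by (rule dil_vimage_sets[OF Q(1)], rule dil_vimage_sets[OF B(1)])
  have reg: "region m n a b Q B T = (\<Union>s<?N. X s \<times> Y s)"
    unfolding region_def X_def Y_def real_le_iff_less_floor[OF T] by blast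
  have XYs: "X s \<times> Y s \<in> sets ?M" for s using XY by auto
  show "region m n a b Q B T \<in> sets ?M" unfolding reg using XYs by auto
  have "disjoint_family_on (\<lambda>s. X s \<times> Y s) {..<?N}"
    unfolding disjoint_family_on_def
  proof (intro ballI impI, rule ccontr)
    fix s s' assume "s \<noteq> s'" "X s \<times> Y s \<inter> X s' \<times> Y s' \<noteq> {}"
    then obtain y where "y \<in> Y s" "y \<in> Y s'" by blast
    then have "dil n b (- int s) y \<in> ksphere n" "dil n b (- int s') y \<in> ksphere n" using B(3) by (auto simp: Y_def)
    from dil_sphere_unique[of n b, OF n b this] show False using \<open>s \<noteq> s'\<close> by simp
  qed
  then have "emeasure ?M (region m n a b Q B T) = (\<Sum>s<?N. emeasure ?M (X s \<times> Y s))"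
    unfolding reg using XYs by (intro sum_emeasure[symmetric]) auto
  also have "\<dots> = (\<Sum>s<?N. ennreal (measure (hprod {1..m}) Q * measure (hprod {1..n}) B))"
  proof (rule sum.cong[OF refl])
    fix s
    interpret sigma_finite_measure "hprod {1..n}"
      by (rule product_sigma_finite.sigma_finite[OF product_sigma_finite_lam]) simp
    have eB: "emeasure (hprod {1..n}) B = ennreal (measure (hprod {1..n}) B)"
      by (rule emeasure_eq_ennreal_measure) (use B(2) in auto)
    let ?w = "real_of_int (int s * int (\<Sum>i=1..m. a i))"
    have "emeasure (hprod {1..m}) (X s) = ennreal (q powr (- ?w)) * ennreal (measure (hprod {1..m}) Q)"
      unfolding X_def using emeasure_dil_vimage[OF Q(1), of a "int s"] Q(2) by (simp add: emeasure_eq_ennreal_measure)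
    moreover have "emeasure (hprod {1..n}) (Y s) = ennreal (q powr ?w) * ennreal (measure (hprod {1..n}) B)"
      unfolding Y_def ab eB[symmetric] using emeasure_dil_vimage[OF B(1), of b "- int s"] by simp
    ultimately have "emeasure ?M (X s \<times> Y s)
        = (ennreal (q powr (- ?w)) * ennreal (q powr ?w)) * (ennreal (measure (hprod {1..m}) Q) * ennreal (measure (hprod {1..n}) B))"
      using XY by (simp only: emeasure_pair_measure_Times mult_ac)
    also have "ennreal (q powr (- ?w)) * ennreal (q powr ?w) = ennreal (q powr (- ?w) * q powr ?w)"
      by (simp only: ennreal_mult powr_ge_zero)
    also have "q powr (- ?w) * q powr ?w = 1" by (simp only: powr_add[symmetric]) simp
    finally show "emeasure ?M (X s \<times> Y s) = ennreal (measure (hprod {1..m}) Q * measure (hprod {1..n}) B)"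
      by (simp add: ennreal_mult)
  qed
  also have "\<dots> = ennreal (real ?N * (measure (hprod {1..m}) Q * measure (hprod {1..n}) B))"
    by (simp only: sum_constant card_lessThan ennreal_mult of_nat_0_le_iff mult_nonneg_nonneg measure_nonneg ennreal_of_nat_eq_real_of_nat)
  finally show "emeasure ?M (region m n a b Q B T)
      = ennreal (real ?N * (measure (hprod {1..m}) Q * measure (hprod {1..n}) B))" .
qed

end

text \<open>
  Two quantities caught between the same bounds \<open>\<kappa>\<^sub>k x\<close> and \<open>\<kappa>'\<^sub>k x\<close>, up to \<open>o(x)\<close>, for bounds that
  approach each other as \<open>k\<close> grows, are asymptotic.\<close>

lemma sandwiched_ratio:
  fixes c d x :: "real \<Rightarrow> real" and \<kappa> \<kappa>' :: "nat \<Rightarrow> real"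
  assumes x: "\<forall>\<^sub>F T in at_top. 0 < x T"
    and d: "\<And>k. \<forall>\<^sub>F T in at_top. \<kappa> k * x T \<le> d T \<and> d T \<le> \<kappa>' k * x T"
    and c: "\<And>k. \<exists>f f'. (f \<longlongrightarrow> \<kappa> k) at_top \<and> (f' \<longlongrightarrow> \<kappa>' k) at_top \<and> (\<forall>\<^sub>F T in at_top. f T * x T \<le> c T \<and> c T \<le> f' T * x T)"
    and lim: "(\<lambda>k. \<kappa>' k - \<kappa> k) \<longlonglongrightarrow> 0" and \<delta>: "0 < \<delta>" "\<And>k. \<delta> \<le> \<kappa>' k"
  shows "((\<lambda>T. c T / d T) \<longlongrightarrow> 1) at_top"
proof (rule tendstoI)
  fix \<epsilon> :: real assume \<epsilon>: "0 < \<epsilon>"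
  \<comment> \<open>The bound \<open>\<delta> / 2\<close> keeps the inner constant above \<open>\<delta> / 2\<close>; the second bound makes the final
    quotient smaller than \<open>\<epsilon>\<close>.\<close>
  define \<eta> where "\<eta> = min (\<delta> / 2) (\<epsilon> * \<delta> / 8)"
  have \<eta>: "0 < \<eta>" using \<epsilon> \<delta> by (simp add: \<eta>_def)
  obtain k where k: "\<bar>\<kappa>' k - \<kappa> k\<bar> < \<eta>"
    using LIMSEQ_D[OF lim \<eta>] by auto
  obtain f f' where f: "(f \<longlongrightarrow> \<kappa> k) at_top" "(f' \<longlongrightarrow> \<kappa>' k) at_top"
    "\<forall>\<^sub>F T in at_top. f T * x T \<le> c T \<and> c T \<le> f' T * x T" using c by blast
  have "\<forall>\<^sub>F T in at_top. dist (f T) (\<kappa> k) < \<eta>" "\<forall>\<^sub>F T in at_top. dist (f' T) (\<kappa>' k) < \<eta>"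
    using f(1,2) \<eta> by (auto dest: tendstoD)
  with x d[of k] f(3) show "\<forall>\<^sub>F T in at_top. dist (c T / d T) 1 < \<epsilon>"
  proof eventually_elim
    case (elim T)
    have "\<eta> \<le> \<delta> / 2" by (simp add: \<eta>_def)
    then have kk: "\<delta> / 2 \<le> \<kappa> k" using k \<delta>(2)[of k] by linarith
    have "\<delta> / 2 * x T \<le> \<kappa> k * x T" using kk elim(1) by (intro mult_right_mono) auto
    then have d0: "\<delta> / 2 * x T \<le> d T" using elim(2) by linarith
    have dpos: "0 < d T" using d0 elim(1) \<delta>(1) by (smt (verit) half_gt_zero mult_pos_pos)
    have "(\<kappa>' k - \<eta>) * x T \<le> \<kappa> k * x T" using k elim(1) by (intro mult_right_mono) auto
    then have d1: "(\<kappa>' k - \<eta>) * x T \<le> d T" using elim(2) by linarith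
    have "\<kappa>' k * x T \<le> (\<kappa> k + \<eta>) * x T" using k elim(1) by (intro mult_right_mono) auto
    then have d2: "d T \<le> (\<kappa> k + \<eta>) * x T" using elim(2) by linarith
    have "f' T * x T \<le> (\<kappa>' k + \<eta>) * x T" using elim by (intro mult_right_mono) (auto simp: dist_real_def)
    then have c1: "c T \<le> (\<kappa>' k + \<eta>) * x T" using elim(3) by linarith
    have "(\<kappa> k - \<eta>) * x T \<le> f T * x T" using elim by (intro mult_right_mono) (auto simp: dist_real_def)
    then have c2: "(\<kappa> k - \<eta>) * x T \<le> c T" using elim(3) by linarith
    have "\<bar>c T - d T\<bar> \<le> 2 * \<eta> * x T"
      using c1 c2 d1 d2 by (simp add: algebra_simps abs_le_iff)
    also have "\<dots> \<le> (\<epsilon> * \<delta> / 4) * x T" using elim(1) by (intro mult_right_mono) (auto simp: \<eta>_def)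
    also have "\<dots> = (\<epsilon> / 2) * (\<delta> / 2 * x T)" by simp
    also have "\<dots> \<le> (\<epsilon> / 2) * d T" using d0 \<epsilon> by (intro mult_left_mono) auto
    also have "\<dots> < \<epsilon> * d T" using \<epsilon> dpos by simp
    finally have "\<bar>c T - d T\<bar> / d T < \<epsilon>" using dpos by (simp add: divide_less_eq)
    moreover have "c T / d T - 1 = (c T - d T) / d T" using dpos by (simp add: field_simps)
    ultimately show ?case using dpos by (simp add: dist_real_def)
  qed
qed

lemma outer_sphere_subset:
  assumes k: "1 \<le> k" shows "outer_approx {1..k} (int l) (ksphere k \<inter> C) \<subseteq> ksphere k"
proof
  fix x assume "x \<in> outer_approx {1..k} (int l) (ksphere k \<inter> C)"
  then obtain y where y: "x \<in> kvec k" "y \<in> ksphere k" "near {1..k} (int l) x y" by (auto simp: outer_approx_def kvec_def)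
  then show "x \<in> ksphere k" using ksphere_near[OF k y(2,1) _ near_sym[OF y(3)]] by simp
qed

lemma solutions_mono:
  assumes "Q \<subseteq> Q'" "B \<subseteq> B'"
  shows "solutions m n a Q (shell_vectors n b B) s A \<subseteq> solutions m n a Q' (shell_vectors n b B') s A"
  using assms unfolding solutions_def shell_vectors_def by blast

theorem theorem1p4:
  fixes lam :: "'a::{field,finite} fls measure"
    and m n :: nat and a :: "nat \<Rightarrow> nat" and R :: real
    and C1 C2 :: "(nat \<Rightarrow> 'a fls) set"
  assumes "haar_measure lam" and "unimodular_normalization lam"
    and "1 \<le> m" and "1 \<le> n"
    and "a \<in> weights m n"
    and "C1 \<in> sets (sphere_measure lam m)" and "C2 \<in> sets (sphere_measure lam n)"
    and "sphere_topology m frontier_of C1 \<in> null_sets (sphere_measure lam m)"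
    and "sphere_topology n frontier_of C2 \<in> null_sets (sphere_measure lam n)"
    and "\<forall>\<^sub>F T in at_top. measure (pair_vec_measure lam m n) (E_set m n a T R C1 C2) \<noteq> 0"
  shows "AE A in mat_measure lam m n.
    ((\<lambda>T. real (N_count m n a R T A C1 C2)
            / measure (pair_vec_measure lam m n) (E_set m n a T R C1 C2)) \<longlongrightarrow> 1) at_top"
proof -
  interpret haar lam by unfold_locales (rule assms)+
  have m: "1 \<le> m" and n: "1 \<le> n" by fact+
  define b where "b = (\<lambda>j. a (m + j))"
  have a: "\<And>i. i \<in> {1..m} \<Longrightarrow> 0 < a i" and b: "\<And>j. j \<in> {1..n} \<Longrightarrow> 0 < b j"
    and ab: "(\<Sum>i=1..m. a i) = (\<Sum>j=1..n. b j)"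
    using \<open>a \<in> weights m n\<close> by (auto simp: weights_def b_def)
  define tgt where "tgt = target m a R C1"
  define S where "S = ksphere n \<inter> C2"
  define E where "E = nat \<lceil>max 0 R\<rceil> * (\<Sum>i=1..m. a i) + 1"
  have tgt_bd: "x i $$ k = 0" if "x \<in> tgt" "i \<in> {1..m}" "k \<le> - int E" for x i k
    using target_bounded[OF m, of x a R C1 i k] that by (simp only: tgt_def E_def)
  have tgt_ext: "tgt \<subseteq> {1..m} \<rightarrow>\<^sub>E UNIV" by (auto simp: tgt_def target_def kvec_def)
  have S_ext: "S \<subseteq> {1..n} \<rightarrow>\<^sub>E UNIV" by (auto simp: S_def ksphere_def kvec_def)

  have "\<forall>k. \<exists>l. measure (hprod {1..m}) (outer_approx {1..m} (int l) tgt) \<le> measure (hprod {1..m}) (inner_approx {1..m} (int l) tgt) + 1 / real (Suc k)"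
    unfolding tgt_def using target_approximation[of m a, OF m a assms(8)] by simp
  then obtain L where L: "\<And>k. measure (hprod {1..m}) (outer_approx {1..m} (int (L k)) tgt) \<le> measure (hprod {1..m}) (inner_approx {1..m} (int (L k)) tgt) + 1 / real (Suc k)"
    by metis
  have "\<forall>k. \<exists>l. measure (hprod {1..n}) (outer_approx {1..n} (int l) S) \<le> measure (hprod {1..n}) (inner_approx {1..n} (int l) S) + 1 / real (Suc k)"
    unfolding S_def using sphere_approximation[OF n assms(9)] by simp
  then obtain L' where L': "\<And>k. measure (hprod {1..n}) (outer_approx {1..n} (int (L' k)) S) \<le> measure (hprod {1..n}) (inner_approx {1..n} (int (L' k)) S) + 1 / real (Suc k)"
    by metis
  \<comment> \<open>The \<open>k\<close>-th inner and outer approximations differ in volume by at most \<open>1 / (k + 1)\<close>.\<close>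
  define Qi Qo Bi Bo where "Qi = (\<lambda>k. inner_approx {1..m} (int (L k)) tgt)" and "Qo = (\<lambda>k. outer_approx {1..m} (int (L k)) tgt)"
    and "Bi = (\<lambda>k. inner_approx {1..n} (int (L' k)) S)" and "Bo = (\<lambda>k. outer_approx {1..n} (int (L' k)) S)"
  have Q_sub: "Qi k \<subseteq> tgt" "tgt \<subseteq> Qo k" and B_sub: "Bi k \<subseteq> S" "S \<subseteq> Bo k" for k
    unfolding Qi_def Qo_def Bi_def Bo_def
    by (intro inner_subset subset_outer tgt_ext S_ext)+
  have Bo_sph: "Bo k \<subseteq> ksphere n" for k unfolding Bo_def S_def by (rule outer_sphere_subset[OF n])
  have Bi_sph: "Bi k \<subseteq> ksphere n" for k using B_sub[of k] by (auto simp: S_def)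
  have Q_lev: "level_set {1..m} (\<lambda>_. int (L k)) (Qi k)" "level_set {1..m} (\<lambda>_. int (L k)) (Qo k)"
    and B_lev: "level_set {1..n} (\<lambda>_. int (L' k)) (Bi k)" "level_set {1..n} (\<lambda>_. int (L' k)) (Bo k)" for k
    unfolding Qi_def Qo_def Bi_def Bo_def by (intro level_set_inner level_set_outer)+
  have Q_bd: "x i $$ j = 0" if "x \<in> Qo k" "i \<in> {1..m}" "j \<le> - int E" for x i j k
    using tgt_bd that unfolding Qo_def by (rule outer_bounded)
  have Qi_bd: "x i $$ j = 0" if "x \<in> Qi k" "i \<in> {1..m}" "j \<le> - int E" for x i j k
    using tgt_bd[of x i j] that Q_sub by blast
  define cQ cB where "cQ = q powr real (card {1..m} * E)" and "cB = q powr real (card {1..n} * 1)"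
  have Q_le: "emeasure (hprod {1..m}) (Qo k) \<le> ennreal cQ" "emeasure (hprod {1..m}) (Qi k) \<le> ennreal cQ" for k
  proof -
    have ext: "Qo k \<subseteq> {1..m} \<rightarrow>\<^sub>E UNIV" "Qi k \<subseteq> {1..m} \<rightarrow>\<^sub>E UNIV"
      using Q_lev[of k] by (auto simp: level_set_def)
    show "emeasure (hprod {1..m}) (Qo k) \<le> ennreal cQ"
      unfolding cQ_def by (rule bounded_box[OF finite_atLeastAtMost ext(1)]) (rule Q_bd)
    show "emeasure (hprod {1..m}) (Qi k) \<le> ennreal cQ"
      unfolding cQ_def by (rule bounded_box[OF finite_atLeastAtMost ext(2)]) (rule Qi_bd)
  qed
  have B_le: "emeasure (hprod {1..n}) (Bo k) \<le> ennreal cB" "emeasure (hprod {1..n}) (Bi k) \<le> ennreal cB" for k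
  proof -
    have bd: "x i $$ j = 0" if "x \<in> ksphere n" "i \<in> {1..n}" "j \<le> - int 1" for x :: "nat \<Rightarrow> 'a fls" and i j
      using that unfolding ksphere_iff[OF n] by auto
    have bdo: "x i $$ j = 0" if "x \<in> Bo k" "i \<in> {1..n}" "j \<le> - int 1" for x i j
      using bd[of x i j] that Bo_sph by blast
    have bdi: "x i $$ j = 0" if "x \<in> Bi k" "i \<in> {1..n}" "j \<le> - int 1" for x i j
      using bd[of x i j] that Bi_sph by blast
    have ext: "Bo k \<subseteq> {1..n} \<rightarrow>\<^sub>E UNIV" "Bi k \<subseteq> {1..n} \<rightarrow>\<^sub>E UNIV"
      using B_lev[of k] by (auto simp: level_set_def)
    show "emeasure (hprod {1..n}) (Bo k) \<le> ennreal cB"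
      unfolding cB_def by (rule bounded_box[OF finite_atLeastAtMost ext(1)]) (rule bdo)
    show "emeasure (hprod {1..n}) (Bi k) \<le> ennreal cB"
      unfolding cB_def by (rule bounded_box[OF finite_atLeastAtMost ext(2)]) (rule bdi)
  qed
  have fin: "emeasure (hprod {1..m}) (Qo k) \<noteq> \<infinity>" "emeasure (hprod {1..m}) (Qi k) \<noteq> \<infinity>"
    "emeasure (hprod {1..n}) (Bo k) \<noteq> \<infinity>" "emeasure (hprod {1..n}) (Bi k) \<noteq> \<infinity>" for k
    using Q_le[of k] B_le[of k] by (auto simp: top_unique)
  have sets: "Qo k \<in> sets (hprod {1..m})" "Qi k \<in> sets (hprod {1..m})" "Bo k \<in> sets (hprod {1..n})" "Bi k \<in> sets (hprod {1..n})" for k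
    using level_set_sets[OF _ Q_lev(1)] level_set_sets[OF _ Q_lev(2)] level_set_sets[OF _ B_lev(1)] level_set_sets[OF _ B_lev(2)] by simp_all
  define \<kappa> \<kappa>' where "\<kappa> = (\<lambda>k. measure (hprod {1..m}) (Qi k) * measure (hprod {1..n}) (Bi k))"
    and "\<kappa>' = (\<lambda>k. measure (hprod {1..m}) (Qo k) * measure (hprod {1..n}) (Bo k))"
  define x where "x = (\<lambda>T::real. real (nat \<lfloor>T\<rfloor> + 1))"
  define vol where "vol = (\<lambda>T. measure (pair_vec_measure lam m n) (E_set m n a T R C1 C2))"
  define Sol where "Sol = solutions m n a tgt (shell_vectors n b S)"
  define Sol_i where "Sol_i = (\<lambda>k. solutions m n a (Qi k) (shell_vectors n b (Bi k)))"
  define Sol_o where "Sol_o = (\<lambda>k. solutions m n a (Qo k) (shell_vectors n b (Bo k)))"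
  have x_pos: "0 < x T" for T :: real by (simp add: x_def)

  have Sol_o_fin: "finite (Sol_o k s A)" for k s A
    unfolding Sol_o_def by (rule shell_solutions_law(2)[where e = "L k" and l = "L' k" and E = E])
      (fact m | fact n | fact ab | erule a | erule b | rule Q_lev(2) Q_bd Bo_sph B_lev(2); assumption)+
  have sub: "Sol_i k s A \<subseteq> Sol s A" "Sol s A \<subseteq> Sol_o k s A" for k s A
    unfolding Sol_def Sol_i_def Sol_o_def by (intro solutions_mono Q_sub B_sub)+
  have Sol_fin: "finite (Sol s A)" for s A using sub(2)[of s A 0] Sol_o_fin by (rule finite_subset)

  have vol_bounds: "\<kappa> k * x T \<le> vol T \<and> vol T \<le> \<kappa>' k * x T" if T: "0 \<le> T" and nz: "vol T \<noteq> 0" for k T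
  proof -
    let ?M = "hprod {1..m} \<Otimes>\<^sub>M hprod {1..n}"
    have pv: "pair_vec_measure lam m n = completion ?M" by (simp add: pair_vec_measure_def vec_measure_eq)
    have E: "E_set m n a T R C1 C2 = region m n a b tgt S T"
      unfolding tgt_def S_def b_def by (rule E_set_eq[OF m n]) (erule a, erule b[unfolded b_def])
    have v: "vol T = measure (completion ?M) (region m n a b tgt S T)" by (simp add: vol_def pv E)
    have Em: "region m n a b tgt S T \<in> sets (completion ?M)"
      using nz unfolding v by (metis measure_notin_sets)
    note ri = region_measure[of n b a m, OF n b ab sets(2) fin(2) sets(4) fin(4) Bi_sph T]
    note ro = region_measure[of n b a m, OF n b ab sets(1) fin(1) sets(3) fin(3) Bo_sph T]
    have mi: "measure (completion ?M) (region m n a b (Qi k) (Bi k) T) = \<kappa> k * x T"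
      using ri[of k] by (simp add: measure_def \<kappa>_def x_def)
    have mo: "measure (completion ?M) (region m n a b (Qo k) (Bo k) T) = \<kappa>' k * x T"
      using ro[of k] by (simp add: measure_def \<kappa>'_def x_def)
    have of: "region m n a b (Qo k) (Bo k) T \<in> fmeasurable (completion ?M)"
      using ro[of k] by (intro fmeasurableI) (auto intro: sets_completionI_sets)
    have s1: "region m n a b (Qi k) (Bi k) T \<subseteq> region m n a b tgt S T"
      and s2: "region m n a b tgt S T \<subseteq> region m n a b (Qo k) (Bo k) T"
      by (intro region_mono Q_sub B_sub)+
    have "region m n a b tgt S T \<in> fmeasurable (completion ?M)" by (rule fmeasurableI2[OF of s2 Em])
    then have "measure (completion ?M) (region m n a b (Qi k) (Bi k) T) \<le> vol T"
      unfolding v using ri(1)[of k] by (intro measure_mono_fmeasurable[OF s1]) (auto intro: sets_completionI_sets)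
    moreover have "vol T \<le> measure (completion ?M) (region m n a b (Qo k) (Bo k) T)"
      unfolding v by (intro measure_mono_fmeasurable[OF s2 Em of])
    ultimately show ?thesis unfolding mi mo by (rule conjI)
  qed

  have vol_nz: "\<forall>\<^sub>F T in at_top. vol T \<noteq> 0" using assms(10) by (simp add: vol_def)
  have "\<forall>\<^sub>F T in at_top. 0 \<le> T \<and> vol T \<noteq> 0" using vol_nz eventually_ge_at_top[of 0] by eventually_elim simp
  then obtain T1 where T1: "0 \<le> T1" "vol T1 \<noteq> 0"
    using eventually_happens'[OF trivial_limit_at_top_linorder] by blast
  \<comment> \<open>A single \<open>T1\<close> with positive volume bounds all the outer constants away from 0.\<close>
  define \<delta> where "\<delta> = vol T1 / x T1"
  have \<delta>: "0 < \<delta>" using T1(2) x_pos[of T1] by (simp add: \<delta>_def vol_def zero_less_measure_iff)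
  have \<delta>_le: "\<delta> \<le> \<kappa>' k" for k
    using vol_bounds[OF T1, of k] x_pos[of T1] by (simp add: \<delta>_def divide_le_eq)

  have \<kappa>_lim: "(\<lambda>k. \<kappa>' k - \<kappa> k) \<longlonglongrightarrow> 0"
  proof (rule tendsto_sandwich[of "\<lambda>_. 0" _ _ "\<lambda>k. (cQ + cB) * (1 / real (Suc k))"])
    have le: "measure (hprod {1..m}) (Qi k) \<le> measure (hprod {1..m}) (Qo k)"
      "measure (hprod {1..n}) (Bi k) \<le> measure (hprod {1..n}) (Bo k)" for k
      using Q_sub[of k] B_sub[of k] sets[of k] fin[of k]
      by (intro measure_mono_fmeasurable; auto simp: fmeasurable_def less_top)+
    have mQ: "measure (hprod {1..m}) (Qi k) \<le> cQ" and mB: "measure (hprod {1..n}) (Bo k) \<le> cB" for k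
      using Q_le[of k] B_le[of k] by (auto simp: measure_def cQ_def cB_def intro!: enn2real_leI)
    show "\<forall>\<^sub>F k in sequentially. 0 \<le> \<kappa>' k - \<kappa> k"
      unfolding \<kappa>_def \<kappa>'_def using le by (intro always_eventually allI) (simp add: mult_mono)
    show "\<forall>\<^sub>F k in sequentially. \<kappa>' k - \<kappa> k \<le> (cQ + cB) * (1 / real (Suc k))"
    proof (intro always_eventually allI)
      fix k
      let ?Q = "measure (hprod {1..m})" and ?B = "measure (hprod {1..n})"
      have "\<kappa>' k - \<kappa> k = (?Q (Qo k) - ?Q (Qi k)) * ?B (Bo k) + ?Q (Qi k) * (?B (Bo k) - ?B (Bi k))"
        by (simp add: \<kappa>_def \<kappa>'_def algebra_simps)
      also have "\<dots> \<le> (1 / real (Suc k)) * cB + cQ * (1 / real (Suc k))"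
        using L[of k] L'[of k] le[of k] mQ[of k] mB[of k]
        unfolding Qi_def Qo_def Bi_def Bo_def
        by (intro add_mono mult_mono) (auto simp: cQ_def)
      also have "\<dots> = (cQ + cB) * (1 / real (Suc k))" by (simp only: distrib_right mult.commute add.commute)
      finally show "\<kappa>' k - \<kappa> k \<le> (cQ + cB) * (1 / real (Suc k))" .
    qed
    show "(\<lambda>k. (cQ + cB) * (1 / real (Suc k))) \<longlonglongrightarrow> 0"
      using tendsto_mult[OF tendsto_const LIMSEQ_Suc[OF lim_1_over_n], of "cQ + cB"] by simp
  qed simp

  have law_i: "AE A in hprod ({1..m} \<times> {1..n}). (\<lambda>N. (\<Sum>s<N. real (card (Sol_i k s A))) / real N) \<longlonglongrightarrow> \<kappa> k" for k
    unfolding Sol_i_def \<kappa>_def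
    by (rule shell_solutions_law(1)[where e = "L k" and l = "L' k" and E = E])
      (fact m | fact n | fact ab | erule a | erule b | rule Q_lev(1) Qi_bd Bi_sph B_lev(1); assumption)+
  have law_o: "AE A in hprod ({1..m} \<times> {1..n}). (\<lambda>N. (\<Sum>s<N. real (card (Sol_o k s A))) / real N) \<longlonglongrightarrow> \<kappa>' k" for k
    unfolding Sol_o_def \<kappa>'_def
    by (rule shell_solutions_law(1)[where e = "L k" and l = "L' k" and E = E])
      (fact m | fact n | fact ab | erule a | erule b | rule Q_lev(2) Q_bd Bo_sph B_lev(2); assumption)+
  have floor_lim: "filterlim (\<lambda>T::real. nat \<lfloor>T\<rfloor> + 1) at_top at_top"
    unfolding filterlim_at_top
  proof
    fix Z :: nat
    show "\<forall>\<^sub>F T in at_top. Z \<le> nat \<lfloor>T :: real\<rfloor> + 1"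
      using eventually_ge_at_top[of "real Z"] by eventually_elim linarith
  qed
  have "AE A in hprod ({1..m} \<times> {1..n}). \<forall>k. (\<lambda>N. (\<Sum>s<N. real (card (Sol_i k s A))) / real N) \<longlonglongrightarrow> \<kappa> k"
    "AE A in hprod ({1..m} \<times> {1..n}). \<forall>k. (\<lambda>N. (\<Sum>s<N. real (card (Sol_o k s A))) / real N) \<longlonglongrightarrow> \<kappa>' k"
    unfolding AE_all_countable using law_i law_o by blast+
  then have "AE A in hprod ({1..m} \<times> {1..n}). ((\<lambda>T. real (N_count m n a R T A C1 C2) / vol T) \<longlongrightarrow> 1) at_top"
  proof eventually_elim
    case (elim A)
    show ?case
    proof (rule sandwiched_ratio[OF _ _ _ \<kappa>_lim \<delta> \<delta>_le])
      show "\<forall>\<^sub>F T in at_top. 0 < x T" using x_pos by (intro always_eventually allI)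
      show "\<forall>\<^sub>F T in at_top. \<kappa> k * x T \<le> vol T \<and> vol T \<le> \<kappa>' k * x T" for k
        using vol_nz eventually_ge_at_top[of 0] by eventually_elim (rule vol_bounds)
      fix k
      define f where "f = (\<lambda>T::real. (\<Sum>s<nat \<lfloor>T\<rfloor> + 1. real (card (Sol_i k s A))) / real (nat \<lfloor>T\<rfloor> + 1))"
      define f' where "f' = (\<lambda>T::real. (\<Sum>s<nat \<lfloor>T\<rfloor> + 1. real (card (Sol_o k s A))) / real (nat \<lfloor>T\<rfloor> + 1))"
      have "(f \<longlongrightarrow> \<kappa> k) at_top"
        unfolding f_def by (rule filterlim_compose[OF _ floor_lim]) (use elim(1) in blast)
      moreover have "(f' \<longlongrightarrow> \<kappa>' k) at_top"
        unfolding f'_def by (rule filterlim_compose[OF _ floor_lim]) (use elim(2) in blast)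
      moreover have "\<forall>\<^sub>F T in at_top. f T * x T \<le> real (N_count m n a R T A C1 C2)
          \<and> real (N_count m n a R T A C1 C2) \<le> f' T * x T"
        using eventually_ge_at_top[of 0]
      proof eventually_elim
        case (elim T)
        have N: "N_count m n a R T A C1 C2 = (\<Sum>s<nat \<lfloor>T\<rfloor> + 1. card (Sol s A))"
          using N_count_eq[of m n a T R C1 C2 A, OF m n a b[unfolded b_def] elim] Sol_fin
          unfolding Sol_def tgt_def S_def b_def by blast
        have "f T * x T = (\<Sum>s<nat \<lfloor>T\<rfloor> + 1. real (card (Sol_i k s A)))" by (simp add: f_def x_def)
        moreover have "f' T * x T = (\<Sum>s<nat \<lfloor>T\<rfloor> + 1. real (card (Sol_o k s A)))" by (simp add: f'_def x_def)
        ultimately show ?case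
          unfolding N of_nat_sum by (auto intro!: sum_mono of_nat_mono card_mono sub Sol_fin Sol_o_fin simp del: sum.lessThan_Suc)
      qed
      ultimately show "\<exists>f f'. (f \<longlongrightarrow> \<kappa> k) at_top \<and> (f' \<longlongrightarrow> \<kappa>' k) at_top
          \<and> (\<forall>\<^sub>F T in at_top. f T * x T \<le> real (N_count m n a R T A C1 C2) \<and> real (N_count m n a R T A C1 C2) \<le> f' T * x T)"
        by blast
    qed
  qed
  then show ?thesis by (simp only: mat_measure_def vol_def)
qed

end
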